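(* Almost surely, the sequence of finite measures $A\mapsto Z_n(nA)$ satisfies a large deviation principle with rate function $\tilde\Lambda^*$: almost surely, for each measurable (Borel) subset $A$ of $\mathbb{R}$, $$-\inf_{x\in A^o}\tilde\Lambda^*(x)\le \liminf_{n\to\infty}\frac1n\log Z_n(nA)\le \limsup_{n\to\infty}\frac1n\log Z_n(nA)\le -\inf_{x\in\bar A}\tilde\Lambda^*(x),$$ where $A^o$ denotes the interior of $A$ and $\bar A$ its closure.
   Context: Branching random walk in a random environment in time. Let $\xi=(\xi_n)_{n\ge 0}$ be a stationary and ergodic sequence of random variables with values in a measurable space $\Theta$; each realization of $\xi_n$ determines a probability distribution $\eta_n=\eta(\xi_n)$ on $\mathbb{N}\times\mathbb{R}\times\mathbb{R}\times\cdots$. Given $\xi$ (quenched law $\mathbb{P}_\xi$, expectation $\mathbb{E}_\xi$), let $X(u)=(N(u),L_1(u),L_2(u),\dots)$, indexed by finite sequences $u\in\{\emptyset\}\cup\bigcup_{n\ge1}\mathbb{N}^n$, be independent random vectors, $X(u)$ having law $\eta_n$ when the length $|u|$ equals $n$ (values $L_i(u)$ with $i>N(u)$ play no role in the process). The initial particle $\emptyset$ is at $S_\emptyset=0$; each particle $u$ of generation $n$, located at $S_u$, is replaced by $N(u)$ particles $ui$ of generation $n+1$ located at $S_{ui}=S_u+L_i(u)$, $1\le i\le N(u)$. Let $\mathbb{T}_n$ be the set of particles of generation $n$ and $Z_n=\sum_{u\in\mathbb{T}_n}\delta_{S_u}$ their counting measure. The annealed law $\mathbb{P}$ (expectation $\mathbb{E}$)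 is $\mathbb{P}_\xi$ integrated against the law of $\xi$; "a.s." refers to $\mathbb{P}$. Write $N=N(\emptyset)$, $L_i=L_i(\emptyset)$, and $m_n=\mathbb{E}_\xi N(u)$ for $|u|=n$. Standing assumptions: $\mathbb{E}\log m_0\in(0,\infty)$ and $\mathbb{E}\frac{N}{m_0}\log^+N<\infty$; $N\ge1$ a.s.; and, with $m_0(t)=\mathbb{E}_\xi\sum_{i=1}^{N}e^{tL_i}$, $\mathbb{E}|L_1|<\infty$, $\mathbb{E}|\log m_0(t)|<\infty$ and $\mathbb{E}\left|\frac{m_0'(t)}{m_0(t)}\right|<\infty$ for all $t\in\mathbb{R}$. Notation: $\Lambda(t)=\mathbb{E}\log m_0(t)$, which is differentiable with $\Lambda'(t)=\mathbb{E}\frac{m_0'(t)}{m_0(t)}$; $t_-=\inf\{t\in\mathbb{R}:t\Lambda'(t)-\Lambda(t)\le0\}$, $t_+=\sup\{t\in\mathbb{R}:t\Lambda'(t)-\Lambda(t)\le0\}$, so $-\infty\le t_-<0<t_+\le\infty$. Define $\tilde\Lambda(t)=\Lambda(t)$ if $t\in(t_-,t_+)$, $\tilde\Lambda(t)=t\Lambda'(t_+)$ if $t\ge t_+$, $\tilde\Lambda(t)=t\Lambda'(t_-)$ if $t\le t_-$ (for real $t$), and its Legendre transform $\tilde\Lambda^*(x)=\sup_{t\in\mathbb{R}}\{xt-\tilde\Lambda(t)\}$. Also $nA=\{nx:x\in A\}$; $\log0=-\infty$ and $\inf\emptyset=+\infty$. *)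

theory Defs
  imports "HOL-Probability.Probability"
begin

text \<open>Extended logarithm, with \<open>log 0 = -\<infinity>\<close> and \<open>log \<infinity> = \<infinity>\<close>.\<close>

definition elog :: "ennreal \<Rightarrow> ereal" where
  "elog x = (if x = 0 then -\<infinity> else if x = \<infinity> then \<infinity> else ereal (ln (enn2real x)))"

definition stationary_ergodic ::
    "'w measure \<Rightarrow> 'e measure \<Rightarrow> (nat \<Rightarrow> 'w \<Rightarrow> 'e) \<Rightarrow> bool" where
  "stationary_ergodic M \<Theta> \<xi> \<longleftrightarrow>
     (\<forall>n. \<xi> n \<in> M \<rightarrow>\<^sub>M \<Theta>) \<and>
     distr M (\<Pi>\<^sub>M n\<in>UNIV. \<Theta>) (\<lambda>\<omega> n. \<xi> (Suc n) \<omega>) = distr M (\<Pi>\<^sub>M n\<in>UNIV. \<Theta>) (\<lambda>\<omega> n. \<xi> n \<omega>) \<and>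
     (\<forall>A \<in> sets (\<Pi>\<^sub>M n\<in>UNIV. \<Theta>).
        (\<lambda>e n. e (Suc n)) -` A \<inter> space (\<Pi>\<^sub>M n\<in>UNIV. \<Theta>) = A \<longrightarrow>
        measure M {\<omega> \<in> space M. (\<lambda>n. \<xi> n \<omega>) \<in> A} \<in> {0, 1})"

text \<open>
  A mark \<open>(N, l)\<close> encodes \<open>(N, L\<^sub>1, L\<^sub>2, \<dots>)\<close>.  Children and displacements are numbered from \<open>0\<close>
  throughout: \<open>l i\<close> is \<open>L\<close> with index \<open>i + 1\<close>, and a particle \<open>u :: nat list\<close> has the children
  \<open>u @ [i]\<close> with \<open>i < N(u)\<close>.
\<close>

type_synonym mark = "nat \<times> (nat \<Rightarrow> real)"

definition mark_space :: "mark measure" where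
  "mark_space = count_space UNIV \<Otimes>\<^sub>M (\<Pi>\<^sub>M i\<in>UNIV. borel)"

definition quenched_law :: "('e \<Rightarrow> mark measure) \<Rightarrow> (nat \<Rightarrow> 'e) \<Rightarrow> (nat list \<Rightarrow> mark) measure" where
  "quenched_law \<eta> e = (\<Pi>\<^sub>M u\<in>UNIV. \<eta> (e (length u)))"

text \<open>
  The last condition says that the quenched law is a (regular) conditional distribution of the
  family \<open>X\<close> given the environment; equivalently, the joint law of \<open>(\<xi>, X)\<close> is the annealed law.
\<close>

definition bwre ::
    "'w measure \<Rightarrow> 'e measure \<Rightarrow> ('e \<Rightarrow> mark measure) \<Rightarrow> (nat \<Rightarrow> 'w \<Rightarrow> 'e) \<Rightarrow>
     (nat list \<Rightarrow> 'w \<Rightarrow> mark) \<Rightarrow> bool" where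
  "bwre M \<Theta> \<eta> \<xi> X \<longleftrightarrow>
     prob_space M \<and> stationary_ergodic M \<Theta> \<xi> \<and>
     \<eta> \<in> \<Theta> \<rightarrow>\<^sub>M prob_algebra mark_space \<and>
     (\<forall>u. X u \<in> M \<rightarrow>\<^sub>M mark_space) \<and>
     (\<forall>A \<in> sets (\<Pi>\<^sub>M n\<in>UNIV. \<Theta>). \<forall>B \<in> sets (\<Pi>\<^sub>M u\<in>UNIV. mark_space).
        emeasure M {\<omega> \<in> space M. (\<lambda>n. \<xi> n \<omega>) \<in> A \<and> (\<lambda>u. X u \<omega>) \<in> B} =
        (\<integral>\<^sup>+\<omega>. indicator A (\<lambda>n. \<xi> n \<omega>) * emeasure (quenched_law \<eta> (\<lambda>n. \<xi> n \<omega>)) B \<partial>M))"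

text \<open>
  For a family of marks \<open>x\<close>: the set of particles of generation \<open>n\<close>, the position \<open>S\<^sub>u\<close>
  (the sum of the displacements along the ancestral line of \<open>u\<close>), and
  \<open>Z\<^sub>n = \<Sum> \<delta>\<^bsub>S\<^sub>u\<^esub>\<close> as the image of counting measure on generation \<open>n\<close>.
\<close>

primrec generation :: "(nat list \<Rightarrow> mark) \<Rightarrow> nat \<Rightarrow> nat list set" where
  "generation x 0 = {[]}"
| "generation x (Suc n) = {u @ [i] | u i. u \<in> generation x n \<and> i < fst (x u)}"

definition position :: "(nat list \<Rightarrow> mark) \<Rightarrow> nat list \<Rightarrow> real" where
  "position x u = (\<Sum>k<length u. snd (x (take k u)) (u ! k))"

lemma position_Nil: "position x [] = 0"
  by (simp add: position_def)

lemma position_snoc: "position x (u @ [i]) = position x u + snd (x u) i"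
  by (simp add: position_def nth_append)

definition Z :: "(nat list \<Rightarrow> mark) \<Rightarrow> nat \<Rightarrow> real measure" where
  "Z x n = distr (count_space (generation x n)) borel (position x)"

text \<open>
  The random variables \<open>m\<^sub>0\<close> and \<open>m\<^sub>0(t)\<close> as functions of the environment \<open>e\<close>.  They are
  \<open>[0,\<infinity>]\<close>-valued, so that finiteness of moments is a genuine hypothesis.
\<close>

definition m0 :: "('e \<Rightarrow> mark measure) \<Rightarrow> (nat \<Rightarrow> 'e) \<Rightarrow> ennreal" where
  "m0 \<eta> e = (\<integral>\<^sup>+x. of_nat (fst (x [])) \<partial>quenched_law \<eta> e)"

definition m0_fun :: "('e \<Rightarrow> mark measure) \<Rightarrow> (nat \<Rightarrow> 'e) \<Rightarrow> real \<Rightarrow> ennreal" where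
  "m0_fun \<eta> e t = (\<integral>\<^sup>+x. (\<Sum>i<fst (x []). ennreal (exp (t * snd (x []) i))) \<partial>quenched_law \<eta> e)"

text \<open>
  \<open>m\<^sub>0'(t) / m\<^sub>0(t)\<close>; if \<open>m\<^sub>0(t)\<close> is almost surely finite for each \<open>t\<close>, then almost surely
  it is finite for all \<open>t\<close> simultaneously, so \<^const>\<open>enn2real\<close> is harmless here.
\<close>

definition m0_log_deriv :: "('e \<Rightarrow> mark measure) \<Rightarrow> (nat \<Rightarrow> 'e) \<Rightarrow> real \<Rightarrow> real" where
  "m0_log_deriv \<eta> e t =
     deriv (\<lambda>s. enn2real (m0_fun \<eta> e s)) t / enn2real (m0_fun \<eta> e t)"

definition Lam :: "'w measure \<Rightarrow> ('e \<Rightarrow> mark measure) \<Rightarrow> (nat \<Rightarrow> 'w \<Rightarrow> 'e) \<Rightarrow> real \<Rightarrow> real" where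
  "Lam M \<eta> \<xi> t = (\<integral>\<omega>. real_of_ereal (elog (m0_fun \<eta> (\<lambda>n. \<xi> n \<omega>) t)) \<partial>M)"

text \<open>The remaining notions depend only on a function \<open>\<Lambda>\<close>.\<close>

definition t_minus :: "(real \<Rightarrow> real) \<Rightarrow> ereal" where
  "t_minus \<Lambda> = Inf (ereal ` {t. t * deriv \<Lambda> t - \<Lambda> t \<le> 0})"

definition t_plus :: "(real \<Rightarrow> real) \<Rightarrow> ereal" where
  "t_plus \<Lambda> = Sup (ereal ` {t. t * deriv \<Lambda> t - \<Lambda> t \<le> 0})"

text \<open>
  \<^const>\<open>real_of_ereal\<close> is only applied to finite values: if \<open>t\<^sub>- < 0 < t\<^sub>+\<close>, then \<open>t\<^sub>+ \<le> t\<close>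
  (resp. \<open>t \<le> t\<^sub>-\<close>) for a real \<open>t\<close> forces \<open>t\<^sub>+\<close> (resp. \<open>t\<^sub>-\<close>) to be real.
\<close>

definition Lam_tilde :: "(real \<Rightarrow> real) \<Rightarrow> real \<Rightarrow> real" where
  "Lam_tilde \<Lambda> t =
     (if t_minus \<Lambda> < ereal t \<and> ereal t < t_plus \<Lambda> then \<Lambda> t
      else if t_plus \<Lambda> \<le> ereal t then t * deriv \<Lambda> (real_of_ereal (t_plus \<Lambda>))
      else t * deriv \<Lambda> (real_of_ereal (t_minus \<Lambda>)))"

definition legendre :: "(real \<Rightarrow> real) \<Rightarrow> real \<Rightarrow> ereal" where
  "legendre f x = (SUP t. ereal (x * t - f t))"

end

theory Submission imports Defs "HOL-Real_Asymp.Real_Asymp"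
begin

text \<open>
  Upper bound: the quenched mean of \<open>\<Sum>u. e^(t S_u)\<close> over generation \<open>n\<close> is the product of the
  \<open>m_k(t)\<close>, so by Birkhoff's theorem, Markov's inequality and Borel-Cantelli the sum is eventually
  at most \<open>e^(n (\<Lambda>(t) + \<delta>))\<close>, simultaneously for all rational \<open>t\<close>. As \<open>Z\<^sub>n\<close> is integer valued, a
  half line on which this makes the count less than 1 contains no particle at all; this is how
  \<open>\<Lambda>\<close> gets replaced by its linear continuation beyond \<open>t\<^sub>-\<close> and \<open>t\<^sub>+\<close>.
  A closed set is split at \<open>\<Lambda>'(0)\<close> into two pieces, each contained in a half line.

  Lower bound, for \<open>t \<Lambda>'(t) < \<Lambda>(t)\<close>: count the particles whose whole ancestral path stays within
  distance \<open>\<epsilon> n\<close> of the line of slope \<open>\<Lambda>'(t)\<close>, only the first \<open>c\<close> children of each particle being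
  kept. Chernoff's inequality at \<open>t \<plusminus> r\<close> bounds the mean of this count below by
  \<open>e^(n (\<Lambda>(t) - t \<Lambda>'(t) - O(\<epsilon>)))\<close>. For a path confined to the tube the second moment exceeds the
  squared mean by at most \<open>e^(O(\<epsilon> n))\<close>, so by Paley-Zygmund the count is of the right order with
  probability at least \<open>e^(- O(\<epsilon> n))\<close>. Since \<open>N \<ge> 1\<close>, the harmonic mean of \<open>Z\<^sub>n\<close> grows
  exponentially, so that generation \<open>\<beta> n\<close> offers \<open>e^(\<gamma> \<beta> n)\<close> independent trials with
  \<open>\<epsilon>\<close> much smaller than \<open>\<gamma> \<beta>\<close>; one of them succeeds almost surely. Integrability of \<open>L\<^sub>1\<close> makes the
  logarithmic mean of the truncated process converge to \<open>\<Lambda>(t)\<close> as \<open>c\<close> tends to infinity.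
\<close>

section \<open>Birkhoff's ergodic theorem\<close>

text \<open>The hypotheses bound no second moment of N, and the weights \<open>exp (t * S_u)\<close>
  are unbounded; this shapes the lower bound. Keeping at most \<open>c\<close> children bounds the
  pairs that split at one particle, and inside the tube the weights are deterministic up to factors
  \<open>exp (O(\<epsilon> n))\<close>. Relative to the squared mean, pairs that split at time
  \<open>j\<close> weigh about \<open>exp (- j * (\<Lambda> t - t * \<Lambda>'(t)))\<close>, so the
  sign of \<open>t * \<Lambda>'(t) - \<Lambda> t\<close> decides whether the second moment is
  usable. The success probability still decays exponentially, but at a rate that can be made smaller
  than the growth rate of the number of trials. Generations of the environment are dependent, so
  nothing averages over it: quenched bounds are inductions that split off the root and shift the
  environment, hence are stated for any sequence \<open>\<nu>\<close> of offspring laws and any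
  start \<open>s\<close>. Birkhoff's theorem is used with error \<open>\<delta> * n + C\<close>; a
  window that starts at generation \<open>\<beta> n\<close> is then a difference of two initial
  segments. Almost sure bounds are kept to countably many \<open>t\<close>; the passage to all Borel
  sets is deterministic.\<close>

locale ergodic_map = prob_space M for M :: "'a measure" +
  fixes T :: "'a \<Rightarrow> 'a"
  assumes T_meas [measurable]: "T \<in> M \<rightarrow>\<^sub>M M"
    and T_inv: "distr M M T = M"
    and T_ergodic: "\<And>A. A \<in> sets M \<Longrightarrow> T -` A \<inter> space M = A \<Longrightarrow> prob A \<in> {0, 1}"
begin

text \<open>This is the maximum of 0 and the first n Birkhoff sums of \<open>f\<close>; the
  recursive form is the identity behind the maximal ergodic theorem.\<close>

primrec max_sum :: "('a \<Rightarrow> real) \<Rightarrow> nat \<Rightarrow> 'a \<Rightarrow> real" where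
  "max_sum f 0 x = 0"
| "max_sum f (Suc n) x = max 0 (f x + max_sum f n (T x))"

lemma max_sum_nonneg: "0 \<le> max_sum f n x"
  by (cases n) auto

lemma max_sum_Suc: "max_sum f n x \<le> max_sum f (Suc n) x"
proof (induction n arbitrary: x)
  case (Suc n)
  show ?case unfolding max_sum.simps(2)[of f "Suc n"] max_sum.simps(2)[of f n]
    using Suc[of "T x"] by (intro max.mono add_left_mono) auto
qed simp

lemma max_sum_mono: "m \<le> n \<Longrightarrow> max_sum f m x \<le> max_sum f n x"
  by (rule lift_Suc_mono_le[of "\<lambda>n. max_sum f n x"]) (rule max_sum_Suc)

lemma birkhoff_sum_le_max_sum: "(\<Sum>k<n. f ((T ^^ k) x)) \<le> max_sum f n x"
proof (induction n arbitrary: x)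
  case (Suc n)
  have "(\<Sum>k<Suc n. f ((T ^^ k) x)) = f x + (\<Sum>k<n. f ((T ^^ k) (T x)))"
    by (simp add: sum.lessThan_Suc_shift funpow_swap1 del: sum.lessThan_Suc)
  also have "\<dots> \<le> max_sum f (Suc n) x"
    using Suc[of "T x"] by simp
  finally show ?case .
qed simp

lemma max_sum_measurable [measurable]:
  assumes [measurable]: "f \<in> borel_measurable M"
  shows "max_sum f n \<in> borel_measurable M"
proof (induction n)
  case (Suc n)
  note [measurable] = Suc
  show ?case by simp
qed simp

lemma integrable_comp_T:
  assumes "integrable M (g :: 'a \<Rightarrow> real)"
  shows "integrable M (\<lambda>x. g (T x))"
  by (rule integrable_distr[OF T_meas]) (use assms T_inv in simp)

lemma integral_comp_T:
  assumes [measurable]: "(g :: 'a \<Rightarrow> real) \<in> borel_measurable M"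
  shows "(\<integral>x. g (T x) \<partial>M) = (\<integral>x. g x \<partial>M)"
  using integral_distr[OF T_meas, of g] assms unfolding T_inv by simp

lemma max_sum_integrable:
  assumes "integrable M (f :: 'a \<Rightarrow> real)"
  shows "integrable M (max_sum f n)"
proof (induction n)
  case (Suc n)
  have "integrable M (\<lambda>x. max 0 (f x + max_sum f n (T x)))"
    using assms integrable_comp_T[OF Suc]
    by (intro integrable_max Bochner_Integration.integrable_add integrable_zero)
  then show ?case by simp
qed simp

text \<open>The increments \<open>max_sum f (n + 1) - max_sum f n \<circ> T\<close> have nonnegative integral; where
  \<open>max_sum f\<close> is unbounded they converge to \<open>f\<close>, and this set is invariant.\<close>

lemma birkhoff_sums_bounded_above:
  assumes f: "integrable M (f :: 'a \<Rightarrow> real)" and neg: "(\<integral>x. f x \<partial>M) < 0"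
  shows "AE x in M. \<exists>C::real. \<forall>n. (\<Sum>k<n. f ((T ^^ k) x)) \<le> C"
proof -
  have fm [measurable]: "f \<in> borel_measurable M" using f by simp
  define U where "U x \<longleftrightarrow> (\<forall>C::nat. \<exists>n. real C < max_sum f n x)" for x
  define A where "A = {x \<in> space M. U x}"
  have A [measurable]: "A \<in> sets M" unfolding A_def U_def by measurable
  have Tsp: "T x \<in> space M" if "x \<in> space M" for x
    using measurable_space[OF T_meas that] .
  have iff: "U (T x) = U x" for x
    unfolding U_def
  proof safe
    fix C :: nat assume *: "\<forall>C::nat. \<exists>n. real C < max_sum f n (T x)"
    obtain C' :: nat where "C + \<bar>f x\<bar> \<le> C'" using real_arch_simple by blast
    moreover obtain n where "real C' < max_sum f n (T x)" using * by blast
    ultimately have "real C < max_sum f (Suc n) x" by auto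
    then show "\<exists>n. real C < max_sum f n x" by blast
  next
    fix C :: nat assume *: "\<forall>C::nat. \<exists>n. real C < max_sum f n x"
    obtain C' :: nat where "C + \<bar>f x\<bar> \<le> C'" using real_arch_simple by blast
    moreover obtain n where n: "real C' < max_sum f n x" using * by blast
    moreover obtain k where "n = Suc k" using n by (cases n) auto
    ultimately have "real C < max_sum f k (T x)" by (auto simp: max_def split: if_splits)
    then show "\<exists>n. real C < max_sum f n (T x)" by blast
  qed
  have inv: "T -` A \<inter> space M = A"
    unfolding A_def using iff Tsp by auto
  have "prob A \<noteq> 1"
  proof
    assume "prob A = 1"
    then have AE_A: "AE x in M. x \<in> A" using A by (simp add: prob_eq_1)
    define D where "D n x = max_sum f (Suc n) x - max_sum f n (T x)" for n x
    \<comment> \<open>As \<open>max_sum\<close> is nonnegative, this form shows both that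
      \<open>D n\<close> is dominated by \<open>\<bar>f\<bar>\<close> and that it equals
      \<open>f\<close> once \<open>max_sum f n (T x)\<close> exceeds
      \<open>\<bar>f x\<bar>\<close>.\<close>
    have D_eq: "D n x = max (- max_sum f n (T x)) (f x)" for n x by (simp add: D_def max_def)
    have "(\<lambda>n. \<integral>x. D n x \<partial>M) \<longlonglongrightarrow> (\<integral>x. f x \<partial>M)"
    proof (rule integral_dominated_convergence[where w="\<lambda>x. \<bar>f x\<bar>"])
      show "AE x in M. (\<lambda>n. D n x) \<longlonglongrightarrow> f x"
        using AE_A
      proof eventually_elim
        case (elim x)
        obtain C :: nat where C: "\<bar>f x\<bar> \<le> C" using real_arch_simple by blast
        obtain n where n: "real C < max_sum f n (T x)" using elim iff[of x] unfolding A_def U_def by blast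
        have "D k x = f x" if "k \<ge> n" for k
        proof -
          have "\<bar>f x\<bar> < max_sum f k (T x)" using max_sum_mono[OF that, of f "T x"] n C by linarith
          then show ?thesis by (simp add: D_eq max_def)
        qed
        then have "eventually (\<lambda>k. D k x = f x) sequentially" by (auto simp: eventually_sequentially)
        then show ?case by (rule tendsto_eventually)
      qed
      show "AE x in M. norm (D n x) \<le> \<bar>f x\<bar>" for n
      proof (intro AE_I2)
        fix x
        show "norm (D n x) \<le> \<bar>f x\<bar>"
          using max_sum_nonneg[of f n "T x"] unfolding D_eq by (simp add: max_def)
      qed
      show "(\<lambda>x. D n x) \<in> borel_measurable M" for n
        unfolding D_def using max_sum_measurable[OF fm] by measurable
    qed (use f in auto)
    moreover have "0 \<le> (\<integral>x. D n x \<partial>M)" for n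
    proof -
      have "(\<integral>x. D n x \<partial>M) = (\<integral>x. max_sum f (Suc n) x \<partial>M) - (\<integral>x. max_sum f n x \<partial>M)"
        unfolding D_def integral_comp_T[OF max_sum_measurable[OF fm], of n, symmetric]
        by (intro Bochner_Integration.integral_diff max_sum_integrable f
            integrable_comp_T[OF max_sum_integrable[OF f]])
      moreover have "(\<integral>x. max_sum f n x \<partial>M) \<le> (\<integral>x. max_sum f (Suc n) x \<partial>M)"
        by (intro integral_mono max_sum_integrable f max_sum_Suc)
      ultimately show ?thesis by simp
    qed
    ultimately have "0 \<le> (\<integral>x. f x \<partial>M)" by (intro LIMSEQ_le_const) auto
    with neg show False by simp
  qed
  with T_ergodic[OF A inv] have "prob A = 0" by auto
  then have "AE x in M. x \<notin> A" using A by (simp add: prob_eq_0)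
  with AE_space show ?thesis
  proof eventually_elim
    case (elim x)
    then obtain C :: nat where "\<And>n. max_sum f n x \<le> C" unfolding A_def U_def by (auto simp: not_less)
    then have "\<forall>n. (\<Sum>k<n. f ((T ^^ k) x)) \<le> C"
      using birkhoff_sum_le_max_sum order_trans by blast
    then show ?case by blast
  qed
qed

text \<open>Apply the one-sided bound to \<open>f\<close> minus its mean minus
  \<open>\<delta>\<close>, and to the negated difference; both have mean \<open>- \<delta>\<close>.
  The error \<open>\<delta> * n + C\<close> with a random \<open>C\<close> holds for every n, so
  errors of different initial segments can be subtracted.\<close>

theorem birkhoff_linear_error:
  assumes f: "integrable M (f :: 'a \<Rightarrow> real)"
  shows "AE x in M. \<forall>\<delta>>0::real. \<exists>C. \<forall>n. \<bar>(\<Sum>k<n. f ((T ^^ k) x)) - n * (\<integral>x. f x \<partial>M)\<bar> \<le> \<delta> * n + C"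
proof -
  let ?I = "\<integral>x. f x \<partial>M"
  have 1: "AE x in M. \<exists>C. \<forall>n. (\<Sum>k<n. f ((T ^^ k) x) - ?I - \<delta>) \<le> C"
    and 2: "AE x in M. \<exists>C. \<forall>n. (\<Sum>k<n. - f ((T ^^ k) x) + ?I - \<delta>) \<le> C" if "\<delta> > 0" for \<delta> :: real
    using that f by (intro birkhoff_sums_bounded_above, simp, simp add: prob_space)+
  have "AE x in M. \<forall>j. (\<exists>C. \<forall>n. (\<Sum>k<n. f ((T ^^ k) x) - ?I - 1 / Suc j) \<le> C) \<and>
      (\<exists>C. \<forall>n. (\<Sum>k<n. - f ((T ^^ k) x) + ?I - 1 / Suc j) \<le> C)"
    unfolding AE_all_countable using 1 2 by (intro allI AE_conjI) auto
  then show ?thesis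
  proof eventually_elim
    case (elim x)
    show ?case
    proof safe
      fix \<delta> :: real assume "\<delta> > 0"
      then obtain j where j: "1 / real (Suc j) < \<delta>" using nat_approx_posE by blast
      obtain C D where C: "\<And>n. (\<Sum>k<n. f ((T ^^ k) x) - ?I - 1 / Suc j) \<le> C"
        and D: "\<And>n. (\<Sum>k<n. - f ((T ^^ k) x) + ?I - 1 / Suc j) \<le> D" using elim by metis
      have "\<bar>(\<Sum>k<n. f ((T ^^ k) x)) - n * ?I\<bar> \<le> \<delta> * n + max C D" for n
      proof -
        have "n * (1 / Suc j) \<le> \<delta> * n"
          using mult_left_mono[of "1 / Suc j" \<delta> "real n"] j by (simp add: mult.commute)
        then show ?thesis
          using C[of n] D[of n] by (simp add: sum_subtractf sum.distrib sum_negf abs_le_iff max_def)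
      qed
      then show "\<exists>C. \<forall>n. \<bar>(\<Sum>k<n. f ((T ^^ k) x)) - n * ?I\<bar> \<le> \<delta> * n + C" by blast
    qed
  qed
qed

end

section \<open>Birkhoff averages along a stationary ergodic environment\<close>

lemma env_measurable:
  assumes "stationary_ergodic M \<Theta> \<xi>"
  shows "(\<lambda>\<omega> n. \<xi> n \<omega>) \<in> M \<rightarrow>\<^sub>M (\<Pi>\<^sub>M n\<in>UNIV. \<Theta>)"
proof -
  have [measurable]: "\<xi> n \<in> M \<rightarrow>\<^sub>M \<Theta>" for n
    using assms by (simp add: stationary_ergodic_def)
  have "\<xi> n \<omega> \<in> space \<Theta>" if "\<omega> \<in> space M" for n \<omega>
    by (rule measurable_space[OF _ that]) measurable
  then show ?thesis
    by (intro measurable_PiM_single') (auto simp: PiE_iff)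
qed

text \<open>Stationarity and ergodicity concern only the law of the environment sequence, so
  Birkhoff's theorem is applied to the shift on sequence space and then pulled back along
  \<open>\<xi>\<close>.\<close>

lemma ergodic_map_shift:
  assumes M: "prob_space M" and se: "stationary_ergodic M \<Theta> \<xi>"
  shows "ergodic_map (distr M (\<Pi>\<^sub>M n\<in>UNIV. \<Theta>) (\<lambda>\<omega> n. \<xi> n \<omega>)) (\<lambda>e n. e (Suc n))"
proof -
  let ?E = "\<Pi>\<^sub>M n\<in>(UNIV :: nat set). \<Theta>" and ?env = "\<lambda>\<omega> n. \<xi> n \<omega>" and ?T = "\<lambda>e (n :: nat). e (Suc n)"
  note env = env_measurable[OF se]
  interpret M: prob_space M by (rule M)
  interpret P: prob_space "distr M ?E ?env" by (rule M.prob_space_distr[OF env])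
  have T: "?T \<in> ?E \<rightarrow>\<^sub>M ?E"
    by (intro measurable_PiM_single') (auto simp: space_PiM PiE_iff)
  show ?thesis
  proof unfold_locales
    show "?T \<in> distr M ?E ?env \<rightarrow>\<^sub>M distr M ?E ?env" using T by simp
    have "distr (distr M ?E ?env) ?E ?T = distr M ?E (\<lambda>\<omega> n. \<xi> (Suc n) \<omega>)"
      using distr_distr[OF T env] by (simp add: comp_def)
    also have "\<dots> = distr M ?E ?env"
      using se by (simp add: stationary_ergodic_def)
    finally show "distr (distr M ?E ?env) (distr M ?E ?env) ?T = distr M ?E ?env"
      by (simp cong: distr_cong)
  next
    fix A assume A: "A \<in> sets (distr M ?E ?env)" "?T -` A \<inter> space (distr M ?E ?env) = A"
    then have "measure M {\<omega> \<in> space M. ?env \<omega> \<in> A} \<in> {0, 1}"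
      using se by (simp add: stationary_ergodic_def)
    then show "P.prob A \<in> {0, 1}"
      using A by (simp add: measure_distr[OF env] vimage_def Int_def conj_commute)
  qed
qed

lemma stationary_distr:
  assumes se: "stationary_ergodic M \<Theta> \<xi>"
  shows "distr M \<Theta> (\<xi> k) = distr M \<Theta> (\<xi> 0)"
proof (induction k)
  case (Suc k)
  let ?E = "\<Pi>\<^sub>M n\<in>(UNIV :: nat set). \<Theta>" and ?env = "\<lambda>\<omega> n. \<xi> n \<omega>"
  have [measurable]: "(\<lambda>e. e n) \<in> ?E \<rightarrow>\<^sub>M \<Theta>" "\<xi> n \<in> M \<rightarrow>\<^sub>M \<Theta>" for n
    using se by (auto simp: stationary_ergodic_def)
  have sh: "(\<lambda>\<omega> n. \<xi> (Suc n) \<omega>) \<in> M \<rightarrow>\<^sub>M ?E"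
    using measurable_space[OF env_measurable[OF se]]
    by (intro measurable_PiM_single') (auto simp: PiE_iff space_PiM)
  have "distr M \<Theta> (\<xi> (Suc k)) = distr (distr M ?E (\<lambda>\<omega> n. \<xi> (Suc n) \<omega>)) \<Theta> (\<lambda>e. e k)"
    by (subst distr_distr) (auto simp: comp_def sh)
  also have "\<dots> = distr (distr M ?E ?env) \<Theta> (\<lambda>e. e k)"
    using se by (simp add: stationary_ergodic_def)
  also have "\<dots> = distr M \<Theta> (\<xi> k)"
    by (subst distr_distr) (auto simp: comp_def env_measurable[OF se])
  finally show ?case using Suc by simp
qed simp

lemma stationary_AE:
  assumes se: "stationary_ergodic M \<Theta> \<xi>" and Q: "{\<theta> \<in> space \<Theta>. Q \<theta>} \<in> sets \<Theta>"
    and AE: "AE \<omega> in M. Q (\<xi> 0 \<omega>)"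
  shows "AE \<omega> in M. \<forall>k. Q (\<xi> k \<omega>)"
  unfolding AE_all_countable
proof
  fix k
  have [measurable]: "\<xi> n \<in> M \<rightarrow>\<^sub>M \<Theta>" for n
    using se by (auto simp: stationary_ergodic_def)
  have "AE \<theta> in distr M \<Theta> (\<xi> k). Q \<theta>"
    unfolding stationary_distr[OF se, of k] using AE Q by (subst AE_distr_iff) auto
  then show "AE \<omega> in M. Q (\<xi> k \<omega>)"
    by (rule AE_distrD[rotated]) simp
qed

lemma birkhoff_env:
  assumes M: "prob_space M" and se: "stationary_ergodic M \<Theta> \<xi>"
    and g: "g \<in> borel_measurable \<Theta>" and int: "integrable M (\<lambda>\<omega>. g (\<xi> 0 \<omega>) :: real)"
  shows "AE \<omega> in M. \<forall>\<delta>>0::real. \<exists>C. \<forall>n.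
    \<bar>(\<Sum>k<n. g (\<xi> k \<omega>)) - n * (\<integral>\<omega>. g (\<xi> 0 \<omega>) \<partial>M)\<bar> \<le> \<delta> * n + C"
proof -
  let ?E = "\<Pi>\<^sub>M n\<in>(UNIV :: nat set). \<Theta>" and ?env = "\<lambda>\<omega> n. \<xi> n \<omega>" and ?T = "\<lambda>e (n :: nat). e (Suc n)"
  note env = env_measurable[OF se]
  interpret ergodic_map "distr M ?E ?env" ?T
    by (rule ergodic_map_shift[OF M se])
  note [measurable] = g
  have T: "(?T ^^ k) e n = e (n + k)" for k e n
    by (induction k arbitrary: n) auto
  have meas: "(\<lambda>e. g (e 0)) \<in> borel_measurable ?E" by measurable
  have "integrable (distr M ?E ?env) (\<lambda>e. g (e 0))"
    using int by (subst integrable_distr_eq[OF env meas])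
  from birkhoff_linear_error[OF this] have "AE e in distr M ?E ?env. \<forall>\<delta>>0::real. \<exists>C. \<forall>n.
    \<bar>(\<Sum>k<n. g (e k)) - n * (\<integral>\<omega>. g (\<xi> 0 \<omega>) \<partial>M)\<bar> \<le> \<delta> * n + C"
    by (simp add: T integral_distr[OF env meas])
  then show ?thesis by (rule AE_distrD[OF env])
qed

section \<open>The branching property\<close>

abbreviation tree_space :: "(nat list \<Rightarrow> mark) measure" where
  "tree_space \<equiv> \<Pi>\<^sub>M u\<in>UNIV. mark_space"

text \<open>The quenched law, with the environment recorded only through its offspring laws: passing
  to the subtrees at generation j becomes the shift
  \<open>\<lambda>k. \<nu> (k + j)\<close>.\<close>

definition tree_law :: "(nat \<Rightarrow> mark measure) \<Rightarrow> (nat list \<Rightarrow> mark) measure" where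
  "tree_law \<nu> = (\<Pi>\<^sub>M u\<in>UNIV. \<nu> (length u))"

text \<open>Rebuilds a tree from the mark of its root and the subtrees of its children. Children
  beyond the offspring number are included, which makes the family of subtrees an infinite product
  independent of the root.\<close>

definition graft :: "mark \<times> (nat \<Rightarrow> nat list \<Rightarrow> mark) \<Rightarrow> nat list \<Rightarrow> mark" where
  "graft = (\<lambda>(m, y) u. case u of [] \<Rightarrow> m | i # v \<Rightarrow> y i v)"

lemma graft_simps [simp]: "graft (m, y) [] = m" "graft (m, y) (i # v) = y i v"
  by (auto simp: graft_def)

lemma space_mark_space [simp]: "space mark_space = UNIV"
  by (simp add: mark_space_def space_pair_measure space_PiM)

lemma space_tree_space [simp]: "space tree_space = UNIV"
  by (simp add: space_PiM)

lemma measurable_fst_mark [measurable]: "fst \<in> mark_space \<rightarrow>\<^sub>M count_space UNIV"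
  unfolding mark_space_def by measurable

lemma measurable_snd_mark [measurable]: "(\<lambda>m. snd m i) \<in> borel_measurable mark_space"
  unfolding mark_space_def by measurable

lemma measurable_subtree [measurable]: "(\<lambda>x u. x (i # u)) \<in> tree_space \<rightarrow>\<^sub>M tree_space"
  by (intro measurable_PiM_single') auto

lemma measurable_graft [measurable]:
  "graft \<in> mark_space \<Otimes>\<^sub>M (\<Pi>\<^sub>M i\<in>UNIV. tree_space) \<rightarrow>\<^sub>M tree_space"
proof (rule measurable_PiM_single')
  fix u :: "nat list"
  show "(\<lambda>p. graft p u) \<in> mark_space \<Otimes>\<^sub>M (\<Pi>\<^sub>M i\<in>UNIV. tree_space) \<rightarrow>\<^sub>M mark_space"
  proof (cases u)
    case Nil
    then have "(\<lambda>p. graft p u) = fst" by (auto simp: graft_def)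
    then show ?thesis by simp
  next
    case (Cons i v)
    then have *: "(\<lambda>p. graft p u) = (\<lambda>x. x v) \<circ> (\<lambda>y. y i) \<circ> snd"
      by (auto simp: graft_def)
    show ?thesis
      unfolding * by (intro measurable_comp[OF measurable_snd] measurable_comp[OF measurable_component_singleton]
          measurable_component_singleton) auto
  qed
qed auto

locale env_seq =
  fixes \<nu> :: "nat \<Rightarrow> mark measure"
  assumes prob_space_env: "prob_space (\<nu> k)"
    and sets_env [measurable_cong, simp]: "sets (\<nu> k) = sets mark_space"

lemma env_seq_shift:
  assumes "env_seq \<nu>"
  shows "env_seq (\<lambda>k. \<nu> (k + j))"
proof -
  interpret env_seq \<nu> by (rule assms)
  show ?thesis by (rule env_seq.intro) (rule prob_space_env, rule sets_env)
qed

lemma env_seq_Suc: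
  assumes "env_seq \<nu>"
  shows "env_seq (\<lambda>k. \<nu> (Suc k))"
proof -
  interpret env_seq \<nu> by (rule assms)
  show ?thesis by (rule env_seq.intro) (rule prob_space_env, rule sets_env)
qed

context env_seq
begin

lemma space_env [simp]: "space (\<nu> k) = UNIV"
  using sets_eq_imp_space_eq[OF sets_env] by simp

lemma sets_tree_law [measurable_cong, simp]: "sets (tree_law \<nu>) = sets tree_space"
  unfolding tree_law_def by (intro sets_PiM_cong) auto

lemma space_tree_law [simp]: "space (tree_law \<nu>) = UNIV"
  using sets_eq_imp_space_eq[OF sets_tree_law] by simp

lemma prob_space_tree_law: "prob_space (tree_law \<nu>)"
  unfolding tree_law_def by (intro prob_space_PiM prob_space_env)

abbreviation (input) "tail_env \<equiv> (\<lambda>k. \<nu> (Suc k))"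

lemma emeasure_tree_law:
  assumes "finite J" "\<And>u. u \<in> J \<Longrightarrow> F u \<in> sets mark_space"
  shows "emeasure (tree_law \<nu>) {x. \<forall>u\<in>J. x u \<in> F u} = (\<Prod>u\<in>J. emeasure (\<nu> (length u)) (F u))"
proof -
  have "{x. \<forall>u\<in>J. x u \<in> F u} = prod_emb UNIV (\<lambda>u. \<nu> (length u)) J (Pi\<^sub>E J F)"
    by (auto simp: prod_emb_def space_PiM PiE_iff)
  then show ?thesis
    unfolding tree_law_def using assms
    by (simp only:) (rule emeasure_PiM_emb, auto simp: prob_space_env)
qed

text \<open>The branching property. It suffices to compare finite cylinders: a cylinder over
  \<open>J\<close> pulls back under \<open>graft\<close> to a condition on the root times conditions
  on the subtrees named by the first letters of \<open>J\<close>, and the product over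
  \<open>J\<close> splits accordingly.\<close>

lemma tree_law_eq_distr_graft:
  "distr (\<nu> 0 \<Otimes>\<^sub>M (\<Pi>\<^sub>M i\<in>UNIV. tree_law tail_env)) tree_space graft = tree_law \<nu>"
    (is "distr (_ \<Otimes>\<^sub>M ?P) _ _ = _")
proof -
  interpret S: env_seq tail_env by (rule env_seq_Suc) unfold_locales
  interpret N: prob_space "\<nu> (length u)" for u :: "nat list" by (rule prob_space_env)
  interpret TL: product_prob_space "\<lambda>u. \<nu> (length u)" "UNIV :: nat list set" ..
  interpret TT: prob_space "tree_law tail_env" by (rule S.prob_space_tree_law)
  interpret P: product_prob_space "\<lambda>i. tree_law tail_env" "UNIV :: nat set" ..
  have sets_P [measurable_cong]: "sets ?P = sets (\<Pi>\<^sub>M i\<in>UNIV. tree_space)"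
    by (intro sets_PiM_cong) auto
  have space_P [simp]: "space ?P = UNIV" by (simp add: space_PiM)
  have g: "graft \<in> \<nu> 0 \<Otimes>\<^sub>M ?P \<rightarrow>\<^sub>M tree_space" by measurable
  show ?thesis
    unfolding tree_law_def[of \<nu>]
  proof (rule TL.PiM_eq)
    show "sets (distr (\<nu> 0 \<Otimes>\<^sub>M ?P) tree_space graft) = sets (\<Pi>\<^sub>M u\<in>UNIV. \<nu> (length u))"
      using sets_tree_law by (simp add: tree_law_def)
  next
    fix J :: "nat list set" and F
    assume J: "finite J" and "\<And>u. u \<in> J \<Longrightarrow> F u \<in> sets (\<nu> (length u))"
    then have F: "F u \<in> sets mark_space" if "u \<in> J" for u using that by auto
    define I where "I = {i. \<exists>v. i # v \<in> J}"
    define K where "K i = {v. i # v \<in> J}" for i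
    have finI: "finite I"
      by (rule finite_subset[OF _ finite_imageI[OF J, of hd]]) (force simp: I_def)
    have finK: "finite (K i)" for i
      by (rule finite_subset[OF _ finite_imageI[OF J, of tl]]) (force simp: K_def)
    define A where "A = (if [] \<in> J then F [] else UNIV)"
    define C where "C i = {x :: nat list \<Rightarrow> mark. \<forall>v\<in>K i. x v \<in> F (i # v)}" for i
    define B where "B = {y :: nat \<Rightarrow> nat list \<Rightarrow> mark. \<forall>i\<in>I. y i \<in> C i}"
    have A: "A \<in> sets mark_space"
      using F sets.top[of mark_space] by (auto simp: A_def)
    have C [measurable]: "C i \<in> sets tree_space" for i
    proof -
      have "C i = {x \<in> space tree_space. \<forall>v\<in>K i. x v \<in> F (i # v)}" by (simp add: C_def)
      also have "\<dots> \<in> sets tree_space"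
      proof (rule sets.sets_Collect_finite_All[OF _ finK])
        fix v assume "v \<in> K i"
        then have [measurable]: "F (i # v) \<in> sets mark_space" by (auto simp: K_def F)
        show "{x \<in> space tree_space. x v \<in> F (i # v)} \<in> sets tree_space" by measurable
      qed
      finally show ?thesis .
    qed
    have Bemb: "B = prod_emb UNIV (\<lambda>i. tree_law tail_env) I (Pi\<^sub>E I C)"
      by (auto simp: B_def prod_emb_def space_PiM PiE_iff)
    have B: "B \<in> sets ?P"
      unfolding Bemb using finI by (intro sets_PiM_I) auto
    have pre: "graft -` {x. \<forall>u\<in>J. x u \<in> F u} = A \<times> B"
    proof (intro set_eqI iffI)
      fix p assume p: "p \<in> graft -` {x. \<forall>u\<in>J. x u \<in> F u}"
      obtain m y where [simp]: "p = (m, y)" by (cases p)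
      have *: "graft (m, y) u \<in> F u" if "u \<in> J" for u using p that by simp
      have "m \<in> A" using *[of "[]"] by (auto simp: A_def)
      moreover have "y i v \<in> F (i # v)" if "i # v \<in> J" for i v using *[OF that] by simp
      ultimately show "p \<in> A \<times> B" by (auto simp: B_def C_def K_def)
    next
      fix p assume p: "p \<in> A \<times> B"
      obtain m y where [simp]: "p = (m, y)" by (cases p)
      have "graft (m, y) u \<in> F u" if "u \<in> J" for u
        using p that by (cases u) (auto simp: A_def B_def C_def K_def I_def)
      then show "p \<in> graft -` {x. \<forall>u\<in>J. x u \<in> F u}" by simp
    qed
    have emb: "prod_emb UNIV (\<lambda>u. \<nu> (length u)) J (Pi\<^sub>E J F) = {x. \<forall>u\<in>J. x u \<in> F u}"
      by (auto simp: prod_emb_def space_PiM PiE_iff)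
    have meas: "{x. \<forall>u\<in>J. x u \<in> F u} \<in> sets tree_space"
    proof -
      have "prod_emb UNIV (\<lambda>u. \<nu> (length u)) J (Pi\<^sub>E J F) \<in> sets (tree_law \<nu>)"
        unfolding tree_law_def using J F by (intro sets_PiM_I) auto
      then show ?thesis by (simp add: emb)
    qed
    have "emeasure (distr (\<nu> 0 \<Otimes>\<^sub>M ?P) tree_space graft) {x. \<forall>u\<in>J. x u \<in> F u}
        = emeasure (\<nu> 0 \<Otimes>\<^sub>M ?P) (A \<times> B)"
      by (simp only: emeasure_distr[OF g meas] pre) (simp add: space_pair_measure)
    also have "\<dots> = emeasure (\<nu> 0) A * emeasure ?P B"
      using A B by (intro P.P.emeasure_pair_measure_Times) auto
    also have "emeasure ?P B = (\<Prod>i\<in>I. emeasure (tree_law tail_env) (C i))"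
      unfolding Bemb using finI by (intro P.emeasure_PiM_emb) auto
    also have "\<dots> = (\<Prod>i\<in>I. \<Prod>v\<in>K i. emeasure (\<nu> (length (i # v))) (F (i # v)))"
    proof (rule prod.cong[OF refl])
      fix i assume "i \<in> I"
      show "emeasure (tree_law tail_env) (C i) = (\<Prod>v\<in>K i. emeasure (\<nu> (length (i # v))) (F (i # v)))"
        using S.emeasure_tree_law[OF finK, of i "\<lambda>v. F (i # v)"] F[of "i # v" for v]
        by (simp add: C_def) (simp add: K_def)
    qed
    also have "\<dots> = (\<Prod>u\<in>(\<lambda>(i, v). i # v) ` (SIGMA i:I. K i). emeasure (\<nu> (length u)) (F u))"
    proof -
      have "(\<Prod>i\<in>I. \<Prod>v\<in>K i. emeasure (\<nu> (length (i # v))) (F (i # v))) =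
          (\<Prod>(i, v)\<in>(SIGMA i:I. K i). emeasure (\<nu> (length (i # v))) (F (i # v)))"
        by (rule prod.Sigma) (auto simp: finI finK)
      then show ?thesis
        by (subst prod.reindex) (auto simp: inj_on_def intro!: prod.cong)
    qed
    also have "(\<lambda>(i, v). i # v) ` (SIGMA i:I. K i) = J - {[]}"
    proof (intro set_eqI iffI)
      fix u assume "u \<in> J - {[]}"
      then show "u \<in> (\<lambda>(i, v). i # v) ` (SIGMA i:I. K i)"
        by (cases u) (auto simp: I_def K_def image_iff)
    qed (auto simp: K_def)
    also have "emeasure (\<nu> 0) A * (\<Prod>u\<in>J - {[]}. emeasure (\<nu> (length u)) (F u)) =
        (\<Prod>u\<in>J. emeasure (\<nu> (length u)) (F u))"
    proof (cases "[] \<in> J")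
      case True
      then show ?thesis using J by (simp add: A_def prod.remove)
    next
      case False
      then show ?thesis using N.emeasure_space_1[of "[]"] by (simp add: A_def)
    qed
    finally show "emeasure (distr (\<nu> 0 \<Otimes>\<^sub>M ?P) tree_space graft)
        (prod_emb UNIV (\<lambda>u. \<nu> (length u)) J (Pi\<^sub>E J F)) = (\<Prod>u\<in>J. emeasure (\<nu> (length u)) (F u))"
      by (simp add: emb)
  qed
qed

lemma nn_integral_tree_law:
  assumes [measurable]: "f \<in> borel_measurable tree_space"
  shows "(\<integral>\<^sup>+x. f x \<partial>tree_law \<nu>) =
    (\<integral>\<^sup>+m. (\<integral>\<^sup>+y. f (graft (m, y)) \<partial>(\<Pi>\<^sub>M i\<in>UNIV. tree_law tail_env)) \<partial>\<nu> 0)"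
proof -
  let ?P = "\<Pi>\<^sub>M i\<in>(UNIV::nat set). tree_law tail_env"
  interpret S: env_seq tail_env by (rule env_seq_Suc) unfold_locales
  interpret PP: prob_space ?P by (rule prob_space_PiM) (rule S.prob_space_tree_law)
  have sets_P [measurable_cong]: "sets ?P = sets (\<Pi>\<^sub>M i\<in>UNIV. tree_space)"
    by (intro sets_PiM_cong) auto
  have g: "graft \<in> \<nu> 0 \<Otimes>\<^sub>M ?P \<rightarrow>\<^sub>M tree_space" by measurable
  show ?thesis
    by (subst tree_law_eq_distr_graft[symmetric], subst nn_integral_distr[OF g])
       (auto intro!: PP.nn_integral_fst[symmetric])
qed

lemma nn_integral_subtree:
  fixes i :: nat
  assumes [measurable]: "f \<in> borel_measurable tree_space"
  shows "(\<integral>\<^sup>+y. f (y i) \<partial>(\<Pi>\<^sub>M i\<in>UNIV. tree_law tail_env)) = (\<integral>\<^sup>+x. f x \<partial>tree_law tail_env)"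
proof -
  let ?P = "\<Pi>\<^sub>M i\<in>(UNIV::nat set). tree_law tail_env"
  interpret S: env_seq tail_env by (rule env_seq_Suc) unfold_locales
  have "distr ?P (tree_law tail_env) (\<lambda>y. y i) = tree_law tail_env"
    by (rule distr_PiM_component) (auto intro: S.prob_space_tree_law)
  then show ?thesis
    using nn_integral_distr[of "\<lambda>y. y i" ?P "tree_law tail_env" f] by simp
qed

lemma nn_integral_prod_subtrees:
  fixes I :: "nat set"
  assumes I: "finite I" and f [measurable]: "\<And>i. i \<in> I \<Longrightarrow> f i \<in> borel_measurable tree_space"
  shows "(\<integral>\<^sup>+y. (\<Prod>i\<in>I. f i (y i)) \<partial>(\<Pi>\<^sub>M i\<in>UNIV. tree_law tail_env)) =
    (\<Prod>i\<in>I. \<integral>\<^sup>+x. f i x \<partial>tree_law tail_env)"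
proof -
  let ?P = "\<Pi>\<^sub>M i\<in>(UNIV::nat set). tree_law tail_env"
  interpret S: env_seq tail_env by (rule env_seq_Suc) unfold_locales
  interpret TT: prob_space "tree_law tail_env" by (rule S.prob_space_tree_law)
  interpret P: product_prob_space "\<lambda>i. tree_law tail_env" "UNIV :: nat set" ..
  have "(\<integral>\<^sup>+y. (\<Prod>i\<in>I. f i (y i)) \<partial>?P) =
      (\<integral>\<^sup>+y. (\<Prod>i\<in>I. f i (y i)) \<partial>(\<Pi>\<^sub>M i\<in>I. tree_law tail_env))"
    by (subst P.distr_PiM_restrict_finite[OF I, symmetric], simp, subst nn_integral_distr)
       (auto intro!: nn_integral_cong prod.cong)
  also have "\<dots> = (\<Prod>i\<in>I. \<integral>\<^sup>+x. f i x \<partial>tree_law tail_env)"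
    using I by (intro P.product_nn_integral_prod) auto
  finally show ?thesis .
qed

end

section \<open>Moments of path sums\<close>

text \<open>Sums, over ancestral paths of length n that start at \<open>s\<close>, the product of
  the weights \<open>g j\<close> at the position reached at time j. Each particle keeps its first
  \<open>K N\<close> children: \<open>K = min c\<close> truncates the process, the identity gives
  all of it. Indicators as weights count paths inside a tube.\<close>

primrec path_sum ::
    "(nat \<Rightarrow> nat) \<Rightarrow> nat \<Rightarrow> (nat \<Rightarrow> real \<Rightarrow> ennreal) \<Rightarrow> (nat list \<Rightarrow> mark) \<Rightarrow> real \<Rightarrow> ennreal" where
  "path_sum K 0 g x s = g 0 s"
| "path_sum K (Suc n) g x s =
     g 0 s * (\<Sum>i<K (fst (x [])). path_sum K n (\<lambda>j. g (Suc j)) (\<lambda>u. x (i # u)) (s + snd (x []) i))"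

definition mgf :: "(nat \<Rightarrow> nat) \<Rightarrow> real \<Rightarrow> mark measure \<Rightarrow> ennreal" where
  "mgf K t \<mu> = (\<integral>\<^sup>+m. (\<Sum>i<K (fst m). ennreal (exp (t * snd m i))) \<partial>\<mu>)"

lemma measurable_sum_children:
  assumes K: "k \<in> M \<rightarrow>\<^sub>M count_space UNIV"
    and f: "\<And>i :: nat. (\<lambda>w. f i w :: ennreal) \<in> borel_measurable M"
  shows "(\<lambda>w. \<Sum>i<(k w :: nat). f i w) \<in> borel_measurable M"
  by (rule measurable_compose_countable[OF borel_measurable_sum[OF f] K])

lemma measurable_path_sum_pair:
  assumes "\<And>j. g j \<in> borel_measurable borel"
  shows "(\<lambda>(x, s). path_sum K n g x s) \<in> borel_measurable (tree_space \<Otimes>\<^sub>M borel)"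
  using assms
proof (induction n arbitrary: g)
  case 0
  note [measurable] = "0.prems"
  show ?case by simp
next
  case (Suc n)
  note [measurable] = Suc.prems
  have IH: "(\<lambda>(x, s). path_sum K n (\<lambda>j. g (Suc j)) x s) \<in> borel_measurable (tree_space \<Otimes>\<^sub>M borel)"
    by (rule Suc.IH) (rule Suc.prems)
  have root: "(\<lambda>p. fst p []) \<in> tree_space \<Otimes>\<^sub>M (borel :: real measure) \<rightarrow>\<^sub>M mark_space"
    by measurable
  have "(\<lambda>p. \<Sum>i<K (fst (fst p [])). path_sum K n (\<lambda>j. g (Suc j)) (\<lambda>u. fst p (i # u)) (snd p + snd (fst p []) i))
      \<in> borel_measurable (tree_space \<Otimes>\<^sub>M borel)"
  proof (rule measurable_sum_children)
    have "fst \<circ> (\<lambda>p. fst p []) \<in> tree_space \<Otimes>\<^sub>M (borel :: real measure) \<rightarrow>\<^sub>M count_space UNIV"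
      by (rule measurable_comp[OF root]) measurable
    then show "(\<lambda>p. K (fst (fst p []))) \<in> tree_space \<Otimes>\<^sub>M (borel :: real measure) \<rightarrow>\<^sub>M count_space UNIV"
      by (auto simp: comp_def intro: measurable_compose)
  next
    fix i
    have s: "(\<lambda>p. snd p + snd (fst p []) i) \<in> borel_measurable (tree_space \<Otimes>\<^sub>M borel)"
      using measurable_compose[OF root measurable_snd_mark[of i]] by (intro borel_measurable_add) auto
    have x: "(\<lambda>p u. fst p (i # u)) \<in> tree_space \<Otimes>\<^sub>M (borel :: real measure) \<rightarrow>\<^sub>M tree_space"
      by (rule measurable_compose[OF measurable_fst measurable_subtree])
    show "(\<lambda>p. path_sum K n (\<lambda>j. g (Suc j)) (\<lambda>u. fst p (i # u)) (snd p + snd (fst p []) i))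
        \<in> borel_measurable (tree_space \<Otimes>\<^sub>M borel)"
      using measurable_compose[OF measurable_Pair[OF x s] IH] by simp
  qed
  then show ?case
    by (simp add: case_prod_beta)
qed

lemma measurable_path_sum:
  assumes "\<And>j. g j \<in> borel_measurable borel" "f \<in> M \<rightarrow>\<^sub>M tree_space" "h \<in> borel_measurable M"
  shows "(\<lambda>w. path_sum K n g (f w) (h w)) \<in> borel_measurable M"
  using measurable_compose[OF measurable_Pair[OF assms(2,3)] measurable_path_sum_pair[OF assms(1)]]
  by simp

lemma measurable_path_sum_tree:
  assumes "\<And>j. g j \<in> borel_measurable borel"
  shows "(\<lambda>x. path_sum K n g x s) \<in> borel_measurable tree_space"
  by (rule measurable_path_sum) (use assms in auto)

section \<open>First moments of path sums: many-to-one bounds\<close>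

context env_seq
begin

lemma mean_path_sum_Suc:
  assumes g: "\<And>j. g j \<in> borel_measurable borel"
  shows "(\<integral>\<^sup>+x. path_sum K (Suc n) g x s \<partial>tree_law \<nu>) = g 0 s *
    (\<integral>\<^sup>+m. (\<Sum>i<K (fst m). \<integral>\<^sup>+x. path_sum K n (\<lambda>j. g (Suc j)) x (s + snd m i) \<partial>tree_law tail_env) \<partial>\<nu> 0)"
proof -
  let ?P = "\<Pi>\<^sub>M i\<in>(UNIV::nat set). tree_law tail_env" and ?g = "\<lambda>j. g (Suc j)"
  interpret S: env_seq tail_env by (rule env_seq_Suc) unfold_locales
  have sets_P [measurable_cong]: "sets ?P = sets (\<Pi>\<^sub>M i\<in>UNIV. tree_space)"
    by (intro sets_PiM_cong) auto
  have m1: "(\<lambda>x. path_sum K n ?g x s) \<in> borel_measurable tree_space" for s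
    by (rule measurable_path_sum_tree) (rule g)
  have m2: "(\<lambda>y. path_sum K n ?g (y i) s) \<in> borel_measurable ?P" for s i
    by (rule measurable_compose[OF _ m1]) measurable
  let ?h = "\<lambda>x. \<Sum>i<K (fst (x [])). path_sum K n ?g (\<lambda>u. x (i # u)) (s + snd (x []) i)"
  have h: "?h \<in> borel_measurable tree_space"
  proof -
    \<comment> \<open>The inner sum is itself a path sum, with the weight at time 0 replaced by 1;
      its measurability comes from this.\<close>
    have "(\<lambda>x. path_sum K (Suc n) (\<lambda>j. if j = 0 then (\<lambda>_. 1) else g j) x s) \<in> borel_measurable tree_space"
      by (rule measurable_path_sum_tree) (use g in auto)
    then show ?thesis by simp
  qed
  have "(\<integral>\<^sup>+x. path_sum K (Suc n) g x s \<partial>tree_law \<nu>) = g 0 s * (\<integral>\<^sup>+x. ?h x \<partial>tree_law \<nu>)"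
    using h by (simp add: nn_integral_cmult)
  also have "(\<integral>\<^sup>+x. ?h x \<partial>tree_law \<nu>) =
      (\<integral>\<^sup>+m. (\<integral>\<^sup>+y. (\<Sum>i<K (fst m). path_sum K n ?g (y i) (s + snd m i)) \<partial>?P) \<partial>\<nu> 0)"
    by (subst nn_integral_tree_law[OF h]) simp
  also have "\<dots> = (\<integral>\<^sup>+m. (\<Sum>i<K (fst m). \<integral>\<^sup>+y. path_sum K n ?g (y i) (s + snd m i) \<partial>?P) \<partial>\<nu> 0)"
    by (intro nn_integral_cong nn_integral_sum m2)
  finally show ?thesis by (simp add: nn_integral_subtree[OF m1])
qed

lemma measurable_mean_path_sum:
  assumes g: "\<And>j. g j \<in> borel_measurable borel"
  shows "(\<lambda>s. \<integral>\<^sup>+x. path_sum K n g x s \<partial>tree_law \<nu>) \<in> borel_measurable borel"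
proof -
  interpret T: prob_space "tree_law \<nu>" by (rule prob_space_tree_law)
  have "(\<lambda>p. path_sum K n g (snd p) (fst p)) \<in> borel_measurable (borel \<Otimes>\<^sub>M tree_law \<nu>)"
    by (rule measurable_path_sum) (use g in measurable)
  then show ?thesis
    by (intro T.borel_measurable_nn_integral) (simp add: case_prod_beta)
qed

end

context
  fixes \<mu> :: "mark measure"
  assumes sets_\<mu>: "sets \<mu> = sets mark_space"
begin

lemma measurable_sum_marks:
  assumes f: "f \<in> borel_measurable borel"
  shows "(\<lambda>m. \<Sum>i<K (fst m). f (s + snd m i) :: ennreal) \<in> borel_measurable \<mu>"
proof (rule measurable_sum_children)
  show "(\<lambda>m. K (fst m)) \<in> \<mu> \<rightarrow>\<^sub>M count_space UNIV"
    unfolding measurable_cong_sets[OF sets_\<mu> refl]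
    by (rule measurable_compose[OF measurable_fst_mark]) simp
  show "(\<lambda>m. f (s + snd m i)) \<in> borel_measurable \<mu>" for i
    unfolding measurable_cong_sets[OF sets_\<mu> refl]
    by (rule measurable_compose[OF borel_measurable_add[OF borel_measurable_const measurable_snd_mark] f])
qed

lemma nn_integral_sum_exp:
  "(\<integral>\<^sup>+m. (\<Sum>i<K (fst m). c * ennreal (exp (t * (s + snd m i)))) \<partial>\<mu>) =
    c * ennreal (exp (t * s)) * mgf K t \<mu>"
proof -
  have "(\<lambda>m. \<Sum>i<K (fst m). ennreal (exp (t * (0 + snd m i)))) \<in> borel_measurable \<mu>"
    by (rule measurable_sum_marks) simp
  then have "(\<integral>\<^sup>+m. c * ennreal (exp (t * s)) * (\<Sum>i<K (fst m). ennreal (exp (t * snd m i))) \<partial>\<mu>) =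
    c * ennreal (exp (t * s)) * mgf K t \<mu>"
    by (simp only: nn_integral_cmult mgf_def add_0)
  moreover have "ennreal (exp (t * (s + l))) = ennreal (exp (t * s)) * ennreal (exp (t * l))" for l
    by (simp add: distrib_left exp_add ennreal_mult)
  ultimately show ?thesis
    by (simp only: sum_distrib_left mult.assoc)
qed

end

text \<open>Intermediate weights are bounded by 1 and only the last one is compared with an
  exponential, so each generation contributes a factor \<open>mgf\<close>. It serves for the full
  exponential sum with \<open>a = 1\<close>, and for tube counts, where \<open>a\<close> bounds
  \<open>exp (- (t * y))\<close> on the final window.\<close>

lemma mean_path_sum_le:
  assumes "env_seq \<nu>" "\<And>j. g j \<in> borel_measurable borel"
    and "\<And>j y. j < n \<Longrightarrow> g j y \<le> 1" "\<And>y. g n y \<le> a * ennreal (exp (t * y))"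
  shows "(\<integral>\<^sup>+x. path_sum K n g x s \<partial>tree_law \<nu>) \<le>
    a * ennreal (exp (t * s)) * (\<Prod>k\<in>{0..<n}. mgf K t (\<nu> k))"
  using assms
proof (induction n arbitrary: g \<nu> s)
  case 0
  then interpret env_seq \<nu> by simp
  interpret T: prob_space "tree_law \<nu>" by (rule prob_space_tree_law)
  show ?case using "0.prems"(4) by (simp add: T.emeasure_space_1[simplified])
next
  case (Suc n)
  interpret env_seq \<nu> by (rule Suc.prems)
  let ?P = "\<Prod>k\<in>{0..<n}. mgf K t (\<nu> (Suc k))"
  have "(\<integral>\<^sup>+x. path_sum K (Suc n) g x s \<partial>tree_law \<nu>) \<le> 1 *
      (\<integral>\<^sup>+m. (\<Sum>i<K (fst m). a * ?P * ennreal (exp (t * (s + snd m i)))) \<partial>\<nu> 0)"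
    unfolding mean_path_sum_Suc[OF Suc.prems(2)]
  proof (intro mult_mono nn_integral_mono sum_mono)
    fix m :: mark and i
    have "(\<integral>\<^sup>+x. path_sum K n (\<lambda>j. g (Suc j)) x (s + snd m i) \<partial>tree_law tail_env) \<le>
        a * ennreal (exp (t * (s + snd m i))) * ?P"
      by (rule Suc.IH) (use Suc.prems env_seq_Suc in auto)
    then show "(\<integral>\<^sup>+x. path_sum K n (\<lambda>j. g (Suc j)) x (s + snd m i) \<partial>tree_law tail_env) \<le>
        a * ?P * ennreal (exp (t * (s + snd m i)))" by (simp add: mult_ac)
  qed (use Suc.prems in auto)
  also have "\<dots> = a * ennreal (exp (t * s)) * (mgf K t (\<nu> 0) * ?P)"
    by (subst nn_integral_sum_exp) (simp_all add: mult_ac)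
  also have "mgf K t (\<nu> 0) * ?P = (\<Prod>k\<in>{0..<Suc n}. mgf K t (\<nu> k))"
    by (simp only: prod.atLeast0_lessThan_Suc_shift comp_def)
  finally show ?case .
qed

text \<open>Many-to-one lower bound: a path leaving the tube \<open>B\<close> at time \<open>j\<close> is paid for by the
  exponential weights \<open>t\<^sub>1\<close>, \<open>t\<^sub>2\<close> up to time \<open>j\<close>, as in Chernoff's inequality.\<close>

lemma mean_tube_ge:
  assumes "env_seq \<nu>" "\<And>j. B j \<in> sets borel"
    and "\<And>y. y \<in> B n \<Longrightarrow> ennreal (exp (t * y)) \<le> \<beta>"
    and "\<And>j y. y \<notin> B j \<Longrightarrow> ennreal (exp (t * y)) \<le>
      \<gamma>1 j * ennreal (exp (t1 * y)) + \<gamma>2 j * ennreal (exp (t2 * y))"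
  shows "ennreal (exp (t * s)) * (\<Prod>k\<in>{0..<n}. mgf K t (\<nu> k)) \<le>
    \<beta> * (\<integral>\<^sup>+x. path_sum K n (\<lambda>j. indicator (B j)) x s \<partial>tree_law \<nu>) +
    (\<Sum>j\<le>n. (\<gamma>1 j * ennreal (exp (t1 * s)) * (\<Prod>k\<in>{0..<j}. mgf K t1 (\<nu> k)) +
            \<gamma>2 j * ennreal (exp (t2 * s)) * (\<Prod>k\<in>{0..<j}. mgf K t2 (\<nu> k))) *
          (\<Prod>k\<in>{j..<n}. mgf K t (\<nu> k)))"
  using assms
proof (induction n arbitrary: B \<nu> s \<gamma>1 \<gamma>2)
  case 0
  then interpret env_seq \<nu> by simp
  interpret T: prob_space "tree_law \<nu>" by (rule prob_space_tree_law)
  show ?case using "0.prems"(3)[of s] "0.prems"(4)[of s 0]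
    by (cases "s \<in> B 0") (auto simp: T.emeasure_space_1[simplified] intro: add_increasing2)
next
  case (Suc n)
  interpret env_seq \<nu> by (rule Suc.prems)
  let ?g = "\<lambda>j. indicator (B (Suc j)) :: real \<Rightarrow> ennreal"
  let ?P = "\<lambda>j n. \<Prod>k\<in>{j..<n}. mgf K t (\<nu> k)"
  let ?Q1 = "\<lambda>j. \<Prod>k\<in>{0..<j}. mgf K t1 (\<nu> k)"
  let ?Q2 = "\<lambda>j. \<Prod>k\<in>{0..<j}. mgf K t2 (\<nu> k)"
  let ?E = "\<lambda>t. ennreal (exp (t * s))"
  let ?Y = "\<integral>\<^sup>+x. path_sum K (Suc n) (\<lambda>j. indicator (B j)) x s \<partial>tree_law \<nu>"
  let ?term = "\<lambda>j. (\<gamma>1 j * ?E t1 * ?Q1 j + \<gamma>2 j * ?E t2 * ?Q2 j) * ?P j (Suc n)"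
  have meas: "\<And>j. ?g j \<in> borel_measurable borel"
    using Suc.prems(2) by auto
  show ?case
  proof (cases "s \<in> B 0")
    case False
    \<comment> \<open>A start outside the tube is an exit at time 0, so the term
      \<open>j = 0\<close> alone pays for the whole left-hand side.\<close>
    have "?E t * ?P 0 (Suc n) \<le> ?term 0"
      using Suc.prems(4)[OF False] by (intro mult_right_mono) auto
    also have "\<dots> \<le> (\<Sum>j\<le>Suc n. ?term j)"
      by (rule member_le_sum) auto
    finally show ?thesis by (rule add_increasing[rotated]) simp
  next
    case True
    let ?P' = "\<lambda>j n. \<Prod>k\<in>{j..<n}. mgf K t (\<nu> (Suc k))"
    let ?Q1' = "\<lambda>j. \<Prod>k\<in>{0..<j}. mgf K t1 (\<nu> (Suc k))"
    let ?Q2' = "\<lambda>j. \<Prod>k\<in>{0..<j}. mgf K t2 (\<nu> (Suc k))"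
    let ?F = "\<lambda>y. \<integral>\<^sup>+x. path_sum K n ?g x y \<partial>tree_law tail_env"
    have IH: "ennreal (exp (t * y)) * ?P' 0 n \<le> \<beta> * ?F y +
      (\<Sum>j\<le>n. (\<gamma>1 (Suc j) * ennreal (exp (t1 * y)) * ?Q1' j +
            \<gamma>2 (Suc j) * ennreal (exp (t2 * y)) * ?Q2' j) * ?P' j n)" for y
      by (rule Suc.IH) (use Suc.prems env_seq_Suc in auto)
    \<comment> \<open>The error terms of the shifted bound are linear in the two exponential
      weights. Their coefficients do not depend on the position \<open>y\<close>, so the sum over
      children integrates to one more factor \<open>mgf\<close> for each weight.\<close>
    define a1 where "a1 = (\<Sum>j\<le>n. \<gamma>1 (Suc j) * ?Q1' j * ?P' j n)"
    define a2 where "a2 = (\<Sum>j\<le>n. \<gamma>2 (Suc j) * ?Q2' j * ?P' j n)"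
    have IH': "?P' 0 n * ennreal (exp (t * y)) \<le> \<beta> * ?F y +
        (a1 * ennreal (exp (t1 * y)) + a2 * ennreal (exp (t2 * y)))" for y
    proof -
      have "(\<Sum>j\<le>n. (\<gamma>1 (Suc j) * ennreal (exp (t1 * y)) * ?Q1' j +
            \<gamma>2 (Suc j) * ennreal (exp (t2 * y)) * ?Q2' j) * ?P' j n) =
          a1 * ennreal (exp (t1 * y)) + a2 * ennreal (exp (t2 * y))"
        unfolding a1_def a2_def sum_distrib_right sum.distrib[symmetric]
        by (intro sum.cong refl) (simp add: algebra_simps)
      with IH[of y] show ?thesis by (simp add: mult.commute)
    qed
    have F: "?F \<in> borel_measurable borel"
    proof -
      interpret S: env_seq tail_env by (rule env_seq_Suc) unfold_locales
      show ?thesis by (rule S.measurable_mean_path_sum) (rule meas)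
    qed
    have m1: "(\<lambda>m. \<Sum>i<K (fst m). \<beta> * ?F (s + snd m i)) \<in> borel_measurable (\<nu> 0)"
      by (rule measurable_sum_marks) (use F in auto)
    have mF: "(\<lambda>m. \<Sum>i<K (fst m). ?F (s + snd m i)) \<in> borel_measurable (\<nu> 0)"
      by (rule measurable_sum_marks) (use F in auto)
    have m2: "(\<lambda>m. \<Sum>i<K (fst m). a * ennreal (exp (t * (s + snd m i)))) \<in> borel_measurable (\<nu> 0)" for a t
      by (rule measurable_sum_marks) auto
    have "?E t * ?P 0 (Suc n) = ?P' 0 n * ?E t * mgf K t (\<nu> 0)"
      by (simp only: prod.atLeast0_lessThan_Suc_shift comp_def mult_ac)
    also have "\<dots> = (\<integral>\<^sup>+m. (\<Sum>i<K (fst m). ?P' 0 n * ennreal (exp (t * (s + snd m i)))) \<partial>\<nu> 0)"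
      by (simp add: nn_integral_sum_exp)
    also have "\<dots> \<le> (\<integral>\<^sup>+m. (\<Sum>i<K (fst m). \<beta> * ?F (s + snd m i)) +
        ((\<Sum>i<K (fst m). a1 * ennreal (exp (t1 * (s + snd m i)))) +
         (\<Sum>i<K (fst m). a2 * ennreal (exp (t2 * (s + snd m i))))) \<partial>\<nu> 0)"
      unfolding sum.distrib[symmetric] by (intro nn_integral_mono sum_mono IH')
    also have "\<dots> = (\<integral>\<^sup>+m. (\<Sum>i<K (fst m). \<beta> * ?F (s + snd m i)) \<partial>\<nu> 0) +
        (a1 * ?E t1 * mgf K t1 (\<nu> 0) + a2 * ?E t2 * mgf K t2 (\<nu> 0))"
      by (simp only: nn_integral_add[OF m1 borel_measurable_add[OF m2 m2]] nn_integral_add[OF m2 m2]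
          nn_integral_sum_exp[OF sets_env])
    also have "(\<integral>\<^sup>+m. (\<Sum>i<K (fst m). \<beta> * ?F (s + snd m i)) \<partial>\<nu> 0) = \<beta> * ?Y"
    proof -
      have "?Y = (\<integral>\<^sup>+m. (\<Sum>i<K (fst m). ?F (s + snd m i)) \<partial>\<nu> 0)"
        using True Suc.prems(2) by (subst mean_path_sum_Suc) auto
      then show ?thesis
        by (simp only: sum_distrib_left[symmetric] nn_integral_cmult[OF mF])
    qed
    also have "a1 * ?E t1 * mgf K t1 (\<nu> 0) + a2 * ?E t2 * mgf K t2 (\<nu> 0) = (\<Sum>j\<le>n. ?term (Suc j))"
      unfolding a1_def a2_def sum_distrib_right sum.distrib[symmetric]
    proof (intro sum.cong refl)
      fix j
      have *: "g1 * q1 * p * e1 * m1 + g2 * q2 * p * e2 * m2 =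
          (g1 * e1 * (m1 * q1) + g2 * e2 * (m2 * q2)) * p"
        for g1 q1 p e1 m1 g2 q2 e2 m2 :: ennreal
        by (simp add: algebra_simps)
      have P: "?P' j n = ?P (Suc j) (Suc n)" by (simp only: prod.shift_bounds_Suc_ivl)
      have Q: "mgf K t1 (\<nu> 0) * ?Q1' j = ?Q1 (Suc j)" "mgf K t2 (\<nu> 0) * ?Q2' j = ?Q2 (Suc j)"
        by (simp_all only: prod.atLeast0_lessThan_Suc_shift comp_def)
      show "\<gamma>1 (Suc j) * ?Q1' j * ?P' j n * ?E t1 * mgf K t1 (\<nu> 0) +
          \<gamma>2 (Suc j) * ?Q2' j * ?P' j n * ?E t2 * mgf K t2 (\<nu> 0) = ?term (Suc j)"
        unfolding * Q P ..
    qed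
    also have "\<dots> \<le> (\<Sum>j\<le>Suc n. ?term j)"
      unfolding sum.atMost_Suc_shift by (rule add_increasing) auto
    finally show ?thesis by (simp add: add_left_mono)
  qed
qed

text \<open>A pair of paths either shares its first child, which gives a second moment of the
  subtree, or has different first children, whose subtrees are independent given the root. Adding
  the squared means of the diagonal completes the off-diagonal sum to a square; this is the source
  of the inequality.\<close>

lemma (in env_seq) second_moment_path_sum_Suc:
  assumes g: "\<And>j. g j \<in> borel_measurable borel"
  defines "g' \<equiv> \<lambda>j. g (Suc j)"
  shows "(\<integral>\<^sup>+x. (path_sum K (Suc n) g x s)\<^sup>2 \<partial>tree_law \<nu>) \<le> (g 0 s)\<^sup>2 *
    (\<integral>\<^sup>+m. (\<Sum>i<K (fst m). \<integral>\<^sup>+x. (path_sum K n g' x (s + snd m i))\<^sup>2 \<partial>tree_law tail_env) +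
           (\<Sum>i<K (fst m). \<integral>\<^sup>+x. path_sum K n g' x (s + snd m i) \<partial>tree_law tail_env)\<^sup>2 \<partial>\<nu> 0)"
proof -
  let ?P = "\<Pi>\<^sub>M i\<in>(UNIV::nat set). tree_law tail_env"
  interpret S: env_seq tail_env by (rule env_seq_Suc) unfold_locales
  have sets_P: "sets ?P = sets (\<Pi>\<^sub>M i\<in>UNIV. tree_space)"
    by (intro sets_PiM_cong) auto
  have m1: "(\<lambda>x. path_sum K n g' x s) \<in> borel_measurable tree_space" for s
    unfolding g'_def by (rule measurable_path_sum_tree) (rule g)
  have m1': "(\<lambda>x. (path_sum K n g' x s)\<^sup>2) \<in> borel_measurable tree_space" for s
    unfolding power2_eq_square by (intro borel_measurable_times_ennreal m1)
  have comp: "(\<lambda>y. y i) \<in> ?P \<rightarrow>\<^sub>M tree_space" for i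
    unfolding measurable_cong_sets[OF sets_P refl] by (rule measurable_component_singleton) simp
  have m2: "(\<lambda>y. path_sum K n g' (y i) s) \<in> borel_measurable ?P" for s i
    by (rule measurable_compose[OF comp m1])
  let ?h = "\<lambda>x. \<Sum>i<K (fst (x [])). path_sum K n g' (\<lambda>u. x (i # u)) (s + snd (x []) i)"
  have h: "?h \<in> borel_measurable tree_space"
  proof -
    have "(\<lambda>x. path_sum K (Suc n) (\<lambda>j. if j = 0 then (\<lambda>_. 1) else g j) x s) \<in> borel_measurable tree_space"
      by (rule measurable_path_sum_tree) (use g in auto)
    then show ?thesis by (simp add: g'_def)
  qed
  have h2: "(\<lambda>x. (?h x)\<^sup>2) \<in> borel_measurable tree_space"
    unfolding power2_eq_square by (intro borel_measurable_times_ennreal h)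
  have h3: "(\<lambda>x. (?h x)\<^sup>2) \<in> borel_measurable (tree_law \<nu>)"
    using h2 unfolding measurable_cong_sets[OF sets_tree_law refl] .
  have "(\<integral>\<^sup>+x. (path_sum K (Suc n) g x s)\<^sup>2 \<partial>tree_law \<nu>) = (\<integral>\<^sup>+x. (g 0 s)\<^sup>2 * (?h x)\<^sup>2 \<partial>tree_law \<nu>)"
    by (simp add: g'_def power_mult_distrib)
  also have "\<dots> = (g 0 s)\<^sup>2 * (\<integral>\<^sup>+x. (?h x)\<^sup>2 \<partial>tree_law \<nu>)"
    by (rule nn_integral_cmult[OF h3])
  finally have eq: "(\<integral>\<^sup>+x. (path_sum K (Suc n) g x s)\<^sup>2 \<partial>tree_law \<nu>) =
    (g 0 s)\<^sup>2 * (\<integral>\<^sup>+x. (?h x)\<^sup>2 \<partial>tree_law \<nu>)" .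
  have "(\<integral>\<^sup>+x. (?h x)\<^sup>2 \<partial>tree_law \<nu>) =
      (\<integral>\<^sup>+m. (\<integral>\<^sup>+y. (\<Sum>i<K (fst m). path_sum K n g' (y i) (s + snd m i))\<^sup>2 \<partial>?P) \<partial>\<nu> 0)"
    by (subst nn_integral_tree_law[OF h2]) simp
  also have "\<dots> \<le> (\<integral>\<^sup>+m. (\<Sum>i<K (fst m). \<integral>\<^sup>+x. (path_sum K n g' x (s + snd m i))\<^sup>2 \<partial>tree_law tail_env) +
           (\<Sum>i<K (fst m). \<integral>\<^sup>+x. path_sum K n g' x (s + snd m i) \<partial>tree_law tail_env)\<^sup>2 \<partial>\<nu> 0)"
  proof (rule nn_integral_mono)
    fix m :: mark
    let ?k = "K (fst m)"
    let ?f = "\<lambda>i x. path_sum K n g' x (s + snd m i)"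
    let ?F = "\<lambda>i. \<integral>\<^sup>+x. ?f i x \<partial>tree_law tail_env"
    let ?G = "\<lambda>i. \<integral>\<^sup>+x. (?f i x)\<^sup>2 \<partial>tree_law tail_env"
    have fm: "(\<lambda>y. ?f i (y i)) \<in> borel_measurable ?P" for i by (rule m2)
    have "(\<integral>\<^sup>+y. (\<Sum>i<?k. ?f i (y i))\<^sup>2 \<partial>?P) = (\<integral>\<^sup>+y. (\<Sum>i<?k. \<Sum>j<?k. ?f i (y i) * ?f j (y j)) \<partial>?P)"
      by (simp add: power2_eq_square sum_product)
    also have "\<dots> = (\<Sum>i<?k. \<Sum>j<?k. \<integral>\<^sup>+y. ?f i (y i) * ?f j (y j) \<partial>?P)"
      by (subst nn_integral_sum, (intro borel_measurable_sum borel_measurable_times_ennreal fm),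
          intro sum.cong refl nn_integral_sum borel_measurable_times_ennreal fm)
    also have "\<dots> \<le> (\<Sum>i<?k. \<Sum>j<?k. (if i = j then ?G i else 0) + ?F i * ?F j)"
    proof (intro sum_mono)
      fix i j
      show "(\<integral>\<^sup>+y. ?f i (y i) * ?f j (y j) \<partial>?P) \<le> (if i = j then ?G i else 0) + ?F i * ?F j"
      proof (cases "i = j")
        case True
        have "(\<integral>\<^sup>+y. (?f i (y i))\<^sup>2 \<partial>?P) = ?G i"
          by (rule nn_integral_subtree[OF m1'])
        then show ?thesis using True by (simp add: power2_eq_square)
      next
        case False
        have "(\<integral>\<^sup>+y. (\<Prod>k\<in>{i, j}. ?f k (y k)) \<partial>?P) = (\<Prod>k\<in>{i, j}. ?F k)"
          by (rule nn_integral_prod_subtrees) (auto intro: m1)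
        then show ?thesis using False by simp
      qed
    qed
    also have "\<dots> = (\<Sum>i<?k. ?G i) + (\<Sum>i<?k. ?F i)\<^sup>2"
      by (simp add: sum.distrib sum.delta power2_eq_square sum_product)
    finally show "(\<integral>\<^sup>+y. (\<Sum>i<?k. ?f i (y i))\<^sup>2 \<partial>?P) \<le> (\<Sum>i<?k. ?G i) + (\<Sum>i<?k. ?F i)\<^sup>2" .
  qed
  finally show ?thesis unfolding eq by (rule mult_left_mono) simp
qed

text \<open>Pairs of paths are sorted by the generation \<open>j\<close> at which they split.
  \<open>\<alpha> j\<close> and \<open>\<beta> j\<close> bound \<open>exp (- (t * y))\<close> and
  \<open>exp (t * y)\<close> on the tube, so \<open>\<alpha> j\<close> times the product up to
  \<open>j\<close> bounds the mean number of splitting particles, and the squared bracket bounds the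
  mean number of descendants of at most \<open>c\<close> children. The first summand belongs to
  pairs that never split.\<close>

lemma tube_second_moment:
  assumes "env_seq \<nu>" "\<And>j. B j \<in> sets borel"
    and "\<And>k. K k \<le> c"
    and "\<And>j y. y \<in> B j \<Longrightarrow> 1 \<le> \<alpha> j * ennreal (exp (t * y))"
    and "\<And>j y. y \<in> B j \<Longrightarrow> ennreal (exp (t * y)) \<le> \<beta> j"
  shows "(\<integral>\<^sup>+x. (path_sum K n (\<lambda>j. indicator (B j)) x s)\<^sup>2 \<partial>tree_law \<nu>) \<le>
    ennreal (exp (t * s)) * (\<alpha> n * (\<Prod>k\<in>{0..<n}. mgf K t (\<nu> k)) +
      (\<Sum>j<n. \<alpha> j * (\<Prod>k\<in>{0..<j}. mgf K t (\<nu> k)) *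
        (of_nat c * \<alpha> n * \<beta> (Suc j) * (\<Prod>k\<in>{Suc j..<n}. mgf K t (\<nu> k)))\<^sup>2))"
  using assms
proof (induction n arbitrary: B \<nu> s \<alpha> \<beta>)
  case 0
  then interpret env_seq \<nu> by simp
  interpret T: prob_space "tree_law \<nu>" by (rule prob_space_tree_law)
  show ?case using "0.prems"(4)[of s 0]
    by (cases "s \<in> B 0") (auto simp: T.emeasure_space_1[simplified] mult.commute)
next
  case (Suc n)
  interpret env_seq \<nu> by (rule Suc.prems)
  interpret N: prob_space "\<nu> 0" by (rule prob_space_env)
  let ?g = "\<lambda>j. indicator (B j) :: real \<Rightarrow> ennreal"
  let ?g' = "\<lambda>j. indicator (B (Suc j)) :: real \<Rightarrow> ennreal"
  let ?P = "\<lambda>j n. \<Prod>k\<in>{j..<n}. mgf K t (\<nu> k)"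
  let ?P' = "\<lambda>j n. \<Prod>k\<in>{j..<n}. mgf K t (\<nu> (Suc k))"
  let ?F = "\<lambda>y. \<integral>\<^sup>+x. path_sum K n ?g' x y \<partial>tree_law tail_env"
  let ?G = "\<lambda>y. \<integral>\<^sup>+x. (path_sum K n ?g' x y)\<^sup>2 \<partial>tree_law tail_env"
  let ?e = "\<lambda>y. ennreal (exp (t * y))"
  have g: "?g j \<in> borel_measurable borel" for j using Suc.prems(2) by auto
  \<comment> \<open>\<open>R\<close> is what the induction hypothesis leaves for the second moment
    below a child once \<open>exp (t * y)\<close> is taken out. \<open>b\<close> bounds the mean
    count below a child uniformly in its position, because the count vanishes off
    \<open>B (Suc 0)\<close>.\<close>
  define R where "R = \<alpha> (Suc n) * ?P' 0 n +
      (\<Sum>j<n. \<alpha> (Suc j) * ?P' 0 j * (of_nat c * \<alpha> (Suc n) * \<beta> (Suc (Suc j)) * ?P' (Suc j) n)\<^sup>2)"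
  define b where "b = \<alpha> (Suc n) * \<beta> (Suc 0) * ?P' 0 n"
  have G: "?G y \<le> ?e y * R" for y
    unfolding R_def by (rule Suc.IH) (use Suc.prems env_seq_Suc in auto)
  have F: "?F y \<le> b" for y
  proof (cases "y \<in> B (Suc 0)")
    case True
    have "?F y \<le> \<alpha> (Suc n) * ?e y * ?P' 0 n"
    proof (rule mean_path_sum_le)
      show "indicator (B (Suc n)) y \<le> \<alpha> (Suc n) * ennreal (exp (t * y))" for y
        using Suc.prems(4)[of y "Suc n"] by (auto split: split_indicator)
    qed (use g env_seq_Suc[OF Suc.prems(1)] in \<open>auto split: split_indicator\<close>)
    also have "\<dots> \<le> b"
      unfolding b_def using Suc.prems(5)[OF True] by (intro mult_right_mono mult_left_mono) auto
    finally show ?thesis .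
  next
    case False
    then have "path_sum K n ?g' x y = 0" for x by (cases n) auto
    then show ?thesis by simp
  qed
  have mR: "(\<lambda>m. \<Sum>i<K (fst m). R * ?e (s + snd m i)) \<in> borel_measurable (\<nu> 0)"
    by (rule measurable_sum_marks) auto
  have "(\<integral>\<^sup>+x. (path_sum K (Suc n) ?g x s)\<^sup>2 \<partial>tree_law \<nu>) \<le> (?g 0 s)\<^sup>2 *
      (\<integral>\<^sup>+m. (\<Sum>i<K (fst m). ?G (s + snd m i)) + (\<Sum>i<K (fst m). ?F (s + snd m i))\<^sup>2 \<partial>\<nu> 0)"
    by (rule second_moment_path_sum_Suc[OF g])
  also have "\<dots> \<le> (?g 0 s)\<^sup>2 * (\<integral>\<^sup>+m. (\<Sum>i<K (fst m). R * ?e (s + snd m i)) + (of_nat c * b)\<^sup>2 \<partial>\<nu> 0)"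
  proof (intro mult_left_mono nn_integral_mono add_mono sum_mono power_mono)
    fix m :: mark
    show "?G (s + snd m i) \<le> R * ?e (s + snd m i)" for i
      using G[of "s + snd m i"] by (simp only: mult.commute)
    have "(\<Sum>i<K (fst m). ?F (s + snd m i)) \<le> (\<Sum>i<K (fst m). b)"
      by (intro sum_mono F)
    also have "\<dots> \<le> of_nat c * b"
      using Suc.prems(3)[of "fst m"] by (simp add: mult_right_mono)
    finally show "(\<Sum>i<K (fst m). ?F (s + snd m i)) \<le> of_nat c * b" .
  qed auto
  also have "\<dots> = (?g 0 s)\<^sup>2 * (R * ?e s * mgf K t (\<nu> 0) + (of_nat c * b)\<^sup>2)"
    by (simp only: nn_integral_add[OF mR borel_measurable_const] nn_integral_sum_exp[OF sets_env]
        nn_integral_const N.emeasure_space_1 mult_1_right)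
  \<comment> \<open>The squared indicator of the start is at most 1 and at most
    \<open>\<alpha> 0 * exp (t * s)\<close>: the first bound serves the term that already carries
    the weight of \<open>s\<close>, the second creates that weight in the other.\<close>
  also have "\<dots> \<le> R * ?e s * mgf K t (\<nu> 0) + (\<alpha> 0 * ?e s) * (of_nat c * b)\<^sup>2"
  proof -
    have "(?g 0 s)\<^sup>2 \<le> 1" by (auto split: split_indicator)
    moreover have "(?g 0 s)\<^sup>2 \<le> \<alpha> 0 * ?e s"
      using Suc.prems(4)[of s 0] by (auto split: split_indicator)
    ultimately have "(?g 0 s)\<^sup>2 * (R * ?e s * mgf K t (\<nu> 0)) \<le> 1 * (R * ?e s * mgf K t (\<nu> 0))"
      "(?g 0 s)\<^sup>2 * (of_nat c * b)\<^sup>2 \<le> (\<alpha> 0 * ?e s) * (of_nat c * b)\<^sup>2"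
      by (intro mult_right_mono; simp)+
    then show ?thesis by (simp only: distrib_left mult_1_left add_mono)
  qed
  also have "\<dots> = ?e s * (mgf K t (\<nu> 0) * R + \<alpha> 0 * (of_nat c * b)\<^sup>2)"
    by (simp add: algebra_simps)
  also have "mgf K t (\<nu> 0) * R = \<alpha> (Suc n) * ?P 0 (Suc n) +
      (\<Sum>j<n. \<alpha> (Suc j) * ?P 0 (Suc j) * (of_nat c * \<alpha> (Suc n) * \<beta> (Suc (Suc j)) * ?P (Suc (Suc j)) (Suc n))\<^sup>2)"
    unfolding R_def distrib_left sum_distrib_left
    by (simp only: prod.atLeast0_lessThan_Suc_shift comp_def prod.shift_bounds_Suc_ivl mult_ac)
  also have "b = \<alpha> (Suc n) * \<beta> (Suc 0) * ?P (Suc 0) (Suc n)"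
    by (simp only: b_def prod.shift_bounds_Suc_ivl)
  also have "?e s * (\<alpha> (Suc n) * ?P 0 (Suc n) +
      (\<Sum>j<n. \<alpha> (Suc j) * ?P 0 (Suc j) * (of_nat c * \<alpha> (Suc n) * \<beta> (Suc (Suc j)) * ?P (Suc (Suc j)) (Suc n))\<^sup>2) +
      \<alpha> 0 * (of_nat c * (\<alpha> (Suc n) * \<beta> (Suc 0) * ?P (Suc 0) (Suc n)))\<^sup>2) =
    ?e s * (\<alpha> (Suc n) * ?P 0 (Suc n) +
      (\<Sum>j<Suc n. \<alpha> j * ?P 0 j * (of_nat c * \<alpha> (Suc n) * \<beta> (Suc j) * ?P (Suc j) (Suc n))\<^sup>2))"
    unfolding sum.lessThan_Suc_shift by (simp only: mult.assoc atLeastLessThan_empty_iff2 prod.empty mult_1_left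
        order_refl atLeastLessThan_empty add_ac)
  finally show ?case .
qed

text \<open>Values below \<open>D / 2\<close> contribute at most \<open>D / 2\<close> to the mean,
  so at least \<open>D / 2\<close> comes from the rest, and Cauchy-Schwarz compares that part with
  its probability. \<open>D\<close> need only be a lower bound for the mean, and \<open>r\<close>
  measures the second moment in units of \<open>D\<^sup>2\<close>.\<close>

lemma (in prob_space) paley_zygmund:
  assumes [measurable]: "Y \<in> borel_measurable M"
    and D: "ennreal D \<le> (\<integral>\<^sup>+x. Y x \<partial>M)" "0 < D"
    and S: "(\<integral>\<^sup>+x. (Y x)\<^sup>2 \<partial>M) \<le> ennreal (D\<^sup>2 * r)" "0 < r"
  shows "1 / (4 * r) \<le> prob {x \<in> space M. ennreal (D / 2) \<le> Y x}"
proof -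
  let ?A = "{x \<in> space M. ennreal (D / 2) \<le> Y x}"
  let ?I = "indicator ?A :: 'a \<Rightarrow> ennreal"
  have "ennreal D \<le> (\<integral>\<^sup>+x. ennreal (D / 2) + Y x * ?I x \<partial>M)"
    by (rule order_trans[OF D(1)], rule nn_integral_mono) (auto split: split_indicator)
  also have "\<dots> = ennreal (D / 2) + (\<integral>\<^sup>+x. Y x * ?I x \<partial>M)"
    by (simp add: nn_integral_add emeasure_space_1)
  finally have "ennreal (D / 2) + ennreal (D / 2) \<le> ennreal (D / 2) + (\<integral>\<^sup>+x. Y x * ?I x \<partial>M)"
    using D(2) by (simp add: ennreal_plus[symmetric] del: ennreal_plus)
  then have "ennreal (D / 2) \<le> (\<integral>\<^sup>+x. Y x * ?I x \<partial>M)"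
    by (simp add: ennreal_add_left_cancel_le)
  then have "(ennreal (D / 2))\<^sup>2 \<le> (\<integral>\<^sup>+x. Y x * ?I x \<partial>M)\<^sup>2"
    by (rule power_mono) simp
  also have "\<dots> \<le> (\<integral>\<^sup>+x. (Y x)\<^sup>2 \<partial>M) * (\<integral>\<^sup>+x. (?I x)\<^sup>2 \<partial>M)"
    by (rule Cauchy_Schwarz_nn_integral) auto
  also have "(\<integral>\<^sup>+x. (?I x)\<^sup>2 \<partial>M) = (\<integral>\<^sup>+x. ?I x \<partial>M)"
    by (intro nn_integral_cong) (auto split: split_indicator)
  also have "\<dots> = emeasure M ?A" by simp
  also have "(\<integral>\<^sup>+x. (Y x)\<^sup>2 \<partial>M) * emeasure M ?A \<le> ennreal (D\<^sup>2 * r) * emeasure M ?A"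
    by (rule mult_right_mono[OF S(1)]) simp
  finally have "ennreal ((D / 2)\<^sup>2) \<le> ennreal (D\<^sup>2 * r * prob ?A)"
    using D(2) S(2) by (simp add: emeasure_eq_measure ennreal_mult'' ennreal_power)
  then have "(D / 2)\<^sup>2 \<le> D\<^sup>2 * r * prob ?A"
    using S(2) by (subst (asm) ennreal_le_iff) auto
  then have "D\<^sup>2 * 1 \<le> D\<^sup>2 * (4 * r * prob ?A)"
    by (simp add: power_divide)
  then have "1 \<le> 4 * r * prob ?A" using D(2) by simp
  then show ?thesis using S(2) by (simp add: field_simps)
qed

section \<open>The number of paths in a tube around a line\<close>

definition tube :: "real \<Rightarrow> real \<Rightarrow> nat \<Rightarrow> real set" where
  "tube v w j = {y. \<bar>y - real j * v\<bar> \<le> w}"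

lemma tube_borel [measurable]: "tube v w j \<in> sets borel"
  unfolding tube_def by measurable

lemma prod_ennreal_exp:
  assumes "\<And>k. k \<in> I \<Longrightarrow> f k = ennreal (exp (a k))"
  shows "(\<Prod>k\<in>I. f k) = ennreal (exp (\<Sum>k\<in>I. a k))"
proof (cases "finite I")
  case True
  have "(\<Prod>k\<in>I. f k) = (\<Prod>k\<in>I. ennreal (exp (a k)))" using assms by simp
  also have "\<dots> = ennreal (\<Prod>k\<in>I. exp (a k))" by (rule prod_ennreal) simp
  finally show ?thesis using True by (simp add: exp_sum)
qed simp

lemma prod_le_ennreal_exp:
  assumes "\<And>k. k \<in> I \<Longrightarrow> f k \<le> ennreal (exp (a k))"
  shows "(\<Prod>k\<in>I. f k) \<le> ennreal (exp (\<Sum>k\<in>I. a k))"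
proof -
  have "(\<Prod>k\<in>I. f k) \<le> (\<Prod>k\<in>I. ennreal (exp (a k)))" using assms by (intro prod_mono_ennreal)
  then show ?thesis by (simp add: prod_ennreal_exp[of I _ a])
qed

lemma sum_ivl_diff: "(i :: nat) \<le> j \<Longrightarrow> (\<Sum>k\<in>{i..<j}. a k) = (\<Sum>k<j. a k) - (\<Sum>k<i. a k :: real)"
  using sum.atLeastLessThan_concat[of 0 i j a] by (simp add: atLeast0LessThan)

lemma abs_mult_tube:
  assumes "\<bar>y - p\<bar> \<le> w"
  shows "t * y \<le> t * p + \<bar>t\<bar> * w" "t * p \<le> t * y + \<bar>t\<bar> * (w :: real)"
proof -
  have "\<bar>t * (y - p)\<bar> \<le> \<bar>t\<bar> * w" using assms by (simp add: abs_mult mult_left_mono)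
  then show "t * y \<le> t * p + \<bar>t\<bar> * w" "t * p \<le> t * y + \<bar>t\<bar> * w"
    by (auto simp: algebra_simps abs_le_iff)
qed

text \<open>Chernoff's inequality in the shape that \<open>mean_tube_ge\<close> consumes: above the
  tube the weight at \<open>t + r\<close> pays, below it the weight at \<open>t - r\<close>.\<close>

lemma exp_outside_tube:
  assumes "y \<notin> tube v w j" "0 < r"
  shows "exp (t * y) \<le> exp (- r * (j * v + w)) * exp ((t + r) * y) + exp (r * (j * v - w)) * exp ((t - r) * y)"
proof (cases "y > j * v + w")
  case True
  then have "0 \<le> r * (y - (j * v + w))" using assms(2) by simp
  then have "exp (t * y) \<le> exp (- r * (j * v + w) + (t + r) * y)"
    by (simp add: algebra_simps)
  then have "exp (t * y) \<le> exp (- r * (j * v + w)) * exp ((t + r) * y)"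
    by (simp only: exp_add)
  then show ?thesis by (rule order_trans) simp
next
  case False
  then have "y < j * v - w" using assms(1) by (auto simp: tube_def abs_le_iff)
  then have "0 \<le> r * (j * v - w - y)" using assms(2) by simp
  then have "exp (t * y) \<le> exp (r * (j * v - w) + (t - r) * y)"
    by (simp add: algebra_simps)
  then have "exp (t * y) \<le> exp (r * (j * v - w)) * exp ((t - r) * y)"
    by (simp only: exp_add)
  then show ?thesis by (rule order_trans) simp
qed

text \<open>The averages \<rho>, \<rho>1, \<rho>2 belong to the exponents \<open>t\<close>,
  \<open>t + r\<close>, \<open>t - r\<close>, and \<open>E\<close> is the error of all initial sums
  up to length \<open>l\<close>. At \<open>t + r\<close> and \<open>t - r\<close> upper bounds
  suffice, so there the logarithms of the full process may be used while \<open>t\<close> has the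
  truncated ones. \<open>small\<close> says that the two ways of leaving the tube, at
  \<open>l + 1\<close> times, cost at most half of the weighted mean.\<close>

locale tube_estimate =
  fixes \<nu> :: "nat \<Rightarrow> mark measure" and K :: "nat \<Rightarrow> nat" and c l :: nat
    and a b1 b2 :: "nat \<Rightarrow> real" and t r v w \<rho> \<rho>1 \<rho>2 \<sigma> E :: real
  assumes env: "env_seq \<nu>"
    and K: "K k \<le> c"
    and mgf_t: "k < l \<Longrightarrow> mgf K t (\<nu> k) = ennreal (exp (a k))"
    and mgf_up: "k < l \<Longrightarrow> mgf K (t + r) (\<nu> k) \<le> ennreal (exp (b1 k))"
    and mgf_down: "k < l \<Longrightarrow> mgf K (t - r) (\<nu> k) \<le> ennreal (exp (b2 k))"
    and sum_t: "j \<le> l \<Longrightarrow> \<bar>(\<Sum>k<j. a k) - j * \<rho>\<bar> \<le> E"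
    and sum_up: "j \<le> l \<Longrightarrow> (\<Sum>k<j. b1 k) \<le> j * \<rho>1 + E"
    and sum_down: "j \<le> l \<Longrightarrow> (\<Sum>k<j. b2 k) \<le> j * \<rho>2 + E"
    and r: "0 < r" and w: "0 \<le> w" and \<sigma>: "0 \<le> \<sigma>"
    and slope_up: "\<rho>1 - \<rho> - r * v \<le> \<sigma>"
    and slope_down: "\<rho>2 - \<rho> + r * v \<le> \<sigma>"
    and small: "2 * (real l + 1) * exp (l * \<sigma> + 2 * E - r * w) \<le> 1 / 2"
    and growth: "t * v \<le> \<rho>"
begin

sublocale env_seq \<nu> by (rule env)

abbreviation A where "A j \<equiv> \<Sum>k<j. a k"

abbreviation count where
  "count \<equiv> \<lambda>x. path_sum K l (\<lambda>j. indicator (tube v w j)) x 0"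

text \<open>Half of the weighted mean \<open>exp (A l)\<close>, the half that survives confinement
  to the tube, divided by the largest weight in the final window.\<close>

definition D where "D = exp (A l - t * l * v - \<bar>t\<bar> * w) / 2"

lemma prod_mgf: "i \<le> j \<Longrightarrow> j \<le> l \<Longrightarrow> (\<Prod>k\<in>{i..<j}. mgf K t (\<nu> k)) = ennreal (exp (A j - A i))"
  using mgf_t by (subst prod_ennreal_exp[where a=a]) (auto simp: sum_ivl_diff)

lemma mean_count_ge: "ennreal D \<le> (\<integral>\<^sup>+x. count x \<partial>tree_law \<nu>)"
proof -
  let ?Y = "\<integral>\<^sup>+x. count x \<partial>tree_law \<nu>"
  let ?\<beta> = "exp (t * l * v + \<bar>t\<bar> * w)"
  let ?\<gamma>1 = "\<lambda>j. ennreal (exp (- r * (j * v + w)))"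
  let ?\<gamma>2 = "\<lambda>j. ennreal (exp (r * (j * v - w)))"
  let ?Q = "\<lambda>t j. \<Prod>k\<in>{0..<j}. mgf K t (\<nu> k)"
  let ?s = "exp (l * \<sigma> + 2 * E - r * w)"
  have "ennreal (exp (t * 0)) * (\<Prod>k\<in>{0..<l}. mgf K t (\<nu> k)) \<le> ennreal ?\<beta> * ?Y +
    (\<Sum>j\<le>l. (?\<gamma>1 j * ennreal (exp ((t + r) * 0)) * ?Q (t + r) j +
            ?\<gamma>2 j * ennreal (exp ((t - r) * 0)) * ?Q (t - r) j) * (\<Prod>k\<in>{j..<l}. mgf K t (\<nu> k)))"
  proof (rule mean_tube_ge[OF env])
    show "ennreal (exp (t * y)) \<le> ennreal ?\<beta>" if "y \<in> tube v w l" for y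
      using abs_mult_tube(1)[of y "l * v" w t] that by (simp add: tube_def mult.assoc)
    show "ennreal (exp (t * y)) \<le> ?\<gamma>1 j * ennreal (exp ((t + r) * y)) + ?\<gamma>2 j * ennreal (exp ((t - r) * y))"
      if "y \<notin> tube v w j" for j y
      using exp_outside_tube[OF that r, of t]
      by (simp add: ennreal_mult'[symmetric] ennreal_plus[symmetric] del: ennreal_plus)
  qed simp
  also have "\<dots> \<le> ennreal ?\<beta> * ?Y + (\<Sum>j\<le>l. ennreal (2 * ?s * exp (A l)))"
  proof (intro add_left_mono sum_mono)
    fix j assume "j \<in> {..l}"
    then have j: "j \<le> l" by simp
    have Q1: "?Q (t + r) j \<le> ennreal (exp (j * \<rho>1 + E))"
      using prod_le_ennreal_exp[of "{0..<j}" "\<lambda>k. mgf K (t + r) (\<nu> k)" b1] mgf_up j sum_up[OF j]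
      by (auto simp: atLeast0LessThan intro: order_trans)
    have Q2: "?Q (t - r) j \<le> ennreal (exp (j * \<rho>2 + E))"
      using prod_le_ennreal_exp[of "{0..<j}" "\<lambda>k. mgf K (t - r) (\<nu> k)" b2] mgf_down j sum_down[OF j]
      by (auto simp: atLeast0LessThan intro: order_trans)
    have "j * \<sigma> \<le> l * \<sigma>" using j \<sigma> by (simp add: mult_right_mono)
    moreover have "j * (\<rho>1 - \<rho> - r * v) \<le> j * \<sigma>" "j * (\<rho>2 - \<rho> + r * v) \<le> j * \<sigma>"
      using slope_up slope_down by (auto intro!: mult_left_mono)
    moreover have "- A j \<le> E - j * \<rho>" using sum_t[OF j] by (auto simp: abs_le_iff)
    \<comment> \<open>One \<open>E\<close> pays for replacing \<open>A j\<close> by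
      \<open>j * \<rho>\<close>, the other comes with the sum at \<open>t + r\<close> or
      \<open>t - r\<close>. What remains is \<open>j\<close> times a slope defect, at most
      \<open>j * \<sigma>\<close> and hence at most \<open>l * \<sigma>\<close>.\<close>
    ultimately have e: "- r * (j * v + w) + (j * \<rho>1 + E) + (A l - A j) \<le> l * \<sigma> + 2 * E - r * w + A l"
      "r * (j * v - w) + (j * \<rho>2 + E) + (A l - A j) \<le> l * \<sigma> + 2 * E - r * w + A l"
      by (simp_all add: algebra_simps)
    have "(?\<gamma>1 j * ennreal (exp ((t + r) * 0)) * ?Q (t + r) j +
            ?\<gamma>2 j * ennreal (exp ((t - r) * 0)) * ?Q (t - r) j) * (\<Prod>k\<in>{j..<l}. mgf K t (\<nu> k)) \<le>
      (?\<gamma>1 j * ennreal (exp (j * \<rho>1 + E)) + ?\<gamma>2 j * ennreal (exp (j * \<rho>2 + E))) * ennreal (exp (A l - A j))"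
      unfolding prod_mgf[OF j order_refl]
      by (intro mult_right_mono add_mono) (auto intro!: mult_left_mono Q1 Q2)
    also have "\<dots> = ennreal (exp (- r * (j * v + w) + (j * \<rho>1 + E) + (A l - A j)) +
        exp (r * (j * v - w) + (j * \<rho>2 + E) + (A l - A j)))"
      unfolding exp_add by (simp add: ennreal_mult'[symmetric] ennreal_plus[symmetric] distrib_right del: ennreal_plus)
    also have "\<dots> \<le> ennreal (2 * ?s * exp (A l))"
    proof (rule ennreal_leI)
      have "exp (- r * (j * v + w) + (j * \<rho>1 + E) + (A l - A j)) +
        exp (r * (j * v - w) + (j * \<rho>2 + E) + (A l - A j)) \<le>
        exp (l * \<sigma> + 2 * E - r * w + A l) + exp (l * \<sigma> + 2 * E - r * w + A l)"
        by (intro add_mono) (simp_all only: exp_le_cancel_iff e)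
      then show "exp (- r * (j * v + w) + (j * \<rho>1 + E) + (A l - A j)) +
        exp (r * (j * v - w) + (j * \<rho>2 + E) + (A l - A j)) \<le> 2 * ?s * exp (A l)"
        by (simp only: exp_add mult_2 distrib_right)
    qed
    finally show "(?\<gamma>1 j * ennreal (exp ((t + r) * 0)) * ?Q (t + r) j +
            ?\<gamma>2 j * ennreal (exp ((t - r) * 0)) * ?Q (t - r) j) * (\<Prod>k\<in>{j..<l}. mgf K t (\<nu> k)) \<le>
      ennreal (2 * ?s * exp (A l))" .
  qed
  also have "(\<Sum>j\<le>l. ennreal (2 * ?s * exp (A l))) = ennreal (2 * (real l + 1) * ?s * exp (A l))"
    by (simp add: ennreal_of_nat_eq_real_of_nat ennreal_mult'[symmetric] mult_ac add.commute del: ennreal_plus)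
  also have "\<dots> \<le> ennreal (exp (A l) / 2)"
    using mult_right_mono[OF small, of "exp (A l)"] by (intro ennreal_leI) simp
  finally have "ennreal (exp (A l)) \<le> ennreal ?\<beta> * ?Y + ennreal (exp (A l) / 2)"
    by (simp add: prod_mgf add_left_mono)
  moreover have "ennreal (exp (A l)) = ennreal (exp (A l) / 2) + ennreal (exp (A l) / 2)"
    by (simp add: ennreal_plus[symmetric] del: ennreal_plus)
  ultimately have "ennreal (exp (A l) / 2) \<le> ennreal ?\<beta> * ?Y"
    by (simp add: ennreal_add_left_cancel_le add.commute)
  then have "ennreal (exp (- (t * l * v + \<bar>t\<bar> * w))) * ennreal (exp (A l) / 2) \<le>
      ennreal (exp (- (t * l * v + \<bar>t\<bar> * w))) * (ennreal ?\<beta> * ?Y)"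
    by (rule mult_left_mono) simp
  moreover have "ennreal (exp (- (t * l * v + \<bar>t\<bar> * w))) * (ennreal ?\<beta> * ?Y) = ?Y"
    by (simp add: mult.assoc[symmetric] ennreal_mult'[symmetric] exp_add[symmetric])
  moreover have "exp (- (t * l * v + \<bar>t\<bar> * w)) * (exp (A l) / 2) = D"
    by (simp add: D_def exp_add[symmetric] algebra_simps)
  ultimately show ?thesis by (simp add: ennreal_mult'[symmetric])
qed

text \<open>The exponent \<open>7\<close> counts factors \<open>exp (\<bar>t\<bar> * w)\<close>: one
  from \<open>\<alpha> j\<close>, four from the squares of \<open>\<alpha> l\<close> and
  \<open>\<beta> (Suc j)\<close>, and two that compensate those in \<open>D\<^sup>2\<close>. The
  \<open>3 * E\<close> comes from one \<open>A j\<close> and two \<open>A (Suc j)\<close>.\<close>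

lemma second_moment_count_le:
  "(\<integral>\<^sup>+x. (count x)\<^sup>2 \<partial>tree_law \<nu>) \<le>
    ennreal (D\<^sup>2 * (4 * (1 + (real c)\<^sup>2 * l) * exp (7 * \<bar>t\<bar> * w + 3 * E)))"
proof -
  let ?\<alpha> = "\<lambda>j. exp (- t * j * v + \<bar>t\<bar> * w)" and ?\<beta> = "\<lambda>j. exp (t * j * v + \<bar>t\<bar> * w)"
  let ?b = "D\<^sup>2 * (4 * exp (7 * \<bar>t\<bar> * w + 3 * E))"
  have b: "?b = exp (2 * A l - 2 * t * l * v + 5 * \<bar>t\<bar> * w + 3 * E)"
    by (simp add: D_def power_divide exp_double[symmetric] exp_add[symmetric] algebra_simps)
  have E: "0 \<le> E" using sum_t[of 0] by simp
  have "(\<integral>\<^sup>+x. (count x)\<^sup>2 \<partial>tree_law \<nu>) \<le> ennreal (exp (t * 0)) *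
     (ennreal (?\<alpha> l) * (\<Prod>k\<in>{0..<l}. mgf K t (\<nu> k)) +
      (\<Sum>j<l. ennreal (?\<alpha> j) * (\<Prod>k\<in>{0..<j}. mgf K t (\<nu> k)) *
        (of_nat c * ennreal (?\<alpha> l) * ennreal (?\<beta> (Suc j)) * (\<Prod>k\<in>{Suc j..<l}. mgf K t (\<nu> k)))\<^sup>2))"
  proof (rule tube_second_moment[OF env _ K])
    fix j y assume "y \<in> tube v w j"
    then have y: "\<bar>y - j * v\<bar> \<le> w" by (simp add: tube_def)
    show "1 \<le> ennreal (?\<alpha> j) * ennreal (exp (t * y))"
      using abs_mult_tube(2)[OF y, of t]
      by (simp add: ennreal_mult'[symmetric] exp_add[symmetric] algebra_simps ennreal_1[symmetric] del: ennreal_1)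
    show "ennreal (exp (t * y)) \<le> ennreal (?\<beta> j)"
      using abs_mult_tube(1)[OF y, of t] by (simp add: mult.assoc)
  qed simp
  also have "\<dots> \<le> ennreal ?b + (\<Sum>j<l. ennreal ((real c)\<^sup>2 * ?b))"
    unfolding mult_zero_right exp_zero ennreal_1 mult_1_left
  proof (intro add_mono sum_mono)
    \<comment> \<open>Pairs that never split contribute a mean instead of a squared mean. By
      \<open>growth\<close>, \<open>A l - t * l * v\<close> is at least \<open>- E\<close>, so the
      squared mean is not much smaller.\<close>
    have "l * (t * v) \<le> l * \<rho>" using growth by (intro mult_left_mono) auto
    then have "t * l * v - E \<le> A l" using sum_t[of l] by (simp add: abs_le_iff algebra_simps)
    moreover have "0 \<le> \<bar>t\<bar> * w" using w by simp
    ultimately have e: "- t * l * v + \<bar>t\<bar> * w + A l \<le> 2 * A l - 2 * t * l * v + 5 * \<bar>t\<bar> * w + 3 * E"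
      using E by (simp add: algebra_simps)
    have "ennreal (?\<alpha> l) * (\<Prod>k\<in>{0..<l}. mgf K t (\<nu> k)) = ennreal (exp (- t * l * v + \<bar>t\<bar> * w + A l))"
      by (simp add: prod_mgf ennreal_mult'[symmetric] exp_add[symmetric])
    also have "\<dots> \<le> ennreal ?b" unfolding b using e by simp
    finally show "ennreal (?\<alpha> l) * (\<Prod>k\<in>{0..<l}. mgf K t (\<nu> k)) \<le> ennreal ?b" .
  next
    fix j assume "j \<in> {..<l}"
    then have j: "j \<le> l" "Suc j \<le> l" by auto
    \<comment> \<open>Beyond the squared mean, a split at time \<open>j\<close> has the exponent
      \<open>A j - 2 * A (Suc j) + (j + 2) * (t * v)\<close>. This is at most
      \<open>3 * E - (j + 2) * (\<rho> - t * v)\<close>, and \<open>growth\<close> removes the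
      dependence on \<open>j\<close>.\<close>
    have "(j + 2) * (t * v) \<le> (j + 2) * \<rho>" using growth by (intro mult_left_mono) auto
    then have e: "- t * j * v + \<bar>t\<bar> * w + A j + 2 * (- t * l * v + \<bar>t\<bar> * w + (t * Suc j * v + \<bar>t\<bar> * w) + (A l - A (Suc j)))
        \<le> 2 * A l - 2 * t * l * v + 5 * \<bar>t\<bar> * w + 3 * E"
      using sum_t[OF j(1)] sum_t[OF j(2)] by (simp add: abs_le_iff algebra_simps)
    have "ennreal (?\<alpha> j) * (\<Prod>k\<in>{0..<j}. mgf K t (\<nu> k)) *
        (of_nat c * ennreal (?\<alpha> l) * ennreal (?\<beta> (Suc j)) * (\<Prod>k\<in>{Suc j..<l}. mgf K t (\<nu> k)))\<^sup>2 =
      ennreal (?\<alpha> j * exp (A j) * (c * ?\<alpha> l * ?\<beta> (Suc j) * exp (A l - A (Suc j)))\<^sup>2)"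
      using j by (simp only: prod_mgf order_refl le0 ennreal_of_nat_eq_real_of_nat ennreal_mult'[symmetric]
          ennreal_power exp_ge_zero of_nat_0_le_iff mult_nonneg_nonneg lessThan_0 sum.empty diff_zero)
    also have "?\<alpha> j * exp (A j) * (c * ?\<alpha> l * ?\<beta> (Suc j) * exp (A l - A (Suc j)))\<^sup>2 =
      (real c)\<^sup>2 * exp (- t * j * v + \<bar>t\<bar> * w + A j + 2 * (- t * l * v + \<bar>t\<bar> * w + (t * Suc j * v + \<bar>t\<bar> * w) + (A l - A (Suc j))))"
      by (simp only: power_mult_distrib exp_double[symmetric] exp_add distrib_left mult_ac)
    also have "\<dots> \<le> (real c)\<^sup>2 * ?b"
      unfolding b using e by (intro mult_left_mono) auto
    finally show "ennreal (?\<alpha> j) * (\<Prod>k\<in>{0..<j}. mgf K t (\<nu> k)) *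
        (of_nat c * ennreal (?\<alpha> l) * ennreal (?\<beta> (Suc j)) * (\<Prod>k\<in>{Suc j..<l}. mgf K t (\<nu> k)))\<^sup>2 \<le>
      ennreal ((real c)\<^sup>2 * ?b)"
      by (simp add: ennreal_leI)
  qed
  also have "\<dots> = ennreal (?b + l * ((real c)\<^sup>2 * ?b))"
    by (simp add: ennreal_of_nat_eq_real_of_nat ennreal_mult'[symmetric] ennreal_plus[symmetric] del: ennreal_plus)
  also have "?b + l * ((real c)\<^sup>2 * ?b) = D\<^sup>2 * (4 * (1 + (real c)\<^sup>2 * l) * exp (7 * \<bar>t\<bar> * w + 3 * E))"
    by (simp add: algebra_simps)
  finally show ?thesis .
qed

text \<open>The threshold is \<open>D / 2\<close> with \<open>A l\<close> replaced by its lower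
  bound \<open>l * \<rho> - E\<close>. Apart from a polynomial factor the probability is small only
  through \<open>w\<close> and \<open>E\<close>, which later are small multiples of n.\<close>

lemma prob_count_ge:
  "exp (- (7 * \<bar>t\<bar> * w + 3 * E)) / (16 * (1 + (real c)\<^sup>2 * l)) \<le>
    measure (tree_law \<nu>) {x. ennreal (exp (l * (\<rho> - t * v) - E - \<bar>t\<bar> * w) / 4) \<le> count x}"
proof -
  interpret T: prob_space "tree_law \<nu>" by (rule prob_space_tree_law)
  let ?r = "4 * (1 + (real c)\<^sup>2 * l) * exp (7 * \<bar>t\<bar> * w + 3 * E)"
  have c: "0 < 1 + (real c)\<^sup>2 * l" by (simp add: add_pos_nonneg)
  have m: "count \<in> borel_measurable (tree_law \<nu>)"
    unfolding measurable_cong_sets[OF sets_tree_law refl] by (rule measurable_path_sum_tree) simp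
  have "1 / (4 * ?r) \<le> T.prob {x \<in> space (tree_law \<nu>). ennreal (D / 2) \<le> count x}"
    by (rule T.paley_zygmund[OF m mean_count_ge _ second_moment_count_le]) (use c in \<open>simp_all add: D_def\<close>)
  also have "\<dots> \<le> T.prob {x. ennreal (exp (l * (\<rho> - t * v) - E - \<bar>t\<bar> * w) / 4) \<le> count x}"
  proof (rule T.finite_measure_mono)
    have "exp (l * (\<rho> - t * v) - E - \<bar>t\<bar> * w) / 4 \<le> D / 2"
      using sum_t[of l] by (simp add: D_def abs_le_iff algebra_simps)
    then show "{x \<in> space (tree_law \<nu>). ennreal (D / 2) \<le> count x} \<subseteq>
        {x. ennreal (exp (l * (\<rho> - t * v) - E - \<bar>t\<bar> * w) / 4) \<le> count x}"
      using order_trans[OF ennreal_leI] by blast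
    have "{x \<in> space (tree_law \<nu>). ennreal (exp (l * (\<rho> - t * v) - E - \<bar>t\<bar> * w) / 4) \<le> count x} \<in> T.events"
      using m by measurable
    then show "{x. ennreal (exp (l * (\<rho> - t * v) - E - \<bar>t\<bar> * w) / 4) \<le> count x} \<in> T.events" by simp
  qed
  finally have "1 / (4 * ?r) \<le> T.prob {x. ennreal (exp (l * (\<rho> - t * v) - E - \<bar>t\<bar> * w) / 4) \<le> count x}" .
  moreover have "1 / (4 * (4 * C * exp X)) = exp (- X) / (16 * C)" for C X :: real
    by (simp add: exp_minus divide_simps)
  ultimately show ?thesis by (simp only:)
qed

end

section \<open>Generations of a tree\<close>

lemma finite_generation [simp]: "finite (generation x n)"
proof (induction n)
  case (Suc n)
  have "generation x (Suc n) = (\<Union>u\<in>generation x n. (\<lambda>i. u @ [i]) ` {..<fst (x u)})"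
    by auto
  then show ?case using Suc by simp
qed simp

lemma length_generation: "u \<in> generation x n \<Longrightarrow> length u = n"
  by (induction n arbitrary: u) auto

text \<open>\<open>generation\<close> appends children at the end of a word, whereas the branching
  property removes the first letter; this converts between the two recursions.\<close>

lemma Cons_generation_iff:
  "i # u \<in> generation x (Suc n) \<longleftrightarrow> i < fst (x []) \<and> u \<in> generation (\<lambda>v. x (i # v)) n"
proof (induction n arbitrary: u)
  case 0
  show ?case by auto
next
  case (Suc n)
  show ?case
  proof (cases u rule: rev_cases)
    case Nil
    then show ?thesis using length_generation[of "[i]" x "Suc (Suc n)"] by auto
  next
    case (snoc v j)
    have "i # u \<in> generation x (Suc (Suc n)) \<longleftrightarrow> i # v \<in> generation x (Suc n) \<and> j < fst (x (i # v))"
      using snoc by (subst generation.simps(2)) auto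
    also have "\<dots> \<longleftrightarrow> i < fst (x []) \<and> u \<in> generation (\<lambda>v. x (i # v)) (Suc n)"
      unfolding Suc using snoc by auto
    finally show ?thesis .
  qed
qed

lemma generation_Suc_eq:
  "generation x (Suc n) = (\<Union>i<fst (x []). (#) i ` generation (\<lambda>v. x (i # v)) n)"
proof (intro set_eqI)
  fix u
  show "u \<in> generation x (Suc n) \<longleftrightarrow> u \<in> (\<Union>i<fst (x []). (#) i ` generation (\<lambda>v. x (i # v)) n)"
  proof (cases u)
    case Nil
    then show ?thesis using length_generation[of u x "Suc n"] by auto
  next
    case (Cons i v)
    then show ?thesis using Cons_generation_iff[of i v x n] by (auto simp del: generation.simps)
  qed
qed

lemma sum_generation_Suc:
  "(\<Sum>u\<in>generation x (Suc n). f u :: 'a :: comm_monoid_add) =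
    (\<Sum>i<fst (x []). \<Sum>v\<in>generation (\<lambda>v. x (i # v)) n. f (i # v))"
  unfolding generation_Suc_eq
  by (subst sum.UNION_disjoint) (auto simp: sum.reindex simp del: generation.simps)

lemma prod_generation_Suc:
  "(\<Prod>u\<in>generation x (Suc n). f u :: 'a :: comm_monoid_mult) =
    (\<Prod>i<fst (x []). \<Prod>v\<in>generation (\<lambda>v. x (i # v)) n. f (i # v))"
  unfolding generation_Suc_eq
  by (subst prod.UNION_disjoint) (auto simp: prod.reindex simp del: generation.simps)

lemma position_Cons: "position x (i # u) = snd (x []) i + position (\<lambda>v. x (i # v)) u"
  by (simp add: position_def sum.lessThan_Suc_shift del: sum.lessThan_Suc)

lemma generation_append:
  "u \<in> generation x m \<Longrightarrow> v \<in> generation (\<lambda>w. x (u @ w)) n \<Longrightarrow> u @ v \<in> generation x (m + n)"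
proof (induction n arbitrary: v)
  case (Suc n)
  then obtain v' i where "v = v' @ [i]" "v' \<in> generation (\<lambda>w. x (u @ w)) n" "i < fst (x (u @ v'))"
    by auto
  then show ?case using Suc by auto
qed simp

lemma position_append: "position x (u @ v) = position x u + position (\<lambda>w. x (u @ w)) v"
  by (induction v rule: rev_induct) (simp_all add: position_Nil append.assoc[symmetric] position_snoc del: append_assoc)

abbreviation final_weight :: "nat \<Rightarrow> (real \<Rightarrow> ennreal) \<Rightarrow> nat \<Rightarrow> real \<Rightarrow> ennreal" where
  "final_weight n f \<equiv> \<lambda>j. if j = n then f else (\<lambda>_. 1)"

text \<open>The bridge between path sums and generations: measurability and moment bounds for sums
  over a generation are read off from \<open>path_sum\<close>.\<close>

lemma path_sum_final_weight:
  "path_sum (\<lambda>k. k) n (final_weight n f) x s = (\<Sum>u\<in>generation x n. f (s + position x u))"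
proof (induction n arbitrary: x s)
  case 0
  show ?case by (simp add: position_Nil)
next
  case (Suc n)
  have "path_sum (\<lambda>k. k) (Suc n) (final_weight (Suc n) f) x s =
      (\<Sum>i<fst (x []). path_sum (\<lambda>k. k) n (final_weight n f) (\<lambda>u. x (i # u)) (s + snd (x []) i))"
    by simp
  also have "\<dots> = (\<Sum>u\<in>generation x (Suc n). f (s + position x u))"
    unfolding Suc sum_generation_Suc by (simp add: position_Cons add.assoc)
  finally show ?case .
qed

lemma path_sum_mono:
  assumes "\<And>k. K k \<le> K' k" "\<And>j y. g j y \<le> g' j y"
  shows "path_sum K n g x s \<le> path_sum K' n g' x s"
  using assms(2)
proof (induction n arbitrary: g g' x s)
  case (Suc n)
  have "(\<Sum>i<K (fst (x [])). path_sum K n (\<lambda>j. g (Suc j)) (\<lambda>u. x (i # u)) (s + snd (x []) i)) \<le>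
      (\<Sum>i<K (fst (x [])). path_sum K' n (\<lambda>j. g' (Suc j)) (\<lambda>u. x (i # u)) (s + snd (x []) i))"
    by (intro sum_mono Suc.IH Suc.prems)
  also have "\<dots> \<le> (\<Sum>i<K' (fst (x [])). path_sum K' n (\<lambda>j. g' (Suc j)) (\<lambda>u. x (i # u)) (s + snd (x []) i))"
    using assms(1) by (intro sum_mono2) auto
  finally show ?case by (simp add: mult_mono Suc.prems)
qed simp

text \<open>All tube constraints but the last are dropped and the discarded children are restored;
  both only increase the count.\<close>

lemma tube_count_le_card:
  assumes "\<And>k. K k \<le> k"
  shows "path_sum K n (\<lambda>j. indicator (tube v w j)) x 0 \<le>
    of_nat (card {u \<in> generation x n. position x u \<in> tube v w n})"
proof -
  have "path_sum K n (\<lambda>j. indicator (tube v w j)) x 0 \<le>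
      path_sum (\<lambda>k. k) n (final_weight n (indicator (tube v w n))) x 0"
    by (intro path_sum_mono assms) (auto split: split_indicator)
  also have "\<dots> = of_nat (card {u \<in> generation x n. position x u \<in> tube v w n})"
    by (simp add: path_sum_final_weight indicator_def sum.If_cases Int_def)
  finally show ?thesis .
qed

section \<open>Exponential growth of the population through its harmonic mean\<close>

lemma path_sum_one: "path_sum (\<lambda>k. k) n (\<lambda>_ _. 1) x s = of_nat (card (generation x n))"
proof -
  have "(\<lambda>_ _. 1) = final_weight n (\<lambda>_. 1)" by auto
  then show ?thesis using path_sum_final_weight[of n "\<lambda>_. 1" x s] by simp
qed

lemma card_generation_Suc:
  "card (generation x (Suc n)) = (\<Sum>i<fst (x []). card (generation (\<lambda>v. x (i # v)) n))"
  using sum_generation_Suc[of "\<lambda>_. 1 :: nat"] by simp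

lemma measurable_card_generation:
  "(\<lambda>x. of_nat (card (generation x n)) :: ennreal) \<in> borel_measurable tree_space"
  using measurable_path_sum_tree[of "\<lambda>_ _. 1" "\<lambda>k. k" n 0] by (simp add: path_sum_one)

lemma inverse_of_nat_ennreal: "0 < n \<Longrightarrow> inverse (of_nat n :: ennreal) = ennreal (1 / real n)"
  by (simp add: ennreal_of_nat_eq_real_of_nat inverse_ennreal inverse_eq_divide)

text \<open>Cauchy-Schwarz gives that k squared is at most the sum of the \<open>c i\<close> times
  the sum of their reciprocals. If some \<open>c i\<close> is 0, its inverse is \<infinity> in
  \<open>ennreal\<close> and the right-hand side is infinite.\<close>

lemma inverse_sum_le:
  fixes c :: "nat \<Rightarrow> nat"
  assumes "0 < k"
  shows "inverse (of_nat (\<Sum>i<k. c i)) \<le>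
    inverse (of_nat k) * inverse (of_nat k) * (\<Sum>i<k. inverse (of_nat (c i)) :: ennreal)"
proof (cases "\<exists>i<k. c i = 0")
  case True
  then obtain i where i: "i < k" "c i = 0" by blast
  have "(\<Sum>i<k. inverse (of_nat (c i)) :: ennreal) \<ge> inverse (of_nat (c i))"
    using i by (intro member_le_sum) auto
  then have top: "(\<Sum>i<k. inverse (of_nat (c i)) :: ennreal) = top"
    using i by (simp add: top_unique)
  have "inverse (of_nat k) * inverse (of_nat k) \<noteq> (0 :: ennreal)"
    by simp
  then show ?thesis unfolding top by (simp add: ennreal_mult_top)
next
  case False
  then have c: "0 < c i" if "i < k" for i using that by auto
  note inv = inverse_of_nat_ennreal
  have pos: "0 < (\<Sum>i<k. c i)" using c assms by (intro sum_pos) auto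
  have "(\<Sum>i<k. sqrt (c i) * sqrt (1 / c i)) = (\<Sum>i<k. 1)"
    by (intro sum.cong refl) (auto simp: real_sqrt_mult[symmetric] dest: c)
  then have "(real k)\<^sup>2 = (\<Sum>i<k. sqrt (c i) * sqrt (1 / c i))\<^sup>2"
    by simp
  also have "\<dots> \<le> (\<Sum>i<k. (sqrt (c i))\<^sup>2) * (\<Sum>i<k. (sqrt (1 / c i))\<^sup>2)"
    by (rule Cauchy_Schwarz_ineq_sum)
  also have "\<dots> = real (\<Sum>i<k. c i) * (\<Sum>i<k. 1 / real (c i))"
    by simp
  finally have "(real k)\<^sup>2 \<le> real (\<Sum>i<k. c i) * (\<Sum>i<k. 1 / real (c i))" .
  then have "1 / real (\<Sum>i<k. c i) \<le> 1 / k * (1 / k) * (\<Sum>i<k. 1 / real (c i))"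
  proof -
    have "1 / S \<le> 1 / q * (1 / q) * T" if "q\<^sup>2 \<le> S * T" "0 < S" "0 < q" for q S T :: real
      using that by (simp add: field_simps power2_eq_square)
    moreover have "0 < real (\<Sum>i<k. c i)" using pos by (simp only: of_nat_0_less_iff)
    ultimately show ?thesis using \<open>(real k)\<^sup>2 \<le> _\<close> assms by (simp only: of_nat_0_less_iff)
  qed
  moreover have "(\<Sum>i<k. inverse (of_nat (c i)) :: ennreal) = ennreal (\<Sum>i<k. 1 / real (c i))"
    using c by (simp add: inv sum_ennreal)
  ultimately show ?thesis
    using assms by (simp only: inv[OF pos] inv[OF assms]) (auto simp: ennreal_mult'[symmetric] intro: ennreal_leI)
qed

text \<open>By \<open>inverse_sum_le\<close> the reciprocal of the population is at most
  \<open>1 / N\<close> times the average of the reciprocals of the N subtrees, and averaging over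
  subtrees preserves their common bound. Negative moments require no moment of N from above.\<close>

lemma mean_inverse_card_generation_le:
  assumes "env_seq \<nu>" "\<And>k. AE m in \<nu> k. 1 \<le> fst m"
  shows "(\<integral>\<^sup>+x. inverse (of_nat (card (generation x n))) \<partial>tree_law \<nu>) \<le>
    (\<Prod>k<n. \<integral>\<^sup>+m. inverse (of_nat (fst m)) \<partial>\<nu> k)"
  using assms
proof (induction n arbitrary: \<nu>)
  case 0
  then interpret env_seq \<nu> by simp
  interpret T: prob_space "tree_law \<nu>" by (rule prob_space_tree_law)
  show ?case by (simp add: T.emeasure_space_1[simplified])
next
  case (Suc n)
  interpret env_seq \<nu> by (rule Suc.prems)
  let ?P = "\<Pi>\<^sub>M i\<in>(UNIV::nat set). tree_law tail_env"
  interpret S: env_seq tail_env by (rule env_seq_Suc) unfold_locales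
  have sets_P: "sets ?P = sets (\<Pi>\<^sub>M i\<in>UNIV. tree_space)"
    by (intro sets_PiM_cong) auto
  let ?c = "\<lambda>n x. inverse (of_nat (card (generation x n))) :: ennreal"
  let ?H = "\<Prod>k<n. \<integral>\<^sup>+m. inverse (of_nat (fst m)) \<partial>\<nu> (Suc k)"
  have m1: "?c n \<in> borel_measurable tree_space" for n
    by (rule measurable_compose[OF measurable_card_generation borel_measurable_inverse_ennreal]) simp
  have comp: "(\<lambda>y. y i) \<in> ?P \<rightarrow>\<^sub>M tree_space" for i
    unfolding measurable_cong_sets[OF sets_P refl] by (rule measurable_component_singleton) simp
  have m2: "(\<lambda>y. ?c n (y i)) \<in> borel_measurable ?P" for i
    by (rule measurable_compose[OF comp m1])
  have m3: "(\<lambda>m. inverse (of_nat (fst m))) \<in> borel_measurable (\<nu> 0)"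
    unfolding measurable_cong_sets[OF sets_env refl]
    by (rule measurable_compose[OF measurable_fst_mark]) simp
  have "(\<integral>\<^sup>+x. ?c (Suc n) x \<partial>tree_law \<nu>) =
      (\<integral>\<^sup>+m. (\<integral>\<^sup>+y. inverse (of_nat (\<Sum>i<fst m. card (generation (y i) n))) \<partial>?P) \<partial>\<nu> 0)"
    by (subst nn_integral_tree_law[OF m1]) (simp add: card_generation_Suc del: generation.simps)
  also have "\<dots> \<le> (\<integral>\<^sup>+m. inverse (of_nat (fst m)) * ?H \<partial>\<nu> 0)"
    using Suc.prems(2)[of 0]
  proof (intro nn_integral_mono_AE, elim eventually_mono)
    fix m :: mark assume "1 \<le> fst m"
    then have k: "0 < fst m" by simp
    let ?i = "inverse (of_nat (fst m)) :: ennreal"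
    have "(\<integral>\<^sup>+y. inverse (of_nat (\<Sum>i<fst m. card (generation (y i) n))) \<partial>?P) \<le>
        (\<integral>\<^sup>+y. ?i * ?i * (\<Sum>i<fst m. ?c n (y i)) \<partial>?P)"
      by (intro nn_integral_mono inverse_sum_le k)
    also have "\<dots> = ?i * ?i * (\<Sum>i<fst m. \<integral>\<^sup>+y. ?c n (y i) \<partial>?P)"
      by (simp only: nn_integral_cmult[OF borel_measurable_sum[OF m2]] nn_integral_sum[OF m2])
    also have "\<dots> \<le> ?i * ?i * (\<Sum>i<fst m. ?H)"
    proof (intro mult_left_mono sum_mono)
      fix i
      show "(\<integral>\<^sup>+y. ?c n (y i) \<partial>?P) \<le> ?H"
        unfolding nn_integral_subtree[OF m1] by (rule Suc.IH) (use Suc.prems env_seq_Suc in auto)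
    qed simp
    also have "\<dots> = ?i * (?i * of_nat (fst m)) * ?H"
      by (simp add: mult.assoc)
    also have "?i * of_nat (fst m) = 1"
      using k by (simp add: ennreal_of_nat_eq_real_of_nat inverse_ennreal ennreal_mult'[symmetric])
    finally show "(\<integral>\<^sup>+y. inverse (of_nat (\<Sum>i<fst m. card (generation (y i) n))) \<partial>?P) \<le> ?i * ?H"
      by simp
  qed
  also have "\<dots> = (\<Prod>k<Suc n. \<integral>\<^sup>+m. inverse (of_nat (fst m)) \<partial>\<nu> k)"
    by (simp only: nn_integral_multc[OF m3] prod.lessThan_Suc_shift comp_def)
  finally show ?case .
qed

text \<open>The reciprocal of N is at most 1, and at most 1/2 where N is at least 2. The logarithm
  of the resulting bound lies between \<open>- ln 2\<close> and 0, so Birkhoff's theorem applies to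
  it.\<close>

lemma mean_inverse_offspring_le:
  fixes \<mu> :: "mark measure"
  assumes "prob_space \<mu>" and sets: "sets \<mu> = sets mark_space" and AE: "AE m in \<mu>. 1 \<le> fst m"
  shows "(\<integral>\<^sup>+m. inverse (of_nat (fst m)) \<partial>\<mu>) \<le> ennreal (1 - measure \<mu> {m. 2 \<le> fst m} / 2)"
proof -
  interpret prob_space \<mu> by fact
  have "{m \<in> space mark_space. 2 \<le> fst m} \<in> sets mark_space" by measurable
  then have A: "{m. 2 \<le> fst m} \<in> sets \<mu>" using sets by simp
  have int: "integrable \<mu> (\<lambda>m. 1 - indicator {m. 2 \<le> fst m} m / 2 :: real)"
    using A by (intro Bochner_Integration.integrable_diff integrable_const integrable_divide
        integrable_real_indicator) (auto simp: less_top[symmetric])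
  have "(\<integral>\<^sup>+m. inverse (of_nat (fst m)) \<partial>\<mu>) \<le> (\<integral>\<^sup>+m. ennreal (1 - indicator {m. 2 \<le> fst m} m / 2) \<partial>\<mu>)"
    using AE
  proof (intro nn_integral_mono_AE, elim eventually_mono)
    fix m :: mark assume m: "1 \<le> fst m"
    have "1 / real (fst m) \<le> 1 - indicator {m. 2 \<le> fst m} m / 2"
      using m by (auto simp: indicator_def divide_simps)
    then show "inverse (of_nat (fst m)) \<le> ennreal (1 - indicator {m. 2 \<le> fst m} m / 2)"
      using m by (simp add: ennreal_of_nat_eq_real_of_nat inverse_ennreal inverse_eq_divide ennreal_leI)
  qed
  also have "\<dots> = ennreal (\<integral>m. 1 - indicator {m. 2 \<le> fst m} m / 2 \<partial>\<mu>)"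
    by (intro nn_integral_eq_integral int) (auto simp: indicator_def)
  also have "(\<integral>m. 1 - indicator {m. 2 \<le> fst m} m / 2 \<partial>\<mu>) = 1 - measure \<mu> {m. 2 \<le> fst m} / 2"
    using A by (subst Bochner_Integration.integral_diff) (auto simp: prob_space less_top[symmetric])
  finally show ?thesis .
qed

section \<open>Products over a generation and independent trials\<close>

primrec path_prod :: "nat \<Rightarrow> ((nat list \<Rightarrow> mark) \<Rightarrow> real \<Rightarrow> ennreal) \<Rightarrow> (nat list \<Rightarrow> mark) \<Rightarrow> real \<Rightarrow> ennreal" where
  "path_prod 0 H x s = H x s"
| "path_prod (Suc n) H x s = (\<Prod>i<fst (x []). path_prod n H (\<lambda>u. x (i # u)) (s + snd (x []) i))"

text \<open>The recursion of \<open>path_prod\<close> is the form in which means factorize; this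
  closed form is the one in which failed trials are counted. The position is an argument of
  \<open>H\<close> because only subtrees with a root near the origin count as trials.\<close>

lemma path_prod_eq:
  "path_prod n H x s = (\<Prod>u\<in>generation x n. H (\<lambda>v. x (u @ v)) (s + position x u))"
proof (induction n arbitrary: x s)
  case 0
  show ?case by (simp add: position_Nil)
next
  case (Suc n)
  show ?case
    unfolding prod_generation_Suc by (simp add: Suc position_Cons add.assoc)
qed

lemma measurable_path_prod:
  assumes H: "(\<lambda>(x, s). H x s) \<in> borel_measurable (tree_space \<Otimes>\<^sub>M borel)"
  shows "(\<lambda>(x, s). path_prod n H x s) \<in> borel_measurable (tree_space \<Otimes>\<^sub>M borel)"
proof (induction n)
  case 0
  show ?case using H by simp
next
  case (Suc n)
  have root: "(\<lambda>p. fst p []) \<in> tree_space \<Otimes>\<^sub>M (borel :: real measure) \<rightarrow>\<^sub>M mark_space"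
    by measurable
  have "(\<lambda>p. \<Prod>i<fst (fst p []). path_prod n H (\<lambda>u. fst p (i # u)) (snd p + snd (fst p []) i))
      \<in> borel_measurable (tree_space \<Otimes>\<^sub>M borel)"
  proof (rule measurable_compose_countable[where g="\<lambda>p. fst (fst p [])"])
    show "(\<lambda>p. fst (fst p [])) \<in> tree_space \<Otimes>\<^sub>M (borel :: real measure) \<rightarrow>\<^sub>M count_space UNIV"
      by (rule measurable_compose[OF root]) measurable
    fix k
    show "(\<lambda>p. \<Prod>i<k. path_prod n H (\<lambda>u. fst p (i # u)) (snd p + snd (fst p []) i))
      \<in> borel_measurable (tree_space \<Otimes>\<^sub>M borel)"
    proof (rule borel_measurable_prod_ennreal)
      fix i
      have s: "(\<lambda>p. snd p + snd (fst p []) i) \<in> borel_measurable (tree_space \<Otimes>\<^sub>M borel)"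
        using measurable_compose[OF root measurable_snd_mark[of i]] by (intro borel_measurable_add) auto
      have x: "(\<lambda>p u. fst p (i # u)) \<in> tree_space \<Otimes>\<^sub>M (borel :: real measure) \<rightarrow>\<^sub>M tree_space"
        by (rule measurable_compose[OF measurable_fst measurable_subtree])
      show "(\<lambda>p. path_prod n H (\<lambda>u. fst p (i # u)) (snd p + snd (fst p []) i))
        \<in> borel_measurable (tree_space \<Otimes>\<^sub>M borel)"
        using measurable_compose[OF measurable_Pair[OF x s] Suc] by simp
    qed
  qed
  then show ?case by (simp add: case_prod_beta)
qed

lemma measurable_path_prod_tree:
  assumes H: "(\<lambda>(x, s). H x s) \<in> borel_measurable (tree_space \<Otimes>\<^sub>M borel)"
  shows "(\<lambda>x. path_prod n H x s) \<in> borel_measurable tree_space"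
  using measurable_compose[OF measurable_Pair[OF measurable_ident_sets[OF refl] measurable_const] measurable_path_prod[OF H], of s]
  by simp

text \<open>The number of factors is random, but given the root the subtrees are independent, and a
  product of means that are at most 1 stays at most 1 whatever its length.\<close>

lemma mean_path_prod_le_1:
  assumes "env_seq \<nu>" and H: "(\<lambda>(x, s). H x s) \<in> borel_measurable (tree_space \<Otimes>\<^sub>M borel)"
    and le: "\<And>s. (\<integral>\<^sup>+x. H x s \<partial>tree_law (\<lambda>k. \<nu> (k + n))) \<le> 1"
  shows "(\<integral>\<^sup>+x. path_prod n H x s \<partial>tree_law \<nu>) \<le> 1"
  using assms(1,3)
proof (induction n arbitrary: \<nu> s)
  case 0
  then show ?case by simp
next
  case (Suc n)
  interpret env_seq \<nu> by (rule Suc.prems)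
  interpret N: prob_space "\<nu> 0" by (rule prob_space_env)
  let ?P = "\<Pi>\<^sub>M i\<in>(UNIV::nat set). tree_law tail_env"
  have m: "(\<lambda>x. path_prod n H x s) \<in> borel_measurable tree_space" for n s
    by (rule measurable_path_prod_tree[OF H])
  have IH: "(\<integral>\<^sup>+x. path_prod n H x s \<partial>tree_law tail_env) \<le> 1" for s
    by (rule Suc.IH) (use Suc.prems env_seq_Suc in auto)
  have "(\<integral>\<^sup>+x. path_prod (Suc n) H x s \<partial>tree_law \<nu>) =
      (\<integral>\<^sup>+m. (\<integral>\<^sup>+y. (\<Prod>i<fst m. path_prod n H (y i) (s + snd m i)) \<partial>?P) \<partial>\<nu> 0)"
    by (subst nn_integral_tree_law[OF m]) simp
  also have "\<dots> = (\<integral>\<^sup>+m. (\<Prod>i<fst m. \<integral>\<^sup>+x. path_prod n H x (s + snd m i) \<partial>tree_law tail_env) \<partial>\<nu> 0)"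
    by (intro nn_integral_cong nn_integral_prod_subtrees m) simp
  also have "\<dots> \<le> (\<integral>\<^sup>+m. 1 \<partial>\<nu> 0)"
    by (intro nn_integral_mono prod_le_1) (use IH in auto)
  also have "\<dots> = 1" using N.emeasure_space_1 by simp
  finally show ?case .
qed

text \<open>The subtrees rooted at generation \<open>m\<close> are independent, so many of them give many
  independent trials.\<close>

lemma all_subtrees_fail_prob:
  assumes env: "env_seq \<nu>" and G: "G \<in> sets tree_space"
    and p: "p \<le> measure (tree_law (\<lambda>k. \<nu> (k + m))) G" "0 < p" "p < 1"
  obtains B where "B \<in> sets tree_space" "emeasure (tree_law \<nu>) B \<le> ennreal ((1 - p) ^ M)"
    "\<And>x. M \<le> card {u \<in> generation x m. \<bar>position x u\<bar> \<le> R} \<Longrightarrow>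
      \<forall>u\<in>generation x m. \<bar>position x u\<bar> \<le> R \<longrightarrow> (\<lambda>v. x (u @ v)) \<notin> G \<Longrightarrow> x \<in> B"
proof -
  interpret env_seq \<nu> by (rule env)
  interpret S: env_seq "\<lambda>k. \<nu> (k + m)" by (rule env_seq_shift[OF env])
  interpret T: prob_space "tree_law \<nu>" by (rule prob_space_tree_law)
  interpret TS: prob_space "tree_law (\<lambda>k. \<nu> (k + m))" by (rule S.prob_space_tree_law)
  define \<theta> where "\<theta> = 1 - p"
  have \<theta>: "0 < \<theta>" "\<theta> < 1" using p by (auto simp: \<theta>_def)
  \<comment> \<open>A failed trial contributes \<open>1 / \<theta>\<close> and a successful one 0.
    As the failure probability is at most \<open>\<theta>\<close>, each factor has mean at most 1,
    while failure of \<open>M\<close> trials forces the product up to at least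
    \<open>\<theta> ^ (- M)\<close>; Markov's inequality then gives
    \<open>\<theta> ^ M\<close>.\<close>
  define H where "H x s = (if \<bar>s\<bar> \<le> R then if x \<in> G then 0 else ennreal (1 / \<theta>) else 1)" for x and s :: real
  have H: "(\<lambda>(x, s). H x s) \<in> borel_measurable (tree_space \<Otimes>\<^sub>M borel)"
    unfolding H_def case_prod_beta using G by measurable
  have "(\<integral>\<^sup>+x. H x s \<partial>tree_law (\<lambda>k. \<nu> (k + m))) \<le> 1" for s
  proof (cases "\<bar>s\<bar> \<le> R")
    case True
    have G': "G \<in> TS.events" "- G \<in> TS.events" using G sets.compl_sets[of G tree_space] by (auto simp: Compl_eq_Diff_UNIV)
    have "(\<integral>\<^sup>+x. H x s \<partial>tree_law (\<lambda>k. \<nu> (k + m))) =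
        (\<integral>\<^sup>+x. ennreal (1 / \<theta>) * indicator (- G) x \<partial>tree_law (\<lambda>k. \<nu> (k + m)))"
      using True by (intro nn_integral_cong) (auto simp: H_def)
    also have "\<dots> = ennreal (1 / \<theta>) * emeasure (tree_law (\<lambda>k. \<nu> (k + m))) (- G)"
      using G' by (simp add: nn_integral_cmult_indicator)
    also have "\<dots> = ennreal (1 / \<theta> * TS.prob (- G))"
      unfolding TS.emeasure_eq_measure using \<theta> by (intro ennreal_mult'[symmetric]) simp
    also have "TS.prob (- G) = 1 - TS.prob G"
      using TS.prob_compl[OF G'(1)] by (simp add: Compl_eq_Diff_UNIV)
    also have "ennreal (1 / \<theta> * (1 - TS.prob G)) \<le> ennreal 1"
      using p \<theta> by (intro ennreal_leI) (simp add: \<theta>_def divide_simps)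
    finally show ?thesis by simp
  next
    case False
    then show ?thesis using TS.emeasure_space_1 by (simp add: H_def)
  qed
  then have mean: "(\<integral>\<^sup>+x. path_prod m H x 0 \<partial>tree_law \<nu>) \<le> 1"
    by (rule mean_path_prod_le_1[OF env H])
  have mp0: "(\<lambda>x. path_prod m H x 0) \<in> borel_measurable tree_space"
    by (rule measurable_path_prod_tree[OF H])
  then have mp: "(\<lambda>x. path_prod m H x 0) \<in> borel_measurable (tree_law \<nu>)"
    unfolding measurable_cong_sets[OF sets_tree_law refl] .
  \<comment> \<open>A measurable set that contains the event that all trials fail; the event itself
    is never measured.\<close>
  let ?B = "{x \<in> space tree_space. 1 \<le> ennreal (\<theta> ^ M) * path_prod m H x 0}"
  have mB: "?B \<in> sets tree_space"
    using mp0 by measurable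
  have sub: "x \<in> ?B"
    if M: "M \<le> card {u \<in> generation x m. \<bar>position x u\<bar> \<le> R}"
      and fail: "\<forall>u\<in>generation x m. \<bar>position x u\<bar> \<le> R \<longrightarrow> (\<lambda>v. x (u @ v)) \<notin> G" for x
  proof -
    let ?n = "card {u \<in> generation x m. \<bar>position x u\<bar> \<le> R}"
    have "path_prod m H x 0 = (\<Prod>u\<in>generation x m. if \<bar>position x u\<bar> \<le> R then ennreal (1 / \<theta>) else 1)"
      unfolding path_prod_eq using fail by (intro prod.cong) (auto simp: H_def)
    also have "\<dots> = ennreal (1 / \<theta>) ^ ?n"
      by (simp add: prod.If_cases Int_def)
    also have "\<dots> = ennreal ((1 / \<theta>) ^ ?n)" using \<theta> by (simp add: ennreal_power)
    finally have eq: "path_prod m H x 0 = ennreal ((1 / \<theta>) ^ ?n)" .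
    have "(1 / \<theta>) ^ M \<le> (1 / \<theta>) ^ ?n" using M \<theta> by (intro power_increasing) auto
    then have "\<theta> ^ M * (1 / \<theta>) ^ M \<le> \<theta> ^ M * (1 / \<theta>) ^ ?n" using \<theta> by (intro mult_left_mono) auto
    then have "1 \<le> \<theta> ^ M * (1 / \<theta>) ^ ?n" using \<theta> by (simp add: power_mult_distrib[symmetric])
    then show ?thesis
      using \<theta> by (simp add: eq ennreal_mult'[symmetric] ennreal_1[symmetric] del: ennreal_1)
  qed
  have "emeasure (tree_law \<nu>) ?B \<le>
      ennreal (\<theta> ^ M) * (\<integral>\<^sup>+x. path_prod m H x 0 * indicator (space (tree_law \<nu>)) x \<partial>tree_law \<nu>)"
    using nn_integral_Markov_inequality[of "\<lambda>x. path_prod m H x 0" "space (tree_law \<nu>)" "tree_law \<nu>" "ennreal (\<theta> ^ M)"]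
      sets.top[of "tree_law \<nu>"] mp by simp
  also have "\<dots> \<le> ennreal (\<theta> ^ M) * 1"
    using mean by (intro mult_left_mono) auto
  finally have "emeasure (tree_law \<nu>) ?B \<le> ennreal ((1 - p) ^ M)" by (simp add: \<theta>_def)
  then show ?thesis by (rule that[OF mB _ sub])
qed

section \<open>Quenched almost sure bounds\<close>

text \<open>Borel-Cantelli with geometric bounds. Nothing is known about \<open>B n\<close> before
  \<open>start\<close>, so those sets are replaced by the empty set.\<close>

lemma (in prob_space) AE_eventually_notin:
  assumes B: "\<And>n. start \<le> n \<Longrightarrow> B n \<in> events"
    and le: "\<And>n. start \<le> n \<Longrightarrow> emeasure M (B n) \<le> ennreal (exp (C - \<gamma> * real n))" and \<gamma>: "0 < \<gamma>"
  shows "AE x in M. \<forall>\<^sub>F n in sequentially. x \<notin> B n"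
proof -
  define A where "A n = (if start \<le> n then B n else {})" for n
  have "AE x in M. \<forall>\<^sub>F n in sequentially. x \<in> space M - A n"
  proof (rule borel_cantelli_AE1)
    show "A n \<in> events" for n using B by (auto simp: A_def)
    show "emeasure M (A n) < \<infinity>" for n by (simp add: emeasure_eq_measure)
    have sum: "summable (\<lambda>n. exp C * exp (- \<gamma>) ^ n)"
      using \<gamma> by (intro summable_mult summable_geometric) simp
    have le: "prob (A n) \<le> exp C * exp (- \<gamma>) ^ n" for n
    proof (cases "start \<le> n")
      case True
      have "prob (B n) \<le> exp (C - \<gamma> * real n)"
        using le[OF True] by (simp add: emeasure_eq_measure)
      also have "\<dots> = exp C * exp (- \<gamma>) ^ n"
        by (simp add: exp_diff exp_of_nat_mult[symmetric] exp_minus field_simps)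
      finally show ?thesis using True by (simp add: A_def)
    qed (simp add: A_def)
    show "summable (\<lambda>n. prob (A n))"
      by (rule summable_comparison_test'[OF sum, of 0]) (simp add: le)
  qed
  then show ?thesis
  proof eventually_elim
    case (elim x)
    show ?case using elim eventually_ge_at_top[of start] by eventually_elim (auto simp: A_def)
  qed
qed

lemma (in prob_space) AE_eventually_less_1:
  assumes f: "\<And>n. f n \<in> borel_measurable M"
    and le: "\<And>n. (\<integral>\<^sup>+x. f n x \<partial>M) \<le> ennreal (exp (C - \<gamma> * real n))" and \<gamma>: "0 < \<gamma>"
  shows "AE x in M. \<forall>\<^sub>F n in sequentially. f n x < 1"
proof -
  have "AE x in M. \<forall>\<^sub>F n in sequentially. x \<notin> {x \<in> space M. 1 \<le> f n x}"
  proof (rule AE_eventually_notin[where start=0 and \<gamma>=\<gamma>])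
    fix n
    note [measurable] = f[of n]
    show "{x \<in> space M. 1 \<le> f n x} \<in> events" by measurable
    have "emeasure M {x \<in> space M. 1 \<le> 1 * f n x} \<le> 1 * (\<integral>\<^sup>+x. f n x * indicator (space M) x \<partial>M)"
      by (rule nn_integral_Markov_inequality) auto
    also have "\<dots> \<le> (\<integral>\<^sup>+x. f n x \<partial>M)"
      by (auto intro!: nn_integral_mono split: split_indicator)
    also note le
    finally show "emeasure M {x \<in> space M. 1 \<le> f n x} \<le> ennreal (exp (C - \<gamma> * real n))" by simp
  qed (rule \<gamma>)
  with AE_space show ?thesis
  proof eventually_elim
    case (elim x)
    show ?case using elim(2) by eventually_elim (use elim(1) in auto)
  qed
qed

section \<open>Population size and exponential sums in a fixed environment\<close>

context env_seq
begin

lemma card_generation_growth_AE: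
  fixes \<gamma> C :: real
  assumes N: "\<And>k. AE m in \<nu> k. 1 \<le> fst m" and \<gamma>: "0 < \<gamma>"
    and sum: "\<And>n. (\<Sum>k<n. ln (1 - measure (\<nu> k) {m. 2 \<le> fst m} / 2)) \<le> C - 2 * \<gamma> * real n"
  shows "AE x in tree_law \<nu>. \<forall>\<^sub>F n in sequentially. exp (\<gamma> * n) \<le> card (generation x n)"
proof -
  interpret T: prob_space "tree_law \<nu>" by (rule prob_space_tree_law)
  let ?c = "\<lambda>n x. inverse (of_nat (card (generation x n))) :: ennreal"
  have mc: "?c n \<in> borel_measurable (tree_law \<nu>)" for n
    unfolding measurable_cong_sets[OF sets_tree_law refl]
    by (rule measurable_compose[OF measurable_card_generation borel_measurable_inverse_ennreal]) simp
  have "AE x in tree_law \<nu>. \<forall>\<^sub>F n in sequentially. ennreal (exp (\<gamma> * n)) * ?c n x < 1"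
  proof (rule T.AE_eventually_less_1[where \<gamma>=\<gamma>])
    fix n
    show "(\<lambda>x. ennreal (exp (\<gamma> * n)) * ?c n x) \<in> borel_measurable (tree_law \<nu>)"
      by (intro borel_measurable_times_ennreal mc) simp
    have "(\<integral>\<^sup>+x. ?c n x \<partial>tree_law \<nu>) \<le> (\<Prod>k<n. \<integral>\<^sup>+m. inverse (of_nat (fst m)) \<partial>\<nu> k)"
      by (rule mean_inverse_card_generation_le) (use N in \<open>auto intro: env_seq_axioms\<close>)
    also have "\<dots> \<le> ennreal (exp (\<Sum>k<n. ln (1 - measure (\<nu> k) {m. 2 \<le> fst m} / 2)))"
    proof (rule prod_le_ennreal_exp)
      fix k
      interpret K: prob_space "\<nu> k" by (rule prob_space_env)
      have "0 < 1 - measure (\<nu> k) {m. 2 \<le> fst m} / 2"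
        using K.prob_le_1[of "{m. 2 \<le> fst m}"] by linarith
      then show "(\<integral>\<^sup>+m. inverse (of_nat (fst m)) \<partial>\<nu> k) \<le> ennreal (exp (ln (1 - measure (\<nu> k) {m. 2 \<le> fst m} / 2)))"
        using mean_inverse_offspring_le[OF prob_space_env sets_env N, of k] by simp
    qed
    also have "\<dots> \<le> ennreal (exp (C - 2 * \<gamma> * real n))"
      using sum[of n] by (intro ennreal_leI) simp
    finally have "ennreal (exp (\<gamma> * n)) * (\<integral>\<^sup>+x. ?c n x \<partial>tree_law \<nu>) \<le>
        ennreal (exp (\<gamma> * n)) * ennreal (exp (C - 2 * \<gamma> * real n))"
      by (rule mult_left_mono) simp
    then show "(\<integral>\<^sup>+x. ennreal (exp (\<gamma> * n)) * ?c n x \<partial>tree_law \<nu>) \<le> ennreal (exp (C - \<gamma> * real n))"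
      by (simp add: nn_integral_cmult[OF mc] ennreal_mult'[symmetric] exp_add[symmetric] algebra_simps)
  qed (rule \<gamma>)
  then show ?thesis
  proof eventually_elim
    case (elim x)
    show ?case using elim
    proof eventually_elim
      case (elim n)
      let ?N = "card (generation x n)"
      \<comment> \<open>An empty generation would make the inverse infinite and so violate the
        bound.\<close>
      have "?N \<noteq> 0"
        using elim by (auto simp: ennreal_mult_top split: if_splits)
      then have "?c n x = ennreal (1 / real ?N)"
        by (simp only: inverse_of_nat_ennreal neq0_conv)
      then have "ennreal (exp (\<gamma> * n) * (1 / real ?N)) < ennreal 1"
        using elim by (simp add: ennreal_mult'[symmetric])
      then have "exp (\<gamma> * n) * (1 / real ?N) < 1"
        by (subst (asm) ennreal_less_iff) auto
      then show ?case using \<open>?N \<noteq> 0\<close> by (simp add: divide_simps split: if_splits)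
    qed
  qed
qed

lemma exp_sum_upper_AE:
  fixes b :: "nat \<Rightarrow> real" and \<rho> \<delta> C :: real
  assumes b: "\<And>k. mgf (\<lambda>k. k) t (\<nu> k) \<le> ennreal (exp (b k))"
    and sum: "\<And>n. (\<Sum>k<n. b k) \<le> n * (\<rho> + \<delta>) + C" and \<delta>: "0 < \<delta>"
  shows "AE x in tree_law \<nu>. \<forall>\<^sub>F n in sequentially.
    (\<Sum>u\<in>generation x n. exp (t * position x u)) \<le> exp (n * (\<rho> + 2 * \<delta>))"
proof -
  interpret T: prob_space "tree_law \<nu>" by (rule prob_space_tree_law)
  let ?f = "\<lambda>y. ennreal (exp (t * y))"
  let ?W = "\<lambda>n x. path_sum (\<lambda>k. k) n (final_weight n ?f) x 0"
  have W: "?W n x = ennreal (\<Sum>u\<in>generation x n. exp (t * position x u))" for n x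
    by (simp add: path_sum_final_weight)
  have mW: "?W n \<in> borel_measurable (tree_law \<nu>)" for n
    unfolding measurable_cong_sets[OF sets_tree_law refl] by (rule measurable_path_sum_tree) auto
  have "AE x in tree_law \<nu>. \<forall>\<^sub>F n in sequentially. ennreal (exp (- (real n * (\<rho> + 2 * \<delta>)))) * ?W n x < 1"
  proof (rule T.AE_eventually_less_1[where \<gamma>=\<delta>])
    fix n
    show "(\<lambda>x. ennreal (exp (- (real n * (\<rho> + 2 * \<delta>)))) * ?W n x) \<in> borel_measurable (tree_law \<nu>)"
      by (intro borel_measurable_times_ennreal mW) simp
    have "(\<integral>\<^sup>+x. ?W n x \<partial>tree_law \<nu>) \<le> 1 * ennreal (exp (t * 0)) * (\<Prod>k\<in>{0..<n}. mgf (\<lambda>k. k) t (\<nu> k))"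
      by (rule mean_path_sum_le) (auto intro: env_seq_axioms)
    also have "\<dots> \<le> ennreal (exp (\<Sum>k<n. b k))"
      using prod_le_ennreal_exp[of "{..<n}" "\<lambda>k. mgf (\<lambda>k. k) t (\<nu> k)" b] b by (simp add: atLeast0LessThan)
    also have "\<dots> \<le> ennreal (exp (n * (\<rho> + \<delta>) + C))"
      using sum[of n] by (intro ennreal_leI) simp
    finally have "ennreal (exp (- (real n * (\<rho> + 2 * \<delta>)))) * (\<integral>\<^sup>+x. ?W n x \<partial>tree_law \<nu>) \<le>
        ennreal (exp (- (real n * (\<rho> + 2 * \<delta>)))) * ennreal (exp (n * (\<rho> + \<delta>) + C))"
      by (rule mult_left_mono) simp
    also have "\<dots> = ennreal (exp (C - \<delta> * real n))"
      by (simp add: ennreal_mult'[symmetric] exp_add[symmetric] algebra_simps)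
    finally show "(\<integral>\<^sup>+x. ennreal (exp (- (real n * (\<rho> + 2 * \<delta>)))) * ?W n x \<partial>tree_law \<nu>) \<le> ennreal (exp (C - \<delta> * real n))"
      by (simp only: nn_integral_cmult[OF mW])
  qed (rule \<delta>)
  then show ?thesis
  proof eventually_elim
    case (elim x)
    show ?case using elim
    proof eventually_elim
      case (elim n)
      have "ennreal (exp (- (real n * (\<rho> + 2 * \<delta>))) * (\<Sum>u\<in>generation x n. exp (t * position x u))) < ennreal 1"
        using elim unfolding W by (subst ennreal_mult) (auto simp: sum_nonneg)
      then have "exp (- (real n * (\<rho> + 2 * \<delta>))) * (\<Sum>u\<in>generation x n. exp (t * position x u)) < 1"
        by (subst (asm) ennreal_less_iff) (auto intro!: mult_nonneg_nonneg sum_nonneg)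
      then have "exp (n * (\<rho> + 2 * \<delta>)) * (exp (- (real n * (\<rho> + 2 * \<delta>))) * (\<Sum>u\<in>generation x n. exp (t * position x u)))
          \<le> exp (n * (\<rho> + 2 * \<delta>)) * 1"
        by (intro mult_left_mono) auto
      then show ?case by (simp add: mult.assoc[symmetric] exp_add[symmetric])
    qed
  qed
qed

end

text \<open>The sequences \<open>b1\<close>, \<open>a\<close>, \<open>b2\<close> stand for the logarithms (upper bounds for \<open>b1\<close>, \<open>b2\<close>) of the truncated
  moment generating functions at \<open>t + r\<close>, \<open>t\<close>, \<open>t - r\<close>, with averages \<open>\<rho>1\<close>, \<open>\<rho>\<close>, \<open>\<rho>2\<close>; \<open>\<gamma>\<close> is the growth rate of the population and \<open>v\<close> the
  slope of the tube.\<close>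

locale lower_bound_env = env_seq +
  fixes c :: nat and a b1 b2 :: "nat \<Rightarrow> real" and t r v \<rho> \<rho>1 \<rho>2 \<sigma> \<epsilon> \<delta> C \<beta> \<gamma> R :: real
  assumes mgf_t: "mgf (min c) t (\<nu> k) = ennreal (exp (a k))"
    and mgf_up: "mgf (min c) (t + r) (\<nu> k) \<le> ennreal (exp (b1 k))"
    and mgf_down: "mgf (min c) (t - r) (\<nu> k) \<le> ennreal (exp (b2 k))"
    and sum_t: "\<bar>(\<Sum>k<j. a k) - j * \<rho>\<bar> \<le> \<delta> * j + C"
    and sum_up: "\<bar>(\<Sum>k<j. b1 k) - j * \<rho>1\<bar> \<le> \<delta> * j + C"
    and sum_down: "\<bar>(\<Sum>k<j. b2 k) - j * \<rho>2\<bar> \<le> \<delta> * j + C"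
    and slope_up: "\<rho>1 - \<rho> - r * v \<le> \<sigma>"
    and slope_down: "\<rho>2 - \<rho> + r * v \<le> \<sigma>"
    and r: "0 < r" and \<sigma>: "0 \<le> \<sigma>" and \<delta>: "0 < \<delta>" and \<epsilon>: "0 < \<epsilon>"
    and chernoff: "\<sigma> + 4 * \<delta> < r * \<epsilon>"
    and tv: "t * v \<le> \<rho>"
    and \<beta>: "0 < \<beta>" "\<beta> < 1" and \<gamma>: "0 < \<gamma>" and R: "0 \<le> R"
    and trials: "7 * \<bar>t\<bar> * \<epsilon> + 6 * \<delta> < \<gamma> * \<beta>"
begin

text \<open>The generation at which the independent trials start; it lies between
  \<open>\<beta> * n - 1\<close> and \<open>\<beta> * n\<close>.\<close>

definition first :: "nat \<Rightarrow> nat" where "first n = nat \<lfloor>\<beta> * real n\<rfloor>"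

lemma first_le: "real (first n) \<le> \<beta> * n" "first n \<le> n" and first_ge: "\<beta> * n - 1 \<le> first n"
proof -
  have *: "real (first n) = of_int \<lfloor>\<beta> * real n\<rfloor>"
    using \<beta> by (simp add: first_def)
  show "real (first n) \<le> \<beta> * n" "\<beta> * n - 1 \<le> first n" unfolding * by linarith+
  moreover have "\<beta> * n \<le> n" using \<beta> by (simp add: mult_left_le_one_le)
  ultimately show "first n \<le> n" by linarith
qed

lemma C: "0 \<le> C"
  using sum_t[of 0] by simp

text \<open>A window that starts at generation \<open>m\<close> is a difference of two initial
  segments, so the Birkhoff error is paid twice; it is expressed through n to be uniform over all
  windows inside the first n generations.\<close>

lemma window_sum:
  fixes f :: "nat \<Rightarrow> real" and q :: real and m j n :: nat
  assumes "\<And>j. \<bar>(\<Sum>k<j. f k) - j * q\<bar> \<le> \<delta> * j + C" "m + j \<le> n"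
  shows "\<bar>(\<Sum>k<j. f (k + m)) - j * q\<bar> \<le> 2 * \<delta> * n + 2 * C"
proof -
  have "(\<Sum>k<j. f (k + m)) = (\<Sum>k\<in>{0 + m..<j + m}. f k)"
    using sum.shift_bounds_nat_ivl[of f 0 m j] by (simp add: atLeast0LessThan)
  also have "\<dots> = (\<Sum>k<m + j. f k) - (\<Sum>k<m. f k)"
    by (simp add: sum_ivl_diff add.commute)
  finally have "\<bar>(\<Sum>k<j. f (k + m)) - j * q\<bar> \<le> \<delta> * (m + j) + C + (\<delta> * m + C)"
    using assms(1)[of m] assms(1)[of "m + j"] by (simp add: abs_le_iff algebra_simps)
  moreover have "\<delta> * (m + j) \<le> \<delta> * n" "\<delta> * m \<le> \<delta> * n"
    using assms(2) \<delta> by auto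
  ultimately show ?thesis by simp
qed

text \<open>The threshold of \<open>prob_count_ge\<close> for the window after
  \<open>first n\<close>, with error \<open>2 * \<delta> * n + 2 * C\<close> and tube width
  \<open>\<epsilon> * n\<close>.\<close>

definition thr :: "nat \<Rightarrow> real" where "thr n = exp (real (n - first n) * (\<rho> - t * v) - (2 * \<delta> * n + 2 * C) - \<bar>t\<bar> * (\<epsilon> * n)) / 4"

definition Good :: "nat \<Rightarrow> (nat list \<Rightarrow> mark) set" where "Good n = {x. ennreal (thr n) \<le>
  path_sum (min c) (n - first n) (\<lambda>j. indicator (tube v (\<epsilon> * n) j)) x 0}"

text \<open>The matching success probability; in the denominator the window length is replaced by
  the larger n.\<close>

definition p :: "nat \<Rightarrow> real" where "p n = exp (- (7 * \<bar>t\<bar> * (\<epsilon> * n) + 3 * (2 * \<delta> * n + 2 * C))) / (16 * (1 + (real c)\<^sup>2 * n))"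

lemma p: "0 < p n" "p n < 1"
proof -
  have d: "16 \<le> 16 * (1 + (real c)\<^sup>2 * n)" by simp
  show "0 < p n" unfolding p_def by (rule divide_pos_pos[OF exp_gt_zero]) (use d in linarith)
  have "exp (- (7 * \<bar>t\<bar> * (\<epsilon> * n) + 3 * (2 * \<delta> * n + 2 * C))) \<le> 1"
  proof -
    have "0 \<le> 7 * \<bar>t\<bar> * (\<epsilon> * n) + 3 * (2 * \<delta> * n + 2 * C)"
      using \<epsilon> \<delta> C by (intro add_nonneg_nonneg mult_nonneg_nonneg) auto
    then show ?thesis by (simp only: exp_le_one_iff neg_le_0_iff_le)
  qed
  then show "p n < 1" unfolding p_def using d by (subst divide_less_eq_1_pos) linarith+
qed

lemma eventually_good:
  "\<forall>\<^sub>F n in sequentially. p n \<le> measure (tree_law (\<lambda>k. \<nu> (k + first n))) (Good n)"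
proof -
  \<comment> \<open>The condition \<open>small\<close> contains twice the window error, which is
    where \<open>4 * \<delta>\<close> and \<open>4 * C\<close> come from. \<open>chernoff\<close>
    leaves a positive exponential rate that beats the polynomial factor.\<close>
  have "0 < r * \<epsilon> - (\<sigma> + 4 * \<delta>)" using chernoff by simp
  then have "\<forall>\<^sub>F n in sequentially. 2 * (real n + 1) * exp (4 * C - real n * (r * \<epsilon> - (\<sigma> + 4 * \<delta>))) \<le> 1 / 2"
    by real_asymp
  then show ?thesis
  proof eventually_elim
    case (elim n)
    let ?m = "first n" and ?l = "n - first n" and ?E = "2 * \<delta> * n + 2 * C"
    interpret W: tube_estimate "\<lambda>k. \<nu> (k + ?m)" "min c" c ?l "\<lambda>k. a (k + ?m)" "\<lambda>k. b1 (k + ?m)" "\<lambda>k. b2 (k + ?m)"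
      t r v "\<epsilon> * n" \<rho> \<rho>1 \<rho>2 \<sigma> ?E
    proof (rule tube_estimate.intro)
      show "env_seq (\<lambda>k. \<nu> (k + ?m))" by (rule env_seq_shift) (rule env_seq_axioms)
      show "\<bar>(\<Sum>k<j. a (k + ?m)) - j * \<rho>\<bar> \<le> ?E" if "j \<le> ?l" for j
        using that first_le(2)[of n] by (intro window_sum sum_t) auto
      show "(\<Sum>k<j. b1 (k + ?m)) \<le> j * \<rho>1 + ?E" if "j \<le> ?l" for j
      proof -
        have "?m + j \<le> n" using that first_le(2)[of n] by linarith
        from window_sum[of b1 \<rho>1, OF sum_up this] show ?thesis by linarith
      qed
      show "(\<Sum>k<j. b2 (k + ?m)) \<le> j * \<rho>2 + ?E" if "j \<le> ?l" for j
      proof -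
        have "?m + j \<le> n" using that first_le(2)[of n] by linarith
        from window_sum[of b2 \<rho>2, OF sum_down this] show ?thesis by linarith
      qed
      have "?l * \<sigma> \<le> n * \<sigma>" using \<sigma> by (intro mult_right_mono) auto
      then have "?l * \<sigma> + 2 * ?E - r * (\<epsilon> * n) \<le> 4 * C - real n * (r * \<epsilon> - (\<sigma> + 4 * \<delta>))"
      proof -
        have "2 * ?E - r * (\<epsilon> * n) = 4 * C - real n * (r * \<epsilon> - (\<sigma> + 4 * \<delta>)) - n * \<sigma>"
          by (simp add: algebra_simps)
        with \<open>?l * \<sigma> \<le> n * \<sigma>\<close> show ?thesis by linarith
      qed
      then have "2 * (real ?l + 1) * exp (?l * \<sigma> + 2 * ?E - r * (\<epsilon> * n)) \<le>
          2 * (real n + 1) * exp (4 * C - real n * (r * \<epsilon> - (\<sigma> + 4 * \<delta>)))"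
        by (intro mult_mono) auto
      with elim show "2 * (real ?l + 1) * exp (?l * \<sigma> + 2 * ?E - r * (\<epsilon> * n)) \<le> 1 / 2" by linarith
      show "0 \<le> \<epsilon> * real n" using \<epsilon> by simp
      show "min c k \<le> c" for k by simp
    qed (rule mgf_t mgf_up mgf_down r \<sigma> slope_up slope_down tv)+
    have "p n \<le> exp (- (7 * \<bar>t\<bar> * (\<epsilon> * n) + 3 * ?E)) / (16 * (1 + (real c)\<^sup>2 * ?l))"
      unfolding p_def by (intro divide_left_mono mult_left_mono add_left_mono) (auto intro!: mult_pos_pos add_pos_nonneg)
    also have "\<dots> \<le> measure (tree_law (\<lambda>k. \<nu> (k + first n))) (Good n)"
      using W.prob_count_ge by (simp add: Good_def thr_def)
    finally show ?case .
  qed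
qed

lemma Good_sets: "Good n \<in> sets tree_space"
proof -
  have "(\<lambda>x. path_sum (min c) (n - first n) (\<lambda>j. indicator (tube v (\<epsilon> * n) j)) x 0) \<in> borel_measurable tree_space"
    by (rule measurable_path_sum_tree) simp
  then have "{x \<in> space tree_space. ennreal (thr n) \<le>
    path_sum (min c) (n - first n) (\<lambda>j. indicator (tube v (\<epsilon> * n) j)) x 0} \<in> sets tree_space" by measurable
  then show ?thesis by (simp add: Good_def)
qed

text \<open>The power is at most \<open>exp (- p * M)\<close>, where \<open>M\<close> is the number
  of trials. \<open>M\<close> grows at rate \<open>\<gamma> * \<beta>\<close>, and \<open>p\<close>
  decays at rate \<open>7 * \<bar>t\<bar> * \<epsilon> + 6 * \<delta>\<close> up to a polynomial;
  \<open>trials\<close> says that the first rate wins, so \<open>p * M\<close> eventually exceeds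
  n.\<close>

lemma eventually_trials: "\<forall>\<^sub>F n in sequentially. (1 - p n) ^ nat \<lfloor>exp (\<gamma> * first n)\<rfloor> \<le> exp (- real n)"
proof -
  define d where "d = \<gamma> * \<beta> - (7 * \<bar>t\<bar> * \<epsilon> + 6 * \<delta>)"
  define q where "q = 7 * \<bar>t\<bar> * \<epsilon> + 6 * \<delta>"
  have d: "0 < d" using trials by (simp add: d_def)
  have q: "0 < q" using \<epsilon> \<delta> by (simp add: q_def add_nonneg_pos)
  define k where "k = (1 + (real c)\<^sup>2) * (16 * exp (6 * C))"
  have "0 < k" unfolding k_def by (intro mult_pos_pos add_pos_nonneg) auto
  \<comment> \<open>One factor n is the exponent to be reached, the other bounds the denominator of
    \<open>p n\<close>. The summand 1 pays for rounding down the number of trials, and the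
    \<open>\<gamma>\<close> in the exponent for rounding in \<open>first n\<close>.\<close>
  then have "\<forall>\<^sub>F n in sequentially. real n * real n * k + 1 \<le> exp (d * real n - \<gamma>)"
    using d \<gamma> by real_asymp
  then show ?thesis
    using eventually_ge_at_top[of 1]
  proof eventually_elim
    case (elim n)
    have "1 + (real c)\<^sup>2 * n \<le> (1 + (real c)\<^sup>2) * n" using elim(2) by (simp add: distrib_right)
    then have "n * ((1 + (real c)\<^sup>2 * n) * (16 * exp (6 * C))) \<le> n * ((1 + (real c)\<^sup>2) * n * (16 * exp (6 * C)))"
      by (intro mult_left_mono mult_right_mono) auto
    also have "\<dots> = real n * real n * k" by (simp add: k_def)
    also have "\<dots> \<le> exp (d * real n - \<gamma>) - exp (- q * real n)"
    proof -
      have "exp (- q * real n) \<le> 1" using q by simp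
      then show ?thesis using elim(1) by linarith
    qed
    finally have elim: "n * (1 + (real c)\<^sup>2 * real n) * (16 * exp (6 * C)) \<le> exp (d * real n - \<gamma>) - exp (- q * real n)"
      by (simp add: mult.assoc)
    let ?M = "nat \<lfloor>exp (\<gamma> * first n)\<rfloor>"
    have pd: "0 < 16 * (1 + (real c)\<^sup>2 * real n) * exp (6 * C)" by (intro mult_pos_pos add_pos_nonneg) auto
    have "\<gamma> * (\<beta> * n - 1) \<le> \<gamma> * first n"
      using first_ge[of n] \<gamma> by (intro mult_left_mono) auto
    then have "exp (\<gamma> * (\<beta> * n - 1)) \<le> exp (\<gamma> * first n)" by simp
    moreover have "exp (\<gamma> * first n) - 1 \<le> real ?M" by linarith
    ultimately have M: "exp (\<gamma> * (\<beta> * n - 1)) - 1 \<le> ?M" by linarith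
    have pn: "p n = exp (- q * n) / (16 * (1 + (real c)\<^sup>2 * real n) * exp (6 * C))"
    proof -
      have e: "- (7 * \<bar>t\<bar> * (\<epsilon> * n) + 3 * (2 * \<delta> * n + 2 * C)) = - q * n - 6 * C"
        by (simp add: q_def algebra_simps)
      show ?thesis unfolding p_def e exp_diff by (simp add: mult_ac)
    qed
    have "exp (- q * n) * (exp (\<gamma> * (\<beta> * n - 1)) - 1) = exp (d * real n - \<gamma>) - exp (- q * n)"
      by (simp add: q_def d_def right_diff_distrib exp_add[symmetric] algebra_simps)
    moreover have "n * (16 * (1 + (real c)\<^sup>2 * real n) * exp (6 * C)) = n * (1 + (real c)\<^sup>2 * real n) * (16 * exp (6 * C))"
      by (simp only: mult_ac)
    ultimately have "n * (16 * (1 + (real c)\<^sup>2 * real n) * exp (6 * C)) \<le> exp (- q * n) * (exp (\<gamma> * (\<beta> * n - 1)) - 1)"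
      using elim by (simp only:)
    then have "n \<le> p n * (exp (\<gamma> * (\<beta> * n - 1)) - 1)"
      unfolding pn using pd by (simp add: pos_le_divide_eq)
    also have "\<dots> \<le> p n * ?M" using M p(1)[of n] by (intro mult_left_mono) auto
    finally have n: "n \<le> p n * ?M" .
    have "1 - p n \<le> exp (- p n)" using exp_ge_add_one_self[of "- p n"] by simp
    then have "(1 - p n) ^ ?M \<le> exp (- p n) ^ ?M"
      using p[of n] by (intro power_mono) auto
    also have "\<dots> = exp (- (p n * ?M))" by (simp add: exp_of_nat_mult[symmetric] mult.commute)
    also have "\<dots> \<le> exp (- real n)" using n by simp
    finally show ?case .
  qed
qed

text \<open>One successful subtree is enough. Its root is at distance at most
  \<open>R * first n\<close> from the origin, and the line has moved by at most
  \<open>\<bar>v\<bar> * first n\<close> meanwhile; this is the extra width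
  \<open>(R + \<bar>v\<bar>) * \<beta>\<close>.\<close>

theorem card_lower_AE:
  assumes growth: "AE x in tree_law \<nu>. \<forall>\<^sub>F n in sequentially. exp (\<gamma> * n) \<le> card (generation x n)"
    and radius: "AE x in tree_law \<nu>. \<forall>\<^sub>F n in sequentially. \<forall>u\<in>generation x n. \<bar>position x u\<bar> \<le> R * n"
  shows "AE x in tree_law \<nu>. \<forall>\<^sub>F n in sequentially.
    thr n \<le> card {u \<in> generation x n. \<bar>position x u - n * v\<bar> \<le> (\<epsilon> + (R + \<bar>v\<bar>) * \<beta>) * n}"
proof -
  interpret T: prob_space "tree_law \<nu>" by (rule prob_space_tree_law)
  let ?M = "\<lambda>n. nat \<lfloor>exp (\<gamma> * first n)\<rfloor>"
  let ?fail = "\<lambda>n x. ?M n \<le> card {u \<in> generation x (first n). \<bar>position x u\<bar> \<le> R * first n} \<and>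
      (\<forall>u\<in>generation x (first n). \<bar>position x u\<bar> \<le> R * first n \<longrightarrow> (\<lambda>v. x (u @ v)) \<notin> Good n)"
  obtain n0 where n0: "\<And>n. n0 \<le> n \<Longrightarrow> p n \<le> measure (tree_law (\<lambda>k. \<nu> (k + first n))) (Good n)"
    "\<And>n. n0 \<le> n \<Longrightarrow> (1 - p n) ^ ?M n \<le> exp (- real n)"
    using eventually_conj[OF eventually_good eventually_trials] unfolding eventually_sequentially by blast
  define Q where "Q n B \<longleftrightarrow> B \<in> sets tree_space \<and> emeasure (tree_law \<nu>) B \<le> ennreal (exp (0 - 1 * real n)) \<and>
      (\<forall>x. ?fail n x \<longrightarrow> x \<in> B)" for n B
  \<comment> \<open>\<open>all_subtrees_fail_prob\<close> only asserts that a suitable measurable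
    set exists for each large n; these sets are chosen here to form the sequence for
    Borel-Cantelli.\<close>
  define B where "B n = (SOME B. Q n B)" for n
  have ex: "\<exists>B. Q n B"
    if ge: "n0 \<le> n" for n
  proof -
    obtain B where "B \<in> sets tree_space" "emeasure (tree_law \<nu>) B \<le> ennreal ((1 - p n) ^ ?M n)"
      "\<And>x. ?fail n x \<Longrightarrow> x \<in> B"
      by (rule all_subtrees_fail_prob[OF env_seq_axioms Good_sets n0(1)[OF ge] p, of "?M n" "R * first n"]) blast
    then show ?thesis
      using n0(2)[OF ge] unfolding Q_def by (intro exI[of _ B]) (auto intro: order_trans ennreal_leI)
  qed
  have Q: "Q n (B n)" if "n0 \<le> n" for n
    unfolding B_def by (rule someI_ex[OF ex[OF that]])
  have B: "\<And>n. n0 \<le> n \<Longrightarrow> B n \<in> sets tree_space"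
    "\<And>n. n0 \<le> n \<Longrightarrow> emeasure (tree_law \<nu>) (B n) \<le> ennreal (exp (0 - 1 * real n))"
    "\<And>n x. n0 \<le> n \<Longrightarrow> ?fail n x \<Longrightarrow> x \<in> B n"
    using Q unfolding Q_def by blast+
  have "AE x in tree_law \<nu>. \<forall>\<^sub>F n in sequentially. x \<notin> B n"
    by (rule T.AE_eventually_notin[of n0 B 0 1]) (use B in auto)
  with growth radius show ?thesis
  proof eventually_elim
    case (elim x)
    have lim: "filterlim first at_top sequentially"
    proof -
      have "filterlim (\<lambda>n. \<beta> * real n - 1) at_top sequentially" using \<beta> by real_asymp
      then have "filterlim (\<lambda>n. real (first n)) at_top sequentially"
        by (rule filterlim_at_top_mono) (use first_ge in auto)
      then show ?thesis by (simp add: filterlim_of_nat_at_top filterlim_sequentially_iff_filterlim_real)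
    qed
    have "\<forall>\<^sub>F n in sequentially. exp (\<gamma> * first n) \<le> card (generation x (first n))"
      using eventually_compose_filterlim[OF elim(1) lim] .
    moreover have "\<forall>\<^sub>F n in sequentially. \<forall>u\<in>generation x (first n). \<bar>position x u\<bar> \<le> R * first n"
      using eventually_compose_filterlim[OF elim(2) lim] .
    ultimately show ?case using elim(3) eventually_ge_at_top[of n0]
    proof eventually_elim
      case (elim n)
      let ?m = "first n" and ?l = "n - first n"
      have "{u \<in> generation x ?m. \<bar>position x u\<bar> \<le> R * ?m} = generation x ?m" using elim(2) by auto
      moreover have "?M n \<le> card (generation x ?m)" using elim(1) by linarith
      ultimately have "?M n \<le> card {u \<in> generation x ?m. \<bar>position x u\<bar> \<le> R * ?m}" by simp
      then obtain u where u: "u \<in> generation x ?m" "\<bar>position x u\<bar> \<le> R * ?m" "(\<lambda>v. x (u @ v)) \<in> Good n"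
        using B(3)[OF elim(4), of x] elim(3) by blast
      let ?y = "\<lambda>v. x (u @ v)"
      let ?S = "{w \<in> generation ?y ?l. position ?y w \<in> tube v (\<epsilon> * n) ?l}"
      let ?S' = "{w \<in> generation x n. \<bar>position x w - n * v\<bar> \<le> (\<epsilon> + (R + \<bar>v\<bar>) * \<beta>) * n}"
      have "ennreal (thr n) \<le> of_nat (card ?S)"
        using u(3) tube_count_le_card[of "min c" ?l v "\<epsilon> * n" ?y] unfolding Good_def
        by (simp only: mem_Collect_eq) (rule order_trans, assumption, simp)
      then have "thr n \<le> card ?S"
        by (simp add: ennreal_of_nat_eq_real_of_nat)
      also have "card ?S \<le> card ?S'"
      proof (rule card_inj_on_le)
        show "inj_on ((@) u) ?S" by (auto simp: inj_on_def)
        show "finite ?S'" by simp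
        show "(@) u ` ?S \<subseteq> ?S'"
        proof (rule image_subsetI)
          fix w assume "w \<in> ?S"
          then have w: "w \<in> generation ?y ?l" "\<bar>position ?y w - ?l * v\<bar> \<le> \<epsilon> * n" by (auto simp: tube_def)
          have "u @ w \<in> generation x n"
            using generation_append[OF u(1) w(1)] first_le(2)[of n] by simp
          moreover have "\<bar>position x (u @ w) - n * v\<bar> \<le> (\<epsilon> + (R + \<bar>v\<bar>) * \<beta>) * n"
          proof -
            have "position x (u @ w) - n * v = position x u - ?m * v + (position ?y w - ?l * v)"
              using first_le(2)[of n] by (simp add: position_append of_nat_diff algebra_simps)
            also have "\<bar>\<dots>\<bar> \<le> \<bar>position x u\<bar> + ?m * \<bar>v\<bar> + \<bar>position ?y w - ?l * v\<bar>"
              using abs_mult[of "real ?m" v] by linarith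
            also have "\<dots> \<le> (R + \<bar>v\<bar>) * ?m + \<epsilon> * n"
              using u(2) w(2) by (simp add: algebra_simps)
            also have "(R + \<bar>v\<bar>) * ?m \<le> (R + \<bar>v\<bar>) * (\<beta> * n)"
              using first_le(1)[of n] R by (intro mult_left_mono) auto
            finally show ?thesis by (simp add: algebra_simps)
          qed
          ultimately show "u @ w \<in> ?S'" by simp
        qed
      qed
      finally show ?case by simp
    qed
  qed
qed

end

section \<open>The logarithmic moment generating function\<close>

definition lmgf :: "(nat \<Rightarrow> nat) \<Rightarrow> real \<Rightarrow> mark measure \<Rightarrow> real" where
  "lmgf K t \<mu> = ln (enn2real (mgf K t \<mu>))"

lemma exp_le_exp_add_exp:
  assumes "\<bar>a\<bar> \<le> (b :: real)"
  shows "exp (a * x) \<le> exp (b * x) + exp (- b * x)"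
proof (cases "0 \<le> x")
  case True
  then have "a * x \<le> b * x" using assms by (intro mult_right_mono) auto
  then have "exp (a * x) \<le> exp (b * x)" by simp
  then show ?thesis by (rule order_trans) simp
next
  case False
  then have "a * x \<le> - b * x" using assms by (intro mult_right_mono_neg) auto
  then have "exp (a * x) \<le> exp (- b * x)" by simp
  then show ?thesis by (rule order_trans) simp
qed

text \<open>From \<open>\<bar>exp y - 1\<bar> \<le> \<bar>y\<bar> * exp \<bar>y\<bar>\<close> and
  \<open>\<bar>x\<bar> \<le> exp \<bar>x\<bar>\<close>. It dominates the difference quotients of the
  moment generating function at \<open>t\<close> by its integrands at \<open>t + 2\<close> and
  \<open>t - 2\<close>.\<close>

lemma abs_exp_quotient_le:
  fixes h x :: real
  assumes "h \<noteq> 0" "\<bar>h\<bar> \<le> 1"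
  shows "\<bar>(exp (h * x) - 1) / h\<bar> \<le> exp (2 * x) + exp (- 2 * x)"
proof -
  have a: "\<bar>exp y - 1\<bar> \<le> \<bar>y\<bar> * exp \<bar>y\<bar>" for y :: real
  proof (cases "0 \<le> y")
    case True
    have "1 - y \<le> exp (- y)" using exp_ge_add_one_self[of "- y"] by simp
    then have "(1 - y) * exp y \<le> exp (- y) * exp y" by (intro mult_right_mono) auto
    then show ?thesis using True by (simp add: exp_minus algebra_simps)
  next
    case False
    have "1 - exp y \<le> - y" using exp_ge_add_one_self[of y] by linarith
    also have "\<dots> \<le> - y * exp (- y)" using False by (simp add: mult_le_cancel_left1)
    finally show ?thesis using False by simp
  qed
  have "\<bar>(exp (h * x) - 1) / h\<bar> = \<bar>exp (h * x) - 1\<bar> / \<bar>h\<bar>" by (rule abs_divide)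
  also have "\<dots> \<le> (\<bar>h * x\<bar> * exp \<bar>h * x\<bar>) / \<bar>h\<bar>" using a by (rule divide_right_mono) simp
  also have "\<dots> = \<bar>x\<bar> * exp (\<bar>h\<bar> * \<bar>x\<bar>)" using assms by (simp add: abs_mult)
  also have "\<dots> \<le> exp \<bar>x\<bar> * exp \<bar>x\<bar>"
  proof (intro mult_mono)
    show "\<bar>x\<bar> \<le> exp \<bar>x\<bar>" using exp_ge_add_one_self[of "\<bar>x\<bar>"] by linarith
    show "exp (\<bar>h\<bar> * \<bar>x\<bar>) \<le> exp \<bar>x\<bar>" using assms by (simp add: mult_left_le_one_le)
  qed auto
  also have "\<dots> = exp (2 * \<bar>x\<bar>)" by (simp add: exp_add[symmetric])
  also have "\<dots> \<le> exp (2 * x) + exp (- 2 * x)" by (cases "0 \<le> x") auto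
  finally show ?thesis .
qed

lemma exp_convex_comb:
  "0 \<le> u \<Longrightarrow> 0 \<le> w \<Longrightarrow> u + w = 1 \<Longrightarrow> exp (u * a + w * b) \<le> u * exp a + w * exp (b :: real)"
proof -
  assume "0 \<le> u" "0 \<le> w" "u + w = 1"
  then have "u = 1 - w" "0 \<le> w" "w \<le> 1" by auto
  then show ?thesis using convex_onD[OF exp_convex, of w a b] by simp
qed

text \<open>What holds for the offspring law of almost every state of the environment; finiteness is
  required for all exponents at once.\<close>

locale offspring_law = prob_space \<mu> for \<mu> :: "mark measure" +
  assumes sets_\<mu>: "sets \<mu> = sets mark_space"
    and nonempty: "AE m in \<mu>. 1 \<le> fst m"
    and first_int: "integrable \<mu> (\<lambda>m. snd m 0)"
    and mgf_fin: "mgf (\<lambda>k. k) t \<mu> < \<infinity>"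
begin

lemma measurable_sum_marks_real:
  assumes f: "f \<in> borel_measurable borel"
  shows "(\<lambda>m. \<Sum>i<fst m. f (snd m i) :: real) \<in> borel_measurable \<mu>"
proof (rule measurable_compose_countable[where g=fst])
  show "fst \<in> \<mu> \<rightarrow>\<^sub>M count_space UNIV"
    unfolding measurable_cong_sets[OF sets_\<mu> refl] by (rule measurable_fst_mark)
  show "(\<lambda>m. \<Sum>i<k. f (snd m i)) \<in> borel_measurable \<mu>" for k
    unfolding measurable_cong_sets[OF sets_\<mu> refl]
    by (intro borel_measurable_sum measurable_compose[OF measurable_snd_mark f])
qed

abbreviation expsum :: "real \<Rightarrow> mark \<Rightarrow> real" where
  "expsum t m \<equiv> \<Sum>i<fst m. exp (t * snd m i)"

lemma mgf_eq_expsum: "mgf (\<lambda>k. k) t \<mu> = (\<integral>\<^sup>+m. ennreal (expsum t m) \<partial>\<mu>)"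
  unfolding mgf_def by (intro nn_integral_cong) (simp add: sum_ennreal)

lemma expsum_integrable: "integrable \<mu> (expsum t)"
proof (rule integrableI_nonneg)
  show "(\<integral>\<^sup>+m. ennreal (expsum t m) \<partial>\<mu>) < \<infinity>" using mgf_fin[of t] by (simp add: mgf_eq_expsum)
  show "expsum t \<in> borel_measurable \<mu>"
    by (rule measurable_sum_marks_real[where f="\<lambda>y. exp (t * y)"]) measurable
qed (simp add: sum_nonneg)

definition \<phi> :: "real \<Rightarrow> real" where "\<phi> t = (\<integral>m. expsum t m \<partial>\<mu>)"

lemma mgf_eq_\<phi>: "mgf (\<lambda>k. k) t \<mu> = ennreal (\<phi> t)"
  unfolding mgf_eq_expsum \<phi>_def
  by (rule nn_integral_eq_integral[OF expsum_integrable]) (simp add: sum_nonneg)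

lemma mgf_trunc_le: "mgf (min c) t \<mu> \<le> mgf (\<lambda>k. k) t \<mu>"
  unfolding mgf_def by (intro nn_integral_mono sum_mono2) auto

abbreviation "drift \<equiv> \<integral>m. snd m 0 \<partial>\<mu>"

text \<open>Jensen's inequality for the first child, via the tangent line of \<open>exp\<close>.\<close>

lemma exp_drift_le_mgf_trunc:
  assumes "0 < c"
  shows "ennreal (exp (t * drift)) \<le> mgf (min c) t \<mu>"
proof -
  let ?a = "t * drift"
  have int: "integrable \<mu> (\<lambda>m. exp ?a * (1 + (t * snd m 0 - ?a)))"
    using first_int by simp
  have "exp ?a = (\<integral>m. exp ?a * (1 + (t * snd m 0 - ?a)) \<partial>\<mu>)"
    using first_int by (simp add: prob_space)
  then have "ennreal (exp ?a) = ennreal (\<integral>m. exp ?a * (1 + (t * snd m 0 - ?a)) \<partial>\<mu>)" by simp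
  also have "\<dots> \<le> (\<integral>\<^sup>+m. ennreal (exp ?a * (1 + (t * snd m 0 - ?a))) \<partial>\<mu>)"
  proof -
    have "(\<integral>m. exp ?a * (1 + (t * snd m 0 - ?a)) \<partial>\<mu>) \<le> (\<integral>m. max 0 (exp ?a * (1 + (t * snd m 0 - ?a))) \<partial>\<mu>)"
      using int by (intro integral_mono integrable_max) auto
    then have "ennreal (\<integral>m. exp ?a * (1 + (t * snd m 0 - ?a)) \<partial>\<mu>) \<le>
        ennreal (\<integral>m. max 0 (exp ?a * (1 + (t * snd m 0 - ?a))) \<partial>\<mu>)"
      by (rule ennreal_leI)
    also have "\<dots> = (\<integral>\<^sup>+m. ennreal (max 0 (exp ?a * (1 + (t * snd m 0 - ?a)))) \<partial>\<mu>)"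
      using int by (intro nn_integral_eq_integral[symmetric] integrable_max) auto
    finally show ?thesis by (simp add: ennreal_max_0)
  qed
  also have "\<dots> \<le> mgf (min c) t \<mu>"
    unfolding mgf_def using nonempty
  proof (intro nn_integral_mono_AE, elim eventually_mono)
    fix m :: mark assume m: "1 \<le> fst m"
    have "exp ?a * (1 + (t * snd m 0 - ?a)) \<le> exp ?a * exp (t * snd m 0 - ?a)"
      by (intro mult_left_mono exp_ge_add_one_self) simp
    also have "\<dots> = exp (t * snd m 0)" by (simp add: exp_add[symmetric])
    finally have "ennreal (exp ?a * (1 + (t * snd m 0 - ?a))) \<le> ennreal (exp (t * snd m 0))"
      by (rule ennreal_leI)
    also have "\<dots> \<le> (\<Sum>i<min c (fst m). ennreal (exp (t * snd m i)))"
      using m assms by (intro member_le_sum) auto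
    finally show "ennreal (exp ?a * (1 + (t * snd m 0 - ?a))) \<le> (\<Sum>i<min c (fst m). ennreal (exp (t * snd m i)))" .
  qed
  finally show ?thesis .
qed

lemma mgf_pos: "0 < mgf (\<lambda>k. k) t \<mu>"
  using exp_drift_le_mgf_trunc[of 1 t] mgf_trunc_le[of 1 t]
  by (meson ennreal_less_zero_iff exp_gt_zero less_le_trans zero_less_one)

lemma \<phi>_pos: "0 < \<phi> t"
  using mgf_pos[of t] by (simp add: mgf_eq_\<phi>)

lemma lmgf_eq: "lmgf (\<lambda>k. k) t \<mu> = ln (\<phi> t)"
  using \<phi>_pos[of t] by (simp add: lmgf_def mgf_eq_\<phi>)

lemma mgf_eq_exp_lmgf: "mgf (\<lambda>k. k) t \<mu> = ennreal (exp (lmgf (\<lambda>k. k) t \<mu>))"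
  using \<phi>_pos[of t] by (simp add: lmgf_eq mgf_eq_\<phi>)

lemma mgf_trunc_eq_exp_lmgf:
  assumes "0 < c"
  shows "mgf (min c) t \<mu> = ennreal (exp (lmgf (min c) t \<mu>))"
proof -
  have "mgf (min c) t \<mu> < \<infinity>" using mgf_trunc_le mgf_fin by (rule le_less_trans)
  moreover have "0 < mgf (min c) t \<mu>"
    using exp_drift_le_mgf_trunc[OF assms, of t] by (rule less_le_trans[rotated]) simp
  ultimately show ?thesis
    by (simp add: lmgf_def enn2real_positive_iff less_top[symmetric])
qed

text \<open>With \<open>lmgf_trunc_le\<close> this confines the truncated logarithms between two
  bounds that do not depend on \<open>c\<close>, as dominated convergence over the environment will
  require.\<close>

lemma lmgf_trunc_ge: "0 < c \<Longrightarrow> t * drift \<le> lmgf (min c) t \<mu>"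
  using exp_drift_le_mgf_trunc[of c t] by (simp add: mgf_trunc_eq_exp_lmgf)

lemma lmgf_trunc_le: "0 < c \<Longrightarrow> lmgf (min c) t \<mu> \<le> lmgf (\<lambda>k. k) t \<mu>"
  using mgf_trunc_le[of c t] by (simp add: mgf_trunc_eq_exp_lmgf mgf_eq_exp_lmgf)

text \<open>Monotone convergence in the number of children. \<open>Suc c\<close> keeps at least one
  child; with none the moment generating function would be 0.\<close>

lemma lmgf_trunc_tendsto: "(\<lambda>c. lmgf (min (Suc c)) t \<mu>) \<longlonglongrightarrow> lmgf (\<lambda>k. k) t \<mu>"
proof -
  have "(\<lambda>c. mgf (min (Suc c)) t \<mu>) \<longlonglongrightarrow> mgf (\<lambda>k. k) t \<mu>"
    unfolding mgf_def
  proof (rule nn_integral_LIMSEQ)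
    show "incseq (\<lambda>c m. \<Sum>i<min (Suc c) (fst m). ennreal (exp (t * snd m i)))"
    proof (rule incseq_SucI, rule le_funI)
      fix c and m :: mark
      have "{..<min (Suc c) (fst m)} \<subseteq> {..<min (Suc (Suc c)) (fst m)}" by auto
      then show "(\<Sum>i<min (Suc c) (fst m). ennreal (exp (t * snd m i))) \<le>
          (\<Sum>i<min (Suc (Suc c)) (fst m). ennreal (exp (t * snd m i)))"
        by (intro sum_mono2) simp_all
    qed
    show "(\<lambda>m. \<Sum>i<min (Suc c) (fst m). ennreal (exp (t * snd m i))) \<in> borel_measurable \<mu>" for c
    proof -
      have "(\<lambda>y. ennreal (exp (t * y))) \<in> borel_measurable borel" by measurable
      from measurable_sum_marks[OF sets_\<mu> this, where K="min (Suc c)" and s=0]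
      show ?thesis by (simp only: add_0)
    qed
    fix m :: mark
    have "\<forall>\<^sub>F c in sequentially. (\<Sum>i<min (Suc c) (fst m). ennreal (exp (t * snd m i))) =
        (\<Sum>i<fst m. ennreal (exp (t * snd m i)))"
      using eventually_ge_at_top[of "fst m"] by eventually_elim (simp add: min_def)
    then show "(\<lambda>c. \<Sum>i<min (Suc c) (fst m). ennreal (exp (t * snd m i)))
        \<longlonglongrightarrow> (\<Sum>i<fst m. ennreal (exp (t * snd m i)))"
      by (rule tendsto_eventually)
  qed
  then have "(\<lambda>c. enn2real (mgf (min (Suc c)) t \<mu>)) \<longlonglongrightarrow> enn2real (mgf (\<lambda>k. k) t \<mu>)"
    using mgf_fin[of t] by (intro tendsto_enn2real) (auto simp: mgf_eq_\<phi> \<phi>_pos less_imp_le)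
  then show ?thesis
    unfolding lmgf_def by (rule tendsto_ln) (use \<phi>_pos[of t] in \<open>simp add: mgf_eq_\<phi>\<close>)
qed

text \<open>Hoelder's inequality, derived from convexity of \<open>exp\<close> at the exponents
  shifted by \<open>ln (\<phi> s)\<close> and \<open>ln (\<phi> t)\<close>: after this normalisation
  both integrals are 1.\<close>

lemma convex_lmgf: "convex_on UNIV (\<lambda>t. lmgf (\<lambda>k. k) t \<mu>)"
proof (rule convex_onI)
  fix w s t :: real assume w: "0 < w" "w < 1"
  let ?f = "\<lambda>t. ln (\<phi> t)" and ?u = "1 - w"
  let ?r = "?u * s + w * t" and ?b = "?u * ?f s + w * ?f t"
  have pt: "exp (?r * x) \<le> exp ?b * (?u * exp (- ?f s) * exp (s * x) + w * exp (- ?f t) * exp (t * x))" for x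
  proof -
    have "exp (?u * (s * x - ?f s) + w * (t * x - ?f t)) \<le> ?u * exp (s * x - ?f s) + w * exp (t * x - ?f t)"
      by (rule exp_convex_comb) (use w in linarith)+
    then have "exp ?b * exp (?u * (s * x - ?f s) + w * (t * x - ?f t)) \<le>
        exp ?b * (?u * exp (s * x - ?f s) + w * exp (t * x - ?f t))"
      by (intro mult_left_mono) auto
    moreover have "exp ?b * exp (?u * (s * x - ?f s) + w * (t * x - ?f t)) = exp (?r * x)"
      by (simp add: exp_add[symmetric] algebra_simps)
    moreover have "exp (q * x - z) = exp (- z) * exp (q * x)" for q z :: real
      by (simp add: exp_diff exp_minus divide_inverse mult.commute)
    ultimately show ?thesis by (simp only: mult.assoc)
  qed
  have "\<phi> ?r \<le> (\<integral>m. exp ?b * (?u * exp (- ?f s) * expsum s m + w * exp (- ?f t) * expsum t m) \<partial>\<mu>)"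
    unfolding \<phi>_def[of ?r]
  proof (rule integral_mono)
    show "expsum ?r m \<le> exp ?b * (?u * exp (- ?f s) * expsum s m + w * exp (- ?f t) * expsum t m)" for m
      unfolding sum_distrib_left sum.distrib[symmetric] by (intro sum_mono) (rule pt)
    show "integrable \<mu> (expsum ?r)" by (rule expsum_integrable)
    show "integrable \<mu> (\<lambda>m. exp ?b * (?u * exp (- ?f s) * expsum s m + w * exp (- ?f t) * expsum t m))"
      by (intro integrable_mult_right Bochner_Integration.integrable_add expsum_integrable)
  qed
  also have "\<dots> = exp ?b * (?u * exp (- ?f s) * \<phi> s + w * exp (- ?f t) * \<phi> t)"
    by (simp add: expsum_integrable \<phi>_def)
  also have "\<dots> = exp ?b"
  proof -
    have "exp (- ln (\<phi> q)) * \<phi> q = 1" for q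
      using \<phi>_pos[of q] by (simp add: exp_minus)
    then show ?thesis by (simp only: mult.assoc) simp
  qed
  finally have "ln (\<phi> ?r) \<le> ln (exp ?b)"
    by (rule ln_mono) (rule \<phi>_pos)
  then have "ln (\<phi> ?r) \<le> ?b" by (simp only: ln_exp)
  then show "lmgf (\<lambda>k. k) ((1 - w) *\<^sub>R s + w *\<^sub>R t) \<mu> \<le>
      (1 - w) * lmgf (\<lambda>k. k) s \<mu> + w * lmgf (\<lambda>k. k) t \<mu>"
    by (simp add: lmgf_eq)
qed simp

lemma \<phi>_has_derivative: "(\<phi> has_real_derivative (\<integral>m. (\<Sum>i<fst m. snd m i * exp (t * snd m i)) \<partial>\<mu>)) (at t)"
  unfolding DERIV_def tendsto_at_iff_sequentially comp_def
proof (intro allI impI)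
  fix X :: "nat \<Rightarrow> real"
  assume X0: "\<forall>i. X i \<in> UNIV - {0}" and X: "X \<longlonglongrightarrow> 0"
  have "\<forall>\<^sub>F n in sequentially. \<bar>X n\<bar> < 1"
    using tendsto_rabs[OF X] by (intro order_tendstoD) auto
  then obtain N where N: "\<And>n. N \<le> n \<Longrightarrow> \<bar>X n\<bar> \<le> 1"
    unfolding eventually_sequentially by (meson less_imp_le)
  \<comment> \<open>The dominating function is valid for steps of modulus at most 1, hence the shift
    by \<open>N\<close>.\<close>
  let ?X = "\<lambda>n. X (n + N)"
  let ?q = "\<lambda>h x. exp (t * x) * ((exp (h * x) - 1) / h)"
  have "(\<lambda>n. \<integral>m. (\<Sum>i<fst m. ?q (?X n) (snd m i)) \<partial>\<mu>) \<longlonglongrightarrow> (\<integral>m. (\<Sum>i<fst m. snd m i * exp (t * snd m i)) \<partial>\<mu>)"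
  proof (rule integral_dominated_convergence[where w="\<lambda>m :: mark. expsum (t + 2) m + expsum (t - 2) m"])
    show "integrable \<mu> (\<lambda>m. expsum (t + 2) m + expsum (t - 2) m)"
      by (intro Bochner_Integration.integrable_add expsum_integrable)
    have lim: "(\<lambda>n. ?q (?X n) x) \<longlonglongrightarrow> x * exp (t * x)" for x
    proof -
      have "((\<lambda>h. exp (h * x)) has_real_derivative x * exp (0 * x)) (at 0)"
        by (auto intro!: derivative_eq_intros)
      then have "((\<lambda>h. (exp (h * x) - 1) / h) \<longlongrightarrow> x) (at 0)"
        by (simp add: DERIV_def)
      moreover have "filterlim ?X (at 0) sequentially"
        using X0 LIMSEQ_ignore_initial_segment[OF X, of N] by (auto simp: filterlim_at)
      ultimately have "(\<lambda>n. (exp (?X n * x) - 1) / ?X n) \<longlonglongrightarrow> x"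
        by (rule filterlim_compose)
      then have "(\<lambda>n. ?q (?X n) x) \<longlonglongrightarrow> exp (t * x) * x" by (intro tendsto_mult tendsto_const)
      then show ?thesis by (simp add: mult.commute)
    qed
    show "AE m in \<mu>. (\<lambda>n. \<Sum>i<fst m. ?q (?X n) (snd m i)) \<longlonglongrightarrow> (\<Sum>i<fst m. snd m i * exp (t * snd m i))"
      by (intro AE_I2 tendsto_sum lim)
    show "AE m in \<mu>. norm (\<Sum>i<fst m. ?q (?X n) (snd m i)) \<le> expsum (t + 2) m + expsum (t - 2) m" for n
    proof (intro AE_I2)
      fix m :: mark
      have "norm (\<Sum>i<fst m. ?q (?X n) (snd m i)) \<le> (\<Sum>i<fst m. norm (?q (?X n) (snd m i)))"
        by (rule norm_sum)
      also have "\<dots> \<le> (\<Sum>i<fst m. exp ((t + 2) * snd m i) + exp ((t - 2) * snd m i))"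
      proof (rule sum_mono)
        fix i
        have "norm (?q (?X n) (snd m i)) = exp (t * snd m i) * \<bar>(exp (?X n * snd m i) - 1) / ?X n\<bar>"
          by (simp add: abs_mult)
        also have "\<dots> \<le> exp (t * snd m i) * (exp (2 * snd m i) + exp (- 2 * snd m i))"
          using X0 N[of "n + N"] by (intro mult_left_mono abs_exp_quotient_le) auto
        finally show "norm (?q (?X n) (snd m i)) \<le> exp ((t + 2) * snd m i) + exp ((t - 2) * snd m i)"
          by (simp add: distrib_left exp_add[symmetric] algebra_simps)
      qed
      finally show "norm (\<Sum>i<fst m. ?q (?X n) (snd m i)) \<le> expsum (t + 2) m + expsum (t - 2) m"
        by (simp add: sum.distrib)
    qed
    show "(\<lambda>m. \<Sum>i<fst m. snd m i * exp (t * snd m i)) \<in> borel_measurable \<mu>"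
      by (rule measurable_sum_marks_real[where f="\<lambda>y. y * exp (t * y)"]) measurable
    show "(\<lambda>m. \<Sum>i<fst m. ?q (?X n) (snd m i)) \<in> borel_measurable \<mu>" for n
      by (rule measurable_sum_marks_real[where f="?q (?X n)"]) measurable
  qed
  moreover have "(\<integral>m. (\<Sum>i<fst m. ?q h (snd m i)) \<partial>\<mu>) = (\<phi> (t + h) - \<phi> t) / h" for h
  proof -
    have "(\<Sum>i<fst m. ?q h (snd m i)) = (expsum (t + h) m - expsum t m) / h" for m
      by (simp add: sum_subtractf[symmetric] sum_divide_distrib distrib_right exp_add right_diff_distrib)
    then show ?thesis by (simp add: \<phi>_def expsum_integrable)
  qed
  ultimately have "(\<lambda>n. (\<phi> (t + ?X n) - \<phi> t) / ?X n) \<longlonglongrightarrow> (\<integral>m. (\<Sum>i<fst m. snd m i * exp (t * snd m i)) \<partial>\<mu>)"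
    by simp
  then show "(\<lambda>n. (\<phi> (t + X n) - \<phi> t) / X n) \<longlonglongrightarrow> (\<integral>m. (\<Sum>i<fst m. snd m i * exp (t * snd m i)) \<partial>\<mu>)"
    by (rule LIMSEQ_offset)
qed

lemma lmgf_differentiable: "\<exists>D. ((\<lambda>t. lmgf (\<lambda>k. k) t \<mu>) has_real_derivative D) (at t)"
proof -
  have "((\<lambda>t. ln (\<phi> t)) has_real_derivative 1 / \<phi> t * (\<integral>m. (\<Sum>i<fst m. snd m i * exp (t * snd m i)) \<partial>\<mu>)) (at t)"
    by (rule DERIV_chain'[OF \<phi>_has_derivative DERIV_ln_divide, OF \<phi>_pos])
  then show ?thesis by (intro exI) (simp only: lmgf_eq)
qed

end

section \<open>The random environment\<close>

text \<open>Upper bounds come from the chords to \<open>t + 1\<close> and \<open>t - 1\<close>,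
  lower ones from midpoint convexity at \<open>t\<close>. The bound is uniform in \<open>h\<close>,
  hence an integrable dominating function when \<open>F\<close> is random with integrable
  values.\<close>

lemma convex_quotient_bounds:
  fixes F :: "real \<Rightarrow> real"
  assumes F: "convex_on UNIV F" and h: "h \<noteq> 0" "\<bar>h\<bar> \<le> 1"
  shows "\<bar>(F (t + h) - F t) / h\<bar> \<le> \<bar>F (t + 1)\<bar> + \<bar>F (t - 1)\<bar> + 2 * \<bar>F t\<bar>"
proof -
  have up: "F (t + k) - F t \<le> k * (F (t + 1) - F t)" and up': "F (t - k) - F t \<le> k * (F (t - 1) - F t)"
    and mid: "2 * F t \<le> F (t + k) + F (t - k)"
    if "0 \<le> k" "k \<le> 1" for k
  proof -
    have "(1 - 1 / 2) *\<^sub>R (t + k) + (1 / 2) *\<^sub>R (t - k) = t" by (simp add: field_simps)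
    then show "2 * F t \<le> F (t + k) + F (t - k)"
      using convex_onD[OF F, of "1/2" "t + k" "t - k"] by simp
    show "F (t + k) - F t \<le> k * (F (t + 1) - F t)"
      using convex_onD[OF F, of k t "t + 1"] that by (simp add: algebra_simps)
    show "F (t - k) - F t \<le> k * (F (t - 1) - F t)"
      using convex_onD[OF F, of k t "t - 1"] that by (simp add: algebra_simps)
  qed
  let ?k = "\<bar>h\<bar>"
  have "\<bar>F (t + h) - F t\<bar> \<le> ?k * (\<bar>F (t + 1)\<bar> + \<bar>F (t - 1)\<bar> + 2 * \<bar>F t\<bar>)"
  proof -
    have k: "0 \<le> ?k" "?k \<le> 1" using h by auto
    have "?k * (F (t + 1) - F t) \<le> ?k * (\<bar>F (t + 1)\<bar> + \<bar>F (t - 1)\<bar> + 2 * \<bar>F t\<bar>)"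
      "?k * (F (t - 1) - F t) \<le> ?k * (\<bar>F (t + 1)\<bar> + \<bar>F (t - 1)\<bar> + 2 * \<bar>F t\<bar>)"
      by (intro mult_left_mono; simp)+
    then have "\<bar>F (t + ?k) - F t\<bar> \<le> ?k * (\<bar>F (t + 1)\<bar> + \<bar>F (t - 1)\<bar> + 2 * \<bar>F t\<bar>)"
      "\<bar>F (t - ?k) - F t\<bar> \<le> ?k * (\<bar>F (t + 1)\<bar> + \<bar>F (t - 1)\<bar> + 2 * \<bar>F t\<bar>)"
      using up[OF k] up'[OF k] mid[OF k] by linarith+
    then show ?thesis by (cases "0 \<le> h") (simp_all only: abs_of_nonneg abs_of_neg not_le diff_minus_eq_add)
  qed
  then show ?thesis
    using h by (simp add: abs_divide pos_divide_le_eq mult.commute)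
qed

lemma integral_convex_differentiable:
  fixes F :: "real \<Rightarrow> 'a \<Rightarrow> real"
  assumes int: "\<And>t. integrable M (F t)"
    and conv: "AE \<omega> in M. convex_on UNIV (\<lambda>t. F t \<omega>)"
    and der: "AE \<omega> in M. \<exists>D. ((\<lambda>t. F t \<omega>) has_real_derivative D) (at t)"
  shows "\<exists>D. ((\<lambda>t. \<integral>\<omega>. F t \<omega> \<partial>M) has_real_derivative D) (at t)"
proof -
  let ?q = "\<lambda>h \<omega>. (F (t + h) \<omega> - F t \<omega>) / h"
  \<comment> \<open>A limit along one fixed sequence is measurable in \<omega>, and it equals the
    derivative wherever that exists.\<close>
  define D where "D \<omega> = lim (\<lambda>n. ?q (1 / real (Suc n)) \<omega>)" for \<omega>
  have Fm: "F s \<in> borel_measurable M" for s using int[of s] by (rule borel_measurable_integrable)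
  have qm: "?q h \<in> borel_measurable M" for h
    using Fm[of "t + h"] Fm[of t] by measurable
  have Dm: "D \<in> borel_measurable M"
    unfolding D_def by (rule borel_measurable_lim_metric) (rule qm)
  have seq: "(\<lambda>n. ?q (X n) \<omega>) \<longlonglongrightarrow> D'"
    if "((\<lambda>t. F t \<omega>) has_real_derivative D') (at t)" "\<And>n. X n \<noteq> 0" "X \<longlonglongrightarrow> 0" for X D' \<omega>
    using that unfolding DERIV_def tendsto_at_iff_sequentially comp_def by simp
  have "((\<lambda>t. \<integral>\<omega>. F t \<omega> \<partial>M) has_real_derivative (\<integral>\<omega>. D \<omega> \<partial>M)) (at t)"
    unfolding DERIV_def tendsto_at_iff_sequentially comp_def
  proof (intro allI impI)
    fix X :: "nat \<Rightarrow> real"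
    assume "\<forall>i. X i \<in> UNIV - {0}" and X: "X \<longlonglongrightarrow> 0"
    then have X0: "X n \<noteq> 0" for n by auto
    have "\<forall>\<^sub>F n in sequentially. \<bar>X n\<bar> < 1"
      using tendsto_rabs[OF X] by (intro order_tendstoD) auto
    then obtain N where N: "\<And>n. N \<le> n \<Longrightarrow> \<bar>X n\<bar> \<le> 1"
      unfolding eventually_sequentially by (meson less_imp_le)
    have "(\<lambda>n. \<integral>\<omega>. ?q (X (n + N)) \<omega> \<partial>M) \<longlonglongrightarrow> (\<integral>\<omega>. D \<omega> \<partial>M)"
    proof (rule integral_dominated_convergence[where w="\<lambda>\<omega>. \<bar>F (t + 1) \<omega>\<bar> + \<bar>F (t - 1) \<omega>\<bar> + 2 * \<bar>F t \<omega>\<bar>"])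
      show "integrable M (\<lambda>\<omega>. \<bar>F (t + 1) \<omega>\<bar> + \<bar>F (t - 1) \<omega>\<bar> + 2 * \<bar>F t \<omega>\<bar>)"
        by (intro Bochner_Integration.integrable_add integrable_mult_right integrable_abs int)
      show "AE \<omega> in M. (\<lambda>n. ?q (X (n + N)) \<omega>) \<longlonglongrightarrow> D \<omega>"
        using der
      proof eventually_elim
        case (elim \<omega>)
        then obtain D' where D': "((\<lambda>t. F t \<omega>) has_real_derivative D') (at t)" by blast
        have "(\<lambda>n. ?q (1 / real (Suc n)) \<omega>) \<longlonglongrightarrow> D'"
          by (rule seq[OF D' _ LIMSEQ_inverse_real_of_nat[unfolded inverse_eq_divide]]) simp
        then have "D \<omega> = D'" unfolding D_def by (rule limI)
        moreover have "(\<lambda>n. ?q (X (n + N)) \<omega>) \<longlonglongrightarrow> D'"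
          by (rule seq[OF D' _ LIMSEQ_ignore_initial_segment[OF X]]) (rule X0)
        ultimately show ?case by simp
      qed
      show "AE \<omega> in M. norm (?q (X (n + N)) \<omega>) \<le> \<bar>F (t + 1) \<omega>\<bar> + \<bar>F (t - 1) \<omega>\<bar> + 2 * \<bar>F t \<omega>\<bar>" for n
        using conv
      proof eventually_elim
        case (elim \<omega>)
        show ?case
          using convex_quotient_bounds[OF elim X0 N, of "n + N" t] by simp
      qed
    qed (use Dm qm in auto)
    moreover have eq: "(\<integral>\<omega>. ?q h \<omega> \<partial>M) = ((\<integral>\<omega>. F (t + h) \<omega> \<partial>M) - (\<integral>\<omega>. F t \<omega> \<partial>M)) / h" for h
      using int by simp
    ultimately have "(\<lambda>n. ((\<integral>\<omega>. F (t + X (n + N)) \<omega> \<partial>M) - (\<integral>\<omega>. F t \<omega> \<partial>M)) / X (n + N)) \<longlonglongrightarrow> (\<integral>\<omega>. D \<omega> \<partial>M)"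
      by (simp only: eq)
    then show "(\<lambda>n. ((\<integral>\<omega>. F (t + X n) \<omega> \<partial>M) - (\<integral>\<omega>. F t \<omega> \<partial>M)) / X n) \<longlonglongrightarrow> (\<integral>\<omega>. D \<omega> \<partial>M)"
      by (rule LIMSEQ_offset)
  qed
  then show ?thesis by blast
qed

lemma real_of_ereal_elog: "real_of_ereal (elog x) = ln (enn2real x)"
  by (auto simp: elog_def)

text \<open>Only an inequality: at 0 and \<infinity> the left-hand side is 0, since
  \<open>enn2real\<close> sends \<infinity> to 0 and \<open>ln 0 = 0\<close>, whereas the right-hand
  side is infinite.\<close>

lemma abs_ln_le_abs_elog: "ennreal \<bar>ln (enn2real x)\<bar> \<le> e2ennreal \<bar>elog x\<bar>"
  by (auto simp: elog_def ennreal.abs_eq[symmetric] eq_onp_def e2ennreal_ereal)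

section \<open>The model and the offspring laws of its environment\<close>

locale bwre_model =
  fixes M :: "'w measure" and \<Theta> :: "'e measure" and \<eta> :: "'e \<Rightarrow> mark measure"
    and \<xi> :: "nat \<Rightarrow> 'w \<Rightarrow> 'e" and X :: "nat list \<Rightarrow> 'w \<Rightarrow> mark"
  assumes bwre: "bwre M \<Theta> \<eta> \<xi> X"
    and log_m0_pos: "0 < (\<integral>\<omega>. real_of_ereal (elog (m0 \<eta> (\<lambda>n. \<xi> n \<omega>))) \<partial>M)"
    and offspring_ge_1: "AE \<omega> in M. 1 \<le> fst (X [] \<omega>)"
    and first_integrable: "integrable M (\<lambda>\<omega>. snd (X [] \<omega>) 0)"
    and log_m0_fun_fin: "(\<integral>\<^sup>+\<omega>. e2ennreal \<bar>elog (m0_fun \<eta> (\<lambda>n. \<xi> n \<omega>) t)\<bar> \<partial>M) < \<infinity>"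
begin

sublocale prob_space M
  using bwre unfolding bwre_def by blast

lemma stat: "stationary_ergodic M \<Theta> \<xi>"
  using bwre unfolding bwre_def by blast

lemma \<eta>_meas: "\<eta> \<in> \<Theta> \<rightarrow>\<^sub>M prob_algebra mark_space"
  using bwre unfolding bwre_def by blast

lemma X_meas: "X u \<in> M \<rightarrow>\<^sub>M mark_space"
  using bwre unfolding bwre_def by blast

lemma \<xi>_meas: "\<xi> k \<in> M \<rightarrow>\<^sub>M \<Theta>"
  using stat by (simp add: stationary_ergodic_def)

lemma \<xi>_space: "\<omega> \<in> space M \<Longrightarrow> \<xi> k \<omega> \<in> space \<Theta>"
  by (rule measurable_space[OF \<xi>_meas])

lemma \<eta>_prob: "\<theta> \<in> space \<Theta> \<Longrightarrow> prob_space (\<eta> \<theta>)"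
  and \<eta>_sets: "\<theta> \<in> space \<Theta> \<Longrightarrow> sets (\<eta> \<theta>) = sets mark_space"
  using measurable_space[OF \<eta>_meas, of \<theta>] by (auto simp: space_prob_algebra)

lemma env_seq_\<xi>: "\<omega> \<in> space M \<Longrightarrow> env_seq (\<lambda>k. \<eta> (\<xi> k \<omega>))"
  by (rule env_seq.intro) (rule \<eta>_prob[OF \<xi>_space] \<eta>_sets[OF \<xi>_space], assumption)+

lemma quenched_eq: "quenched_law \<eta> (\<lambda>k. \<xi> k \<omega>) = tree_law (\<lambda>k. \<eta> (\<xi> k \<omega>))"
  by (simp add: quenched_law_def tree_law_def)

lemma nn_integral_root:
  assumes "env_seq \<nu>" and f: "f \<in> borel_measurable mark_space"
  shows "(\<integral>\<^sup>+x. f (x []) \<partial>tree_law \<nu>) = (\<integral>\<^sup>+m. f m \<partial>\<nu> 0)"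
proof -
  interpret env_seq \<nu> by fact
  have "distr (tree_law \<nu>) (\<nu> 0) (\<lambda>x. x []) = \<nu> 0"
    unfolding tree_law_def using distr_PiM_component[of UNIV "\<lambda>u. \<nu> (length u)" "[]"]
    by (simp add: prob_space_env)
  moreover have "(\<integral>\<^sup>+m. f m \<partial>distr (tree_law \<nu>) (\<nu> 0) (\<lambda>x. x [])) = (\<integral>\<^sup>+x. f (x []) \<partial>tree_law \<nu>)"
  proof -
    have "(\<lambda>x. x []) \<in> tree_law \<nu> \<rightarrow>\<^sub>M \<nu> 0"
      unfolding measurable_cong_sets[OF sets_tree_law sets_env] by (rule measurable_component_singleton) simp
    moreover have "f \<in> borel_measurable (\<nu> 0)"
      using f unfolding measurable_cong_sets[OF sets_env refl] .
    ultimately show ?thesis by (intro nn_integral_distr) simp_all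
  qed
  ultimately show ?thesis by simp
qed

lemma measurable_sum_exp_mark: "(\<lambda>m. \<Sum>i<K (fst m). ennreal (exp (t * snd m i))) \<in> borel_measurable mark_space"
proof -
  have "(\<lambda>y. ennreal (exp (t * y))) \<in> borel_measurable borel" by measurable
  from measurable_sum_marks[OF refl this, where K=K and s=0] show ?thesis by (simp only: add_0)
qed

lemma m0_fun_eq:
  assumes "\<omega> \<in> space M"
  shows "m0_fun \<eta> (\<lambda>n. \<xi> n \<omega>) t = mgf (\<lambda>k. k) t (\<eta> (\<xi> 0 \<omega>))"
  unfolding m0_fun_def quenched_eq mgf_def
  by (rule nn_integral_root[OF env_seq_\<xi>[OF assms] measurable_sum_exp_mark])

lemma m0_eq:
  assumes "\<omega> \<in> space M"
  shows "m0 \<eta> (\<lambda>n. \<xi> n \<omega>) = mgf (\<lambda>k. k) 0 (\<eta> (\<xi> 0 \<omega>))"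
proof -
  have "m0 \<eta> (\<lambda>n. \<xi> n \<omega>) = m0_fun \<eta> (\<lambda>n. \<xi> n \<omega>) 0" by (simp add: m0_def m0_fun_def)
  then show ?thesis using m0_fun_eq[OF assms] by simp
qed

lemma measurable_nn_integral_\<eta>:
  assumes "f \<in> borel_measurable mark_space"
  shows "(\<lambda>\<theta>. \<integral>\<^sup>+m. f m \<partial>\<eta> \<theta>) \<in> borel_measurable \<Theta>"
  by (rule measurable_compose[OF measurable_prob_algebraD[OF \<eta>_meas] nn_integral_measurable_subprob_algebra[OF assms]])

lemma measurable_mgf: "(\<lambda>\<theta>. mgf K t (\<eta> \<theta>)) \<in> borel_measurable \<Theta>"
  unfolding mgf_def by (rule measurable_nn_integral_\<eta>[OF measurable_sum_exp_mark])

lemma measurable_lmgf: "(\<lambda>\<theta>. lmgf K t (\<eta> \<theta>)) \<in> borel_measurable \<Theta>"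
  unfolding lmgf_def using measurable_mgf[of K t] by measurable

text \<open>Under the annealed law the root mark has the mixture of the laws
  \<open>\<eta> (\<xi> 0)\<close> as distribution. This turns hypotheses on N and L_1 into
  statements about almost every offspring law.\<close>

lemma nn_integral_X_root:
  assumes f: "f \<in> borel_measurable mark_space"
  shows "(\<integral>\<^sup>+\<omega>. f (X [] \<omega>) \<partial>M) = (\<integral>\<^sup>+\<omega>. (\<integral>\<^sup>+m. f m \<partial>\<eta> (\<xi> 0 \<omega>)) \<partial>M)"
proof -
  have \<eta>\<xi>: "(\<lambda>\<omega>. \<eta> (\<xi> 0 \<omega>)) \<in> M \<rightarrow>\<^sub>M subprob_algebra mark_space"
    by (rule measurable_compose[OF \<xi>_meas measurable_prob_algebraD[OF \<eta>_meas]])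
  have M0: "space M \<noteq> {}" by (rule not_empty)
  have "distr M mark_space (X []) = M \<bind> (\<lambda>\<omega>. \<eta> (\<xi> 0 \<omega>))"
  proof (rule measure_eqI)
    show "sets (distr M mark_space (X [])) = sets (M \<bind> (\<lambda>\<omega>. \<eta> (\<xi> 0 \<omega>)))"
      using \<eta>_sets[OF \<xi>_space] M0 by (subst sets_bind[where N=mark_space]) auto
    fix C assume "C \<in> sets (distr M mark_space (X []))"
    then have C: "C \<in> sets mark_space" by simp
    let ?B = "{x \<in> space tree_space. x [] \<in> C}"
    have B: "?B \<in> sets tree_space" using C by measurable
    have "emeasure (distr M mark_space (X [])) C =
        emeasure M {\<omega> \<in> space M. (\<lambda>n. \<xi> n \<omega>) \<in> space (\<Pi>\<^sub>M n\<in>UNIV. \<Theta>) \<and> (\<lambda>u. X u \<omega>) \<in> ?B}"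
      using \<xi>_space by (subst emeasure_distr[OF X_meas C])
        (auto intro!: arg_cong[where f="emeasure M"] simp: space_PiM)
    also have "\<dots> = (\<integral>\<^sup>+\<omega>. indicator (space (\<Pi>\<^sub>M n\<in>UNIV. \<Theta>)) (\<lambda>n. \<xi> n \<omega>) *
        emeasure (quenched_law \<eta> (\<lambda>n. \<xi> n \<omega>)) ?B \<partial>M)"
      using bwre B sets.top[of "\<Pi>\<^sub>M n\<in>UNIV. \<Theta>"] unfolding bwre_def by blast
    also have "\<dots> = (\<integral>\<^sup>+\<omega>. emeasure (\<eta> (\<xi> 0 \<omega>)) C \<partial>M)"
    proof (rule nn_integral_cong)
      fix \<omega> assume \<omega>: "\<omega> \<in> space M"
      interpret E: env_seq "\<lambda>k. \<eta> (\<xi> k \<omega>)" by (rule env_seq_\<xi>[OF \<omega>])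
      have "emeasure (tree_law (\<lambda>k. \<eta> (\<xi> k \<omega>))) {x. \<forall>u\<in>{[]}. x u \<in> C} = (\<Prod>u\<in>{[]}. emeasure (\<eta> (\<xi> (length u) \<omega>)) C)"
        using E.emeasure_tree_law[of "{[]}" "\<lambda>_. C"] C by simp
      then show "indicator (space (\<Pi>\<^sub>M n\<in>UNIV. \<Theta>)) (\<lambda>n. \<xi> n \<omega>) *
        emeasure (quenched_law \<eta> (\<lambda>n. \<xi> n \<omega>)) ?B = emeasure (\<eta> (\<xi> 0 \<omega>)) C"
        using \<xi>_space[OF \<omega>] by (simp add: quenched_eq space_PiM PiE_iff)
    qed
    also have "\<dots> = emeasure (M \<bind> (\<lambda>\<omega>. \<eta> (\<xi> 0 \<omega>))) C"
      by (rule emeasure_bind[OF M0 \<eta>\<xi> C, symmetric])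
    finally show "emeasure (distr M mark_space (X [])) C = emeasure (M \<bind> (\<lambda>\<omega>. \<eta> (\<xi> 0 \<omega>))) C" .
  qed
  then have "(\<integral>\<^sup>+m. f m \<partial>distr M mark_space (X [])) = (\<integral>\<^sup>+m. f m \<partial>(M \<bind> (\<lambda>\<omega>. \<eta> (\<xi> 0 \<omega>))))" by simp
  moreover have "f \<in> borel_measurable (distr M mark_space (X []))" using f by simp
  ultimately show ?thesis
    by (simp only: nn_integral_distr[OF X_meas] nn_integral_bind[OF f \<eta>\<xi>])
qed

lemma first_displacement_fin: "(\<integral>\<^sup>+\<omega>. (\<integral>\<^sup>+m. ennreal \<bar>snd m 0\<bar> \<partial>\<eta> (\<xi> 0 \<omega>)) \<partial>M) < \<infinity>"
proof -
  have "(\<lambda>m. ennreal \<bar>snd m 0\<bar>) \<in> borel_measurable mark_space"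
    using measurable_snd_mark[of 0] by measurable
  from nn_integral_X_root[OF this]
  have "(\<integral>\<^sup>+\<omega>. (\<integral>\<^sup>+m. ennreal \<bar>snd m 0\<bar> \<partial>\<eta> (\<xi> 0 \<omega>)) \<partial>M) = (\<integral>\<^sup>+\<omega>. ennreal \<bar>snd (X [] \<omega>) 0\<bar> \<partial>M)"
    by (rule sym)
  also have "\<dots> < \<infinity>"
    using first_integrable unfolding integrable_iff_bounded real_norm_def by blast
  finally show ?thesis .
qed

text \<open>\<open>offspring_law\<close> rewritten with countably many integrals, so that it defines
  a measurable set of states: finiteness at the integers implies finiteness at every real exponent
  in between.\<close>

definition regular :: "'e \<Rightarrow> bool" where
  "regular \<theta> \<longleftrightarrow> (\<integral>\<^sup>+m. indicator {m. fst m = 0} m \<partial>\<eta> \<theta>) = 0 \<and>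
    (\<integral>\<^sup>+m. ennreal \<bar>snd m 0\<bar> \<partial>\<eta> \<theta>) < \<infinity> \<and> (\<forall>n::nat. mgf (\<lambda>k. k) (real n) (\<eta> \<theta>) < \<infinity> \<and> mgf (\<lambda>k. k) (- real n) (\<eta> \<theta>) < \<infinity>)"

lemma offspring_law_regular:
  assumes \<theta>: "\<theta> \<in> space \<Theta>" and reg: "regular \<theta>"
  shows "offspring_law (\<eta> \<theta>)"
proof -
  interpret N: prob_space "\<eta> \<theta>" by (rule \<eta>_prob[OF \<theta>])
  have "{m \<in> space mark_space. fst m = 0} \<in> sets mark_space" by measurable
  then have Z: "{m. fst m = 0} \<in> sets (\<eta> \<theta>)" using \<eta>_sets[OF \<theta>] by simp
  show ?thesis
  proof unfold_locales
    show "sets (\<eta> \<theta>) = sets mark_space" by (rule \<eta>_sets[OF \<theta>])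
    have "AE m in \<eta> \<theta>. m \<notin> {m. fst m = 0}"
      using reg Z by (intro AE_not_in null_setsI) (auto simp: regular_def)
    then show "AE m in \<eta> \<theta>. 1 \<le> fst m" by eventually_elim auto
    have "(\<lambda>m. snd m 0) \<in> borel_measurable (\<eta> \<theta>)"
      unfolding measurable_cong_sets[OF \<eta>_sets[OF \<theta>] refl] by (rule measurable_snd_mark)
    then show "integrable (\<eta> \<theta>) (\<lambda>m. snd m 0)"
    proof (rule integrableI_bounded)
      show "(\<integral>\<^sup>+m. ennreal (norm (snd m 0)) \<partial>\<eta> \<theta>) < \<infinity>"
        using reg unfolding regular_def real_norm_def by blast
    qed
    fix t :: real
    obtain n :: nat where n: "\<bar>t\<bar> \<le> n" using real_arch_simple by blast
    have m: "(\<lambda>m. \<Sum>i<fst m. ennreal (exp (t * snd m i))) \<in> borel_measurable (\<eta> \<theta>)" for t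
      unfolding measurable_cong_sets[OF \<eta>_sets[OF \<theta>] refl] by (rule measurable_sum_exp_mark)
    have "mgf (\<lambda>k. k) t (\<eta> \<theta>) \<le> (\<integral>\<^sup>+m. (\<Sum>i<fst m. ennreal (exp (real n * snd m i))) +
        (\<Sum>i<fst m. ennreal (exp (- real n * snd m i))) \<partial>\<eta> \<theta>)"
      unfolding mgf_def sum.distrib[symmetric]
      by (intro nn_integral_mono sum_mono)
         (simp add: ennreal_plus[symmetric] exp_le_exp_add_exp[OF n, simplified] del: ennreal_plus)
    also have "\<dots> = mgf (\<lambda>k. k) (real n) (\<eta> \<theta>) + mgf (\<lambda>k. k) (- real n) (\<eta> \<theta>)"
      unfolding mgf_def by (rule nn_integral_add[OF m m])
    also have "\<dots> < \<infinity>"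
    proof -
      have "mgf (\<lambda>k. k) (real n) (\<eta> \<theta>) < \<infinity>" "mgf (\<lambda>k. k) (- real n) (\<eta> \<theta>) < \<infinity>"
        using reg unfolding regular_def by blast+
      then show ?thesis by simp
    qed
    finally show "mgf (\<lambda>k. k) t (\<eta> \<theta>) < \<infinity>" .
  qed
qed

lemma mgf_finite_AE: "AE \<omega> in M. mgf (\<lambda>k. k) t (\<eta> (\<xi> 0 \<omega>)) < \<infinity>"
proof -
  let ?f = "\<lambda>\<omega>. e2ennreal \<bar>elog (mgf (\<lambda>k. k) t (\<eta> (\<xi> 0 \<omega>)))\<bar>"
  have mm: "(\<lambda>\<omega>. mgf (\<lambda>k. k) t (\<eta> (\<xi> 0 \<omega>))) \<in> borel_measurable M"
    by (rule measurable_compose[OF \<xi>_meas measurable_mgf])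
  have "?f \<in> borel_measurable M"
    unfolding elog_def using mm by measurable
  moreover have "(\<integral>\<^sup>+\<omega>. ?f \<omega> \<partial>M) \<noteq> \<infinity>"
  proof -
    have "(\<integral>\<^sup>+\<omega>. ?f \<omega> \<partial>M) = (\<integral>\<^sup>+\<omega>. e2ennreal \<bar>elog (m0_fun \<eta> (\<lambda>n. \<xi> n \<omega>) t)\<bar> \<partial>M)"
      by (intro nn_integral_cong) (simp add: m0_fun_eq)
    then show ?thesis using log_m0_fun_fin[of t] by auto
  qed
  ultimately have "AE \<omega> in M. ?f \<omega> \<noteq> \<infinity>"
    by (rule nn_integral_PInf_AE)
  then show ?thesis
    by eventually_elim (auto simp: elog_def less_top[symmetric] split: if_splits)
qed

lemma regular_sets: "{\<theta> \<in> space \<Theta>. regular \<theta>} \<in> sets \<Theta>"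
proof -
  define z where "z \<theta> = (\<integral>\<^sup>+m. indicator {m. fst m = 0} m \<partial>\<eta> \<theta>)" for \<theta>
  define a where "a \<theta> = (\<integral>\<^sup>+m. ennreal \<bar>snd m 0\<bar> \<partial>\<eta> \<theta>)" for \<theta>
  define f g where "f n \<theta> = mgf (\<lambda>k. k) (real n) (\<eta> \<theta>)" and "g n \<theta> = mgf (\<lambda>k. k) (- real n) (\<eta> \<theta>)" for n \<theta>
  have "{m \<in> space mark_space. fst m = 0} \<in> sets mark_space" by measurable
  then have "(indicator {m. fst m = 0} :: mark \<Rightarrow> ennreal) \<in> borel_measurable mark_space"
    by (intro borel_measurable_indicator) simp
  from measurable_nn_integral_\<eta>[OF this]
  have z: "z \<in> borel_measurable \<Theta>" unfolding z_def .
  have "(\<lambda>m. ennreal \<bar>snd m 0\<bar>) \<in> borel_measurable mark_space"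
    using measurable_snd_mark[of 0] by measurable
  from measurable_nn_integral_\<eta>[OF this]
  have a: "a \<in> borel_measurable \<Theta>" unfolding a_def .
  have f: "f n \<in> borel_measurable \<Theta>" and g: "g n \<in> borel_measurable \<Theta>" for n
    unfolding f_def g_def by (rule measurable_mgf)+
  note [measurable] = z a f g
  have "{\<theta> \<in> space \<Theta>. z \<theta> = 0 \<and> a \<theta> < \<infinity> \<and> (\<forall>n. f n \<theta> < \<infinity> \<and> g n \<theta> < \<infinity>)} \<in> sets \<Theta>"
    by measurable
  then show ?thesis unfolding regular_def z_def a_def f_def g_def .
qed

lemma regular_AE: "AE \<omega> in M. \<forall>k. regular (\<xi> k \<omega>)"
proof (rule stationary_AE[OF stat regular_sets])
  have "{m \<in> space mark_space. fst m = 0} \<in> sets mark_space" by measurable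
  then have i: "(indicator {m. fst m = 0} :: mark \<Rightarrow> ennreal) \<in> borel_measurable mark_space"
    by (intro borel_measurable_indicator) simp
  have a: "(\<lambda>m. ennreal \<bar>snd m 0\<bar>) \<in> borel_measurable mark_space"
    using measurable_snd_mark[of 0] by measurable
  have "(\<integral>\<^sup>+\<omega>. indicator {m. fst m = 0} (X [] \<omega>) \<partial>M) = (\<integral>\<^sup>+\<omega>. 0 \<partial>M)"
    using offspring_ge_1 by (intro nn_integral_cong_AE) (auto elim!: eventually_mono split: split_indicator)
  then have "(\<integral>\<^sup>+\<omega>. (\<integral>\<^sup>+m. indicator {m. fst m = 0} m \<partial>\<eta> (\<xi> 0 \<omega>)) \<partial>M) = 0"
    by (simp add: nn_integral_X_root[OF i])
  then have 1: "AE \<omega> in M. (\<integral>\<^sup>+m. indicator {m. fst m = 0} m \<partial>\<eta> (\<xi> 0 \<omega>)) = 0"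
    by (subst (asm) nn_integral_0_iff_AE) (rule measurable_compose[OF \<xi>_meas measurable_nn_integral_\<eta>[OF i]])
  have 2: "AE \<omega> in M. (\<integral>\<^sup>+m. ennreal \<bar>snd m 0\<bar> \<partial>\<eta> (\<xi> 0 \<omega>)) \<noteq> \<infinity>"
    by (rule nn_integral_PInf_AE[OF measurable_compose[OF \<xi>_meas measurable_nn_integral_\<eta>[OF a]]])
       (use first_displacement_fin in simp)
  have 3: "AE \<omega> in M. \<forall>n::nat. mgf (\<lambda>k. k) (real n) (\<eta> (\<xi> 0 \<omega>)) < \<infinity> \<and> mgf (\<lambda>k. k) (- real n) (\<eta> (\<xi> 0 \<omega>)) < \<infinity>"
    unfolding AE_all_countable using mgf_finite_AE by simp
  show "AE \<omega> in M. regular (\<xi> 0 \<omega>)"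
    using 1 2 3 by eventually_elim (simp add: regular_def less_top[symmetric])
qed

lemma offspring_law_AE: "AE \<omega> in M. \<forall>k. offspring_law (\<eta> (\<xi> k \<omega>))"
  using regular_AE AE_space
proof eventually_elim
  case (elim \<omega>)
  show ?case using offspring_law_regular[OF \<xi>_space[OF elim(2)]] elim(1) by blast
qed

section \<open>The function \<Lambda> and its truncations\<close>

abbreviation "\<Lambda> \<equiv> Lam M \<eta> \<xi>"

abbreviation F :: "real \<Rightarrow> 'w \<Rightarrow> real" where "F t \<omega> \<equiv> lmgf (\<lambda>k. k) t (\<eta> (\<xi> 0 \<omega>))"

lemma F_measurable: "(\<lambda>\<omega>. lmgf K t (\<eta> (\<xi> 0 \<omega>))) \<in> borel_measurable M"
  by (rule measurable_compose[OF \<xi>_meas measurable_lmgf])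

lemma F_integrable: "integrable M (F t)"
proof (rule integrableI_bounded[OF F_measurable])
  have "(\<integral>\<^sup>+\<omega>. ennreal (norm (F t \<omega>)) \<partial>M) \<le> (\<integral>\<^sup>+\<omega>. e2ennreal \<bar>elog (m0_fun \<eta> (\<lambda>n. \<xi> n \<omega>) t)\<bar> \<partial>M)"
    by (intro nn_integral_mono) (simp add: m0_fun_eq lmgf_def abs_ln_le_abs_elog)
  also note log_m0_fun_fin
  finally show "(\<integral>\<^sup>+\<omega>. ennreal (norm (F t \<omega>)) \<partial>M) < \<infinity>" .
qed

lemma Lam_eq: "\<Lambda> t = (\<integral>\<omega>. F t \<omega> \<partial>M)"
  unfolding Lam_def by (intro Bochner_Integration.integral_cong) (simp_all add: m0_fun_eq real_of_ereal_elog lmgf_def)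

lemma Lam_0_pos: "0 < \<Lambda> 0"
proof -
  have "(\<integral>\<omega>. real_of_ereal (elog (m0 \<eta> (\<lambda>n. \<xi> n \<omega>))) \<partial>M) = \<Lambda> 0"
    unfolding Lam_eq by (intro Bochner_Integration.integral_cong) (simp_all add: m0_eq real_of_ereal_elog lmgf_def)
  then show ?thesis using log_m0_pos by simp
qed

lemma Lam_convex: "convex_on UNIV \<Lambda>"
proof (rule convex_onI)
  fix w s t :: real assume w: "0 < w" "w < 1"
  have "\<Lambda> ((1 - w) *\<^sub>R s + w *\<^sub>R t) \<le> (\<integral>\<omega>. (1 - w) * F s \<omega> + w * F t \<omega> \<partial>M)"
    unfolding Lam_eq
  proof (rule integral_mono_AE)
    show "AE \<omega> in M. F ((1 - w) *\<^sub>R s + w *\<^sub>R t) \<omega> \<le> (1 - w) * F s \<omega> + w * F t \<omega>"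
      using offspring_law_AE
    proof eventually_elim
      case (elim \<omega>)
      then interpret N: offspring_law "\<eta> (\<xi> 0 \<omega>)" by simp
      show ?case using convex_onD[OF N.convex_lmgf, of w s t] w by simp
    qed
  qed (intro F_integrable Bochner_Integration.integrable_add integrable_mult_right)+
  also have "\<dots> = (1 - w) * \<Lambda> s + w * \<Lambda> t"
    by (simp add: Lam_eq F_integrable)
  finally show "\<Lambda> ((1 - w) *\<^sub>R s + w *\<^sub>R t) \<le> (1 - w) * \<Lambda> s + w * \<Lambda> t" .
qed simp

lemma Lam_DERIV: "(\<Lambda> has_real_derivative deriv \<Lambda> t) (at t)"
proof -
  have "\<exists>D. ((\<lambda>t. \<integral>\<omega>. F t \<omega> \<partial>M) has_real_derivative D) (at t)"
  proof (rule integral_convex_differentiable[OF F_integrable])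
    show "AE \<omega> in M. convex_on UNIV (\<lambda>t. F t \<omega>)"
      using offspring_law_AE by eventually_elim (rule offspring_law.convex_lmgf, erule spec)
    show "AE \<omega> in M. \<exists>D. ((\<lambda>t. F t \<omega>) has_real_derivative D) (at t)"
      using offspring_law_AE by eventually_elim (rule offspring_law.lmgf_differentiable, erule spec)
  qed
  then show ?thesis
    unfolding Lam_eq[abs_def] by (metis DERIV_imp_deriv)
qed

lemma integrable_drift: "integrable M (\<lambda>\<omega>. \<integral>m. snd m 0 \<partial>\<eta> (\<xi> 0 \<omega>))"
proof (rule integrableI_bounded)
  show "(\<lambda>\<omega>. \<integral>m. snd m 0 \<partial>\<eta> (\<xi> 0 \<omega>)) \<in> borel_measurable M"
    by (rule measurable_compose[OF measurable_compose[OF \<xi>_meas measurable_prob_algebraD[OF \<eta>_meas]]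
          integral_measurable_subprob_algebra[OF measurable_snd_mark]])
  have "(\<integral>\<^sup>+\<omega>. ennreal (norm (\<integral>m. snd m 0 \<partial>\<eta> (\<xi> 0 \<omega>))) \<partial>M) \<le>
      (\<integral>\<^sup>+\<omega>. (\<integral>\<^sup>+m. ennreal \<bar>snd m 0\<bar> \<partial>\<eta> (\<xi> 0 \<omega>)) \<partial>M)"
  proof (rule nn_integral_mono_AE, use offspring_law_AE in eventually_elim)
    case (elim \<omega>)
    then interpret N: offspring_law "\<eta> (\<xi> 0 \<omega>)" by simp
    show ?case using integral_norm_bound_ennreal[OF N.first_int] by simp
  qed
  also note first_displacement_fin
  finally show "(\<integral>\<^sup>+\<omega>. ennreal (norm (\<integral>m. snd m 0 \<partial>\<eta> (\<xi> 0 \<omega>))) \<partial>M) < \<infinity>" .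
qed

lemma lmgf_trunc_bound_AE:
  "AE \<omega> in M. \<bar>lmgf (min (Suc c)) t (\<eta> (\<xi> 0 \<omega>))\<bar> \<le> \<bar>F t \<omega>\<bar> + \<bar>t * (\<integral>m. snd m 0 \<partial>\<eta> (\<xi> 0 \<omega>))\<bar>"
  using offspring_law_AE
proof eventually_elim
  case (elim \<omega>)
  then interpret N: offspring_law "\<eta> (\<xi> 0 \<omega>)" by simp
  show ?case using N.lmgf_trunc_le[of "Suc c" t] N.lmgf_trunc_ge[of "Suc c" t] by linarith
qed

lemma bound_integrable: "integrable M (\<lambda>\<omega>. \<bar>F t \<omega>\<bar> + \<bar>t * (\<integral>m. snd m 0 \<partial>\<eta> (\<xi> 0 \<omega>))\<bar>)"
  by (rule Bochner_Integration.integrable_add[OF integrable_abs[OF F_integrable] integrable_abs[OF integrable_mult_right[OF integrable_drift]]])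

lemma lmgf_trunc_integrable: "integrable M (\<lambda>\<omega>. lmgf (min (Suc c)) t (\<eta> (\<xi> 0 \<omega>)))"
proof (rule Bochner_Integration.integrable_bound[OF bound_integrable[of t] F_measurable])
  show "AE \<omega> in M. norm (lmgf (min (Suc c)) t (\<eta> (\<xi> 0 \<omega>))) \<le>
      norm (\<bar>F t \<omega>\<bar> + \<bar>t * (\<integral>m. snd m 0 \<partial>\<eta> (\<xi> 0 \<omega>))\<bar>)"
    using lmgf_trunc_bound_AE[of c t]
    by eventually_elim (simp only: real_norm_def abs_of_nonneg add_nonneg_nonneg abs_ge_zero)
qed

text \<open>The dominating function combines the full logarithm with the drift of the first child,
  whose integrability comes from that of L_1. It allows \<open>c\<close> to be fixed before the
  environment is chosen.\<close>

lemma Lam_trunc_tendsto: "(\<lambda>c. \<integral>\<omega>. lmgf (min (Suc c)) t (\<eta> (\<xi> 0 \<omega>)) \<partial>M) \<longlonglongrightarrow> \<Lambda> t"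
  unfolding Lam_eq
proof (rule integral_dominated_convergence[OF F_measurable F_measurable bound_integrable[of t]])
  show "AE \<omega> in M. (\<lambda>c. lmgf (min (Suc c)) t (\<eta> (\<xi> 0 \<omega>))) \<longlonglongrightarrow> F t \<omega>"
    using offspring_law_AE by eventually_elim (rule offspring_law.lmgf_trunc_tendsto, erule spec)
  show "AE \<omega> in M. norm (lmgf (min (Suc c)) t (\<eta> (\<xi> 0 \<omega>))) \<le> \<bar>F t \<omega>\<bar> + \<bar>t * (\<integral>m. snd m 0 \<partial>\<eta> (\<xi> 0 \<omega>))\<bar>" for c
    using lmgf_trunc_bound_AE[of c t] by (simp only: real_norm_def)
qed

section \<open>Almost sure bounds under the quenched law\<close>

abbreviation \<nu> :: "'w \<Rightarrow> nat \<Rightarrow> mark measure" where "\<nu> \<omega> \<equiv> (\<lambda>k. \<eta> (\<xi> k \<omega>))"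

text \<open>In the joint law take all environments for the first event: the exceptional set of
  \<open>P\<close> then has annealed probability equal to the mean of its quenched probabilities,
  which vanish. The formula covers measurable events only, whence the assumption on
  \<open>P\<close>.\<close>

lemma quenched_AE_imp_AE:
  assumes P: "{x. P x} \<in> sets tree_space"
    and AE: "AE \<omega> in M. AE x in tree_law (\<nu> \<omega>). P x"
  shows "AE \<omega> in M. P (\<lambda>u. X u \<omega>)"
proof -
  have B: "{x. \<not> P x} \<in> sets tree_space"
    using sets.compl_sets[OF P] by (simp add: Compl_eq_Diff_UNIV[symmetric] Collect_neg_eq)
  have Xm: "(\<lambda>\<omega> u. X u \<omega>) \<in> M \<rightarrow>\<^sub>M tree_space"
    by (intro measurable_PiM_single' X_meas) auto
  have "emeasure M {\<omega> \<in> space M. (\<lambda>n. \<xi> n \<omega>) \<in> space (\<Pi>\<^sub>M n\<in>UNIV. \<Theta>) \<and> (\<lambda>u. X u \<omega>) \<in> {x. \<not> P x}} =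
      (\<integral>\<^sup>+\<omega>. indicator (space (\<Pi>\<^sub>M n\<in>UNIV. \<Theta>)) (\<lambda>n. \<xi> n \<omega>) *
        emeasure (quenched_law \<eta> (\<lambda>n. \<xi> n \<omega>)) {x. \<not> P x} \<partial>M)"
    using bwre B sets.top[of "\<Pi>\<^sub>M n\<in>UNIV. \<Theta>"] unfolding bwre_def by blast
  also have "\<dots> = (\<integral>\<^sup>+\<omega>. 0 \<partial>M)"
  proof (rule nn_integral_cong_AE, use AE AE_space in eventually_elim)
    case (elim \<omega>)
    interpret E: env_seq "\<nu> \<omega>" by (rule env_seq_\<xi>[OF elim(2)])
    have "emeasure (tree_law (\<nu> \<omega>)) {x \<in> space (tree_law (\<nu> \<omega>)). \<not> P x} = 0"
      using elim(1) B by (subst (asm) AE_iff_measurable[OF _ refl]) simp_all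
    then show ?case by (simp add: quenched_eq)
  qed
  finally have "emeasure M {\<omega> \<in> space M. (\<lambda>n. \<xi> n \<omega>) \<in> space (\<Pi>\<^sub>M n\<in>UNIV. \<Theta>) \<and> (\<lambda>u. X u \<omega>) \<in> {x. \<not> P x}} = 0"
    by simp
  moreover have "{\<omega> \<in> space M. (\<lambda>n. \<xi> n \<omega>) \<in> space (\<Pi>\<^sub>M n\<in>UNIV. \<Theta>) \<and> (\<lambda>u. X u \<omega>) \<in> {x. \<not> P x}} =
      {\<omega> \<in> space M. \<not> P (\<lambda>u. X u \<omega>)}"
    using \<xi>_space by (auto simp: space_PiM)
  moreover have "{\<omega> \<in> space M. \<not> P (\<lambda>u. X u \<omega>)} \<in> sets M"
    using measurable_sets[OF Xm B] by (simp add: vimage_def Int_def conj_commute)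
  ultimately show ?thesis
    by (intro AE_I[of _ _ "{\<omega> \<in> space M. \<not> P (\<lambda>u. X u \<omega>)}"]) auto
qed

lemma birkhoff_lmgf:
  assumes "integrable M (\<lambda>\<omega>. lmgf K t (\<eta> (\<xi> 0 \<omega>)))"
  shows "AE \<omega> in M. \<forall>\<delta>>0::real. \<exists>C. \<forall>n. \<bar>(\<Sum>k<n. lmgf K t (\<nu> \<omega> k)) -
    n * (\<integral>\<omega>. lmgf K t (\<eta> (\<xi> 0 \<omega>)) \<partial>M)\<bar> \<le> \<delta> * n + C"
  by (rule birkhoff_env[OF prob_space_axioms stat measurable_lmgf assms])

lemma birkhoff_F:
  "AE \<omega> in M. \<forall>\<delta>>0::real. \<exists>C. \<forall>n. \<bar>(\<Sum>k<n. lmgf (\<lambda>k. k) t (\<nu> \<omega> k)) - n * \<Lambda> t\<bar> \<le> \<delta> * n + C"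
  using birkhoff_lmgf[OF F_integrable] unfolding Lam_eq .

lemma exp_sum_upper_quenched:
  assumes \<delta>: "0 < \<delta>"
  shows "AE \<omega> in M. AE x in tree_law (\<nu> \<omega>). \<forall>\<^sub>F n in sequentially.
    (\<Sum>u\<in>generation x n. exp (t * position x u)) \<le> exp (n * (\<Lambda> t + \<delta>))"
  using birkhoff_F[of t] offspring_law_AE AE_space
proof eventually_elim
  case (elim \<omega>)
  interpret E: env_seq "\<nu> \<omega>" by (rule env_seq_\<xi>[OF elim(3)])
  obtain C where C: "\<And>n. \<bar>(\<Sum>k<n. lmgf (\<lambda>k. k) t (\<nu> \<omega> k)) - n * \<Lambda> t\<bar> \<le> \<delta> / 2 * n + C"
    using elim(1) \<delta> by (meson half_gt_zero)
  have "AE x in tree_law (\<nu> \<omega>). \<forall>\<^sub>F n in sequentially.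
    (\<Sum>u\<in>generation x n. exp (t * position x u)) \<le> exp (n * (\<Lambda> t + 2 * (\<delta> / 2)))"
  proof (rule E.exp_sum_upper_AE[where b="\<lambda>k. lmgf (\<lambda>k. k) t (\<nu> \<omega> k)" and C=C])
    fix k
    have "offspring_law (\<nu> \<omega> k)" using elim(2) by blast
    then show "mgf (\<lambda>k. k) t (\<nu> \<omega> k) \<le> ennreal (exp (lmgf (\<lambda>k. k) t (\<nu> \<omega> k)))"
      by (simp add: offspring_law.mgf_eq_exp_lmgf)
  next
    fix n
    show "(\<Sum>k<n. lmgf (\<lambda>k. k) t (\<nu> \<omega> k)) \<le> n * (\<Lambda> t + \<delta> / 2) + C"
      using C[of n] by (simp add: abs_le_iff algebra_simps)
  qed (use \<delta> in simp)
  then show ?case by simp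
qed

text \<open>A linear bound on all positions: a particle beyond it would by itself exceed the bound
  on the exponential sum at \<open>t = 1\<close> or \<open>t = -1\<close>, each with slack
  1.\<close>

definition "radius = max 0 (max (\<Lambda> 1 + 1) (\<Lambda> (- 1) + 1))"

lemma radius_quenched:
  "AE \<omega> in M. AE x in tree_law (\<nu> \<omega>). \<forall>\<^sub>F n in sequentially. \<forall>u\<in>generation x n. \<bar>position x u\<bar> \<le> radius * n"
  using exp_sum_upper_quenched[OF zero_less_one, of 1] exp_sum_upper_quenched[OF zero_less_one, of "- 1"]
proof eventually_elim
  case (elim \<omega>)
  show ?case using elim
  proof eventually_elim
    case (elim x)
    show ?case using elim
    proof eventually_elim
      case (elim n)
      have *: "t * position x u \<le> radius * n"
        if u: "u \<in> generation x n" and t: "(\<Sum>u\<in>generation x n. exp (t * position x u)) \<le> exp (n * (\<Lambda> t + 1))"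
          and "\<Lambda> t + 1 \<le> radius" for t u
      proof -
        have "exp (t * position x u) \<le> (\<Sum>u\<in>generation x n. exp (t * position x u))"
          using u by (intro member_le_sum) auto
        also note t
        finally have "t * position x u \<le> n * (\<Lambda> t + 1)" by simp
        also have "\<dots> \<le> n * radius" using that(3) by (intro mult_left_mono) auto
        finally show ?thesis by (simp add: mult.commute)
      qed
      show ?case
      proof
        fix u assume u: "u \<in> generation x n"
        have "\<Lambda> 1 + 1 \<le> radius" "\<Lambda> (- 1) + 1 \<le> radius" by (auto simp: radius_def)
        then show "\<bar>position x u\<bar> \<le> radius * n"
          using *[OF u elim(1)] *[OF u elim(2)] by (simp add: abs_le_iff)
      qed
    qed
  qed
qed

text \<open>Logarithm of the bound in \<open>mean_inverse_offspring_le\<close>. Its Birkhoff sums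
  control the harmonic mean of the population.\<close>

definition branch_log :: "'e \<Rightarrow> real" where
  "branch_log \<theta> = ln (1 - measure (\<eta> \<theta>) {m. 2 \<le> fst m} / 2)"

lemma branch_set: "{m. 2 \<le> fst m} \<in> sets mark_space"
proof -
  have "{m \<in> space mark_space. 2 \<le> fst m} \<in> sets mark_space" by measurable
  then show ?thesis by simp
qed

lemma branch_log_measurable: "branch_log \<in> borel_measurable \<Theta>"
proof -
  have "(\<lambda>\<theta>. emeasure (\<eta> \<theta>) {m. 2 \<le> fst m}) \<in> borel_measurable \<Theta>"
    by (rule measurable_compose[OF measurable_prob_algebraD[OF \<eta>_meas] measurable_emeasure_subprob_algebra[OF branch_set]])
  then show ?thesis unfolding branch_log_def measure_def by measurable
qed

lemma branch_log_bounds: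
  assumes "\<theta> \<in> space \<Theta>"
  shows "branch_log \<theta> \<le> 0" "\<bar>branch_log \<theta>\<bar> \<le> ln 2"
proof -
  interpret N: prob_space "\<eta> \<theta>" by (rule \<eta>_prob[OF assms])
  let ?q = "1 - measure (\<eta> \<theta>) {m. 2 \<le> fst m} / 2"
  have q: "1 / 2 \<le> ?q" "?q \<le> 1" using N.prob_le_1[of "{m. 2 \<le> fst m}"] by (auto simp: measure_nonneg)
  have "ln ?q \<le> ln 1" by (rule ln_mono) (use q in linarith)+
  then show "branch_log \<theta> \<le> 0" by (simp add: branch_log_def)
  moreover have "ln (1 / 2) \<le> branch_log \<theta>"
    unfolding branch_log_def using q(1) by (intro ln_mono) auto
  ultimately show "\<bar>branch_log \<theta>\<bar> \<le> ln 2" by (simp add: ln_div)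
qed

lemma branch_log_integrable: "integrable M (\<lambda>\<omega>. branch_log (\<xi> 0 \<omega>))"
proof (rule integrable_const_bound)
  show "AE \<omega> in M. norm (branch_log (\<xi> 0 \<omega>)) \<le> ln 2"
    using branch_log_bounds(2)[OF \<xi>_space] by (intro AE_I2) simp
  show "(\<lambda>\<omega>. branch_log (\<xi> 0 \<omega>)) \<in> borel_measurable M"
    by (rule measurable_compose[OF \<xi>_meas branch_log_measurable])
qed

text \<open>A vanishing mean would force \<open>branch_log\<close> to vanish almost surely, so that
  almost no environment allowed two children. Then m_0 would be at most 1 and
  \<open>\<Lambda> 0\<close> at most 0, against supercriticality.\<close>

lemma mean_branch_log_neg: "(\<integral>\<omega>. branch_log (\<xi> 0 \<omega>) \<partial>M) < 0"
proof (rule ccontr)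
  assume "\<not> ?thesis"
  moreover have "(\<integral>\<omega>. branch_log (\<xi> 0 \<omega>) \<partial>M) \<le> (\<integral>\<omega>. 0 \<partial>M)"
    by (rule integral_mono[OF branch_log_integrable]) (use branch_log_bounds(1)[OF \<xi>_space] in auto)
  ultimately have "(\<integral>\<omega>. - branch_log (\<xi> 0 \<omega>) \<partial>M) = 0"
    by simp
  then have "AE \<omega> in M. - branch_log (\<xi> 0 \<omega>) = 0"
    using branch_log_bounds(1)[OF \<xi>_space] branch_log_integrable
    by (subst (asm) integral_nonneg_eq_0_iff_AE) (auto intro!: AE_I2)
  then have "AE \<omega> in M. F 0 \<omega> \<le> 0"
    using offspring_law_AE AE_space
  proof eventually_elim
    case (elim \<omega>)
    then interpret N: offspring_law "\<eta> (\<xi> 0 \<omega>)" by blast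
    have b: "{m. 2 \<le> fst m} \<in> N.events" using branch_set N.sets_\<mu> by simp
    let ?q = "1 - measure (\<eta> (\<xi> 0 \<omega>)) {m. 2 \<le> fst m} / 2"
    have "0 < ?q" using N.prob_le_1[of "{m. 2 \<le> fst m}"] by linarith
    moreover have "ln ?q = 0" using elim(1) by (simp add: branch_log_def)
    ultimately have "?q = 1" by (simp add: ln_eq_zero_iff)
    then have "N.prob {m. 2 \<le> fst m} = 0" by linarith
    then have "AE m in \<eta> (\<xi> 0 \<omega>). m \<notin> {m. 2 \<le> fst m}" using b by (simp add: N.prob_eq_0)
    then have "mgf (\<lambda>k. k) 0 (\<eta> (\<xi> 0 \<omega>)) \<le> (\<integral>\<^sup>+m. 1 \<partial>\<eta> (\<xi> 0 \<omega>))"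
      unfolding mgf_def by (intro nn_integral_mono_AE, elim eventually_mono) auto
    also have "\<dots> = 1" using N.emeasure_space_1 by simp
    finally have "ennreal (exp (F 0 \<omega>)) \<le> ennreal 1" by (simp add: N.mgf_eq_exp_lmgf)
    then show ?case by (simp only: ennreal_le_iff[OF zero_le_one] exp_le_one_iff)
  qed
  then have "\<Lambda> 0 \<le> (\<integral>\<omega>. 0 \<partial>M)"
    unfolding Lam_eq by (intro integral_mono_AE F_integrable integrable_zero)
  then show False using Lam_0_pos by simp
qed

text \<open>The mean of \<open>branch_log\<close> is \<open>- 4 * growth_rate\<close>: two of the
  four shares are given to the Birkhoff error, and one to Markov's inequality with
  Borel-Cantelli.\<close>

definition "growth_rate = - (\<integral>\<omega>. branch_log (\<xi> 0 \<omega>) \<partial>M) / 4"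

lemma growth_rate_pos: "0 < growth_rate"
  using mean_branch_log_neg by (simp add: growth_rate_def)

lemma growth_quenched:
  "AE \<omega> in M. AE x in tree_law (\<nu> \<omega>). \<forall>\<^sub>F n in sequentially. exp (growth_rate * n) \<le> card (generation x n)"
  using birkhoff_env[OF prob_space_axioms stat branch_log_measurable branch_log_integrable]
    offspring_law_AE AE_space
proof eventually_elim
  case (elim \<omega>)
  interpret E: env_seq "\<nu> \<omega>" by (rule env_seq_\<xi>[OF elim(3)])
  have "0 < 2 * growth_rate" using growth_rate_pos by simp
  then obtain C where C: "\<And>n. \<bar>(\<Sum>k<n. branch_log (\<xi> k \<omega>)) - n * (\<integral>\<omega>. branch_log (\<xi> 0 \<omega>) \<partial>M)\<bar> \<le> 2 * growth_rate * n + C"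
    using elim(1) by blast
  show ?case
  proof (rule E.card_generation_growth_AE[OF _ growth_rate_pos, where C=C])
    show "AE m in \<nu> \<omega> k. 1 \<le> fst m" for k
      by (rule offspring_law.nonempty) (use elim(2) in blast)
    fix n
    have "(\<Sum>k<n. branch_log (\<xi> k \<omega>)) \<le> C - 2 * growth_rate * real n"
      using C[of n] by (simp add: growth_rate_def abs_le_iff algebra_simps)
    then show "(\<Sum>k<n. ln (1 - measure (\<nu> \<omega> k) {m. 2 \<le> fst m} / 2)) \<le> C - 2 * growth_rate * real n"
      by (simp add: branch_log_def)
  qed
qed

text \<open>Differentiability at \<open>t\<close> makes the excess over the tangent at
  \<open>t + r\<close> and \<open>t - r\<close> small compared with \<open>r\<close>. The Chernoff
  gain \<open>r * \<epsilon>\<close> therefore exceeds the slope defect, however small \<epsilon>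
  is.\<close>

lemma Lam_increment:
  assumes "0 < e"
  obtains r where "0 < r" "\<Lambda> (t + r) - \<Lambda> t - r * deriv \<Lambda> t \<le> r * e" "\<Lambda> (t - r) - \<Lambda> t + r * deriv \<Lambda> t \<le> r * e"
proof -
  have "((\<lambda>h. (\<Lambda> (t + h) - \<Lambda> t) / h) \<longlongrightarrow> deriv \<Lambda> t) (at 0)"
    using Lam_DERIV[of t] by (simp add: DERIV_def)
  then have "\<forall>\<^sub>F h in at 0. dist ((\<Lambda> (t + h) - \<Lambda> t) / h) (deriv \<Lambda> t) < e"
    using assms by (rule tendstoD)
  then obtain d where d: "0 < d" "\<And>h. h \<noteq> 0 \<Longrightarrow> \<bar>h\<bar> < d \<Longrightarrow> \<bar>(\<Lambda> (t + h) - \<Lambda> t) / h - deriv \<Lambda> t\<bar> < e"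
    unfolding eventually_at by (auto simp: dist_real_def)
  define r where "r = d / 2"
  have r: "0 < r" "r < d" using d(1) by (auto simp: r_def)
  have "(\<Lambda> (t + r) - \<Lambda> t) / r \<le> deriv \<Lambda> t + e"
    using d(2)[of r] r by (simp add: abs_less_iff)
  then have 1: "\<Lambda> (t + r) - \<Lambda> t - r * deriv \<Lambda> t \<le> r * e"
    using r by (simp add: pos_divide_le_eq algebra_simps)
  have "deriv \<Lambda> t - e \<le> (\<Lambda> (t + - r) - \<Lambda> t) / (- r)"
    using d(2)[of "- r"] r by (simp add: abs_less_iff)
  then have "(\<Lambda> (t - r) - \<Lambda> t) / r \<le> e - deriv \<Lambda> t" by simp
  then have "\<Lambda> (t - r) - \<Lambda> t \<le> (e - deriv \<Lambda> t) * r" using r by (simp only: pos_divide_le_eq)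
  then have 2: "\<Lambda> (t - r) - \<Lambda> t + r * deriv \<Lambda> t \<le> r * e"
    by (simp add: algebra_simps)
  show ?thesis by (rule that[OF r(1) 1 2])
qed

text \<open>The order of the choices is what makes the constants compatible: \<beta> is small
  against \<zeta>, \<epsilon> against the trial budget \<open>growth_rate * \<beta>\<close>, then
  \<open>r\<close> is found from \<epsilon>, \<delta> is small against
  \<open>r * \<epsilon>\<close>, and the truncation level \<open>c\<close> comes last.\<close>

lemma count_lower_quenched:
  fixes t \<zeta> v :: real
  assumes strict: "t * deriv \<Lambda> t < \<Lambda> t" and \<zeta>: "0 < \<zeta>"
  defines "v \<equiv> deriv \<Lambda> t"
  shows "AE \<omega> in M. AE x in tree_law (\<nu> \<omega>). \<forall>\<^sub>F n in sequentially.
    exp (n * (\<Lambda> t - t * v - \<zeta>)) \<le> card {u \<in> generation x n. \<bar>position x u - n * v\<bar> \<le> \<zeta> * n}"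
proof -
  define q where "q = \<Lambda> t - t * v"
  have q: "0 < q" using strict by (simp add: q_def v_def)
  have R: "0 \<le> radius" by (simp add: radius_def)
  \<comment> \<open>One bound keeps the displacement during the first \<beta> n generations below
    \<open>\<zeta> / 4\<close>, the other limits the loss in the exponent, since these generations
    do not contribute at rate \<open>q\<close>.\<close>
  define \<beta> where "\<beta> = min (1 / 2) (min (\<zeta> / (4 * (radius + \<bar>v\<bar> + 1))) (\<zeta> / (4 * (q + 1))))"
  have \<beta>: "0 < \<beta>" "\<beta> < 1" using \<zeta> q R by (auto simp: \<beta>_def)
  have \<beta>1: "(radius + \<bar>v\<bar>) * \<beta> \<le> \<zeta> / 4"
  proof -
    have "(radius + \<bar>v\<bar>) * \<beta> \<le> (radius + \<bar>v\<bar> + 1) * (\<zeta> / (4 * (radius + \<bar>v\<bar> + 1)))"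
      using R \<zeta> \<beta> by (intro mult_mono) (auto simp: \<beta>_def)
    also have "\<dots> = \<zeta> / 4" using R by (simp add: field_simps)
    finally show ?thesis .
  qed
  have \<beta>2: "\<beta> * q \<le> \<zeta> / 4"
  proof -
    have "\<beta> * q \<le> \<zeta> / (4 * (q + 1)) * (q + 1)"
      using q \<zeta> by (intro mult_mono) (auto simp: \<beta>_def)
    also have "\<dots> = \<zeta> / 4" using q by (simp add: field_simps)
    finally show ?thesis .
  qed
  \<comment> \<open>The budget for \<open>7 * \<bar>t\<bar> * \<epsilon>\<close>: half of the trial
    rate, and a fraction of the permitted loss \<zeta>.\<close>
  define b where "b = min (growth_rate * \<beta> / 2) (\<zeta> / 8)"
  have b: "0 < b" "b \<le> growth_rate * \<beta> / 2" "b \<le> \<zeta> / 8" using growth_rate_pos \<beta> \<zeta> by (auto simp: b_def)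
  define \<epsilon> where "\<epsilon> = min (\<zeta> / 2) (b / (7 * (\<bar>t\<bar> + 1)))"
  have \<epsilon>: "0 < \<epsilon>" "\<epsilon> \<le> \<zeta> / 2"
    using b \<zeta> unfolding \<epsilon>_def by (simp add: add_nonneg_pos, intro min.cobounded1)
  have t\<epsilon>: "7 * \<bar>t\<bar> * \<epsilon> \<le> b"
  proof -
    have "7 * \<bar>t\<bar> * \<epsilon> \<le> 7 * (\<bar>t\<bar> + 1) * (b / (7 * (\<bar>t\<bar> + 1)))"
      using \<epsilon>(1) by (intro mult_mono) (auto simp: \<epsilon>_def)
    also have "\<dots> = b" by (simp add: field_simps)
    finally show ?thesis .
  qed
  obtain r where r: "0 < r" "\<Lambda> (t + r) - \<Lambda> t - r * v \<le> r * (\<epsilon> / 4)" "\<Lambda> (t - r) - \<Lambda> t + r * v \<le> r * (\<epsilon> / 4)"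
    using Lam_increment[of "\<epsilon> / 4" t] \<epsilon>(1) unfolding v_def by auto
  \<comment> \<open>In turn these serve the Chernoff condition, where \<open>5 * \<delta>\<close> is
    added to a quarter of \<open>r * \<epsilon>\<close>, the trial condition, where
    \<open>6 * \<delta>\<close> joins \<epsilon>'s half of the budget, the total loss \<zeta>, and
    \<open>t * v \<le> \<rho>\<close> in spite of truncation.\<close>
  define \<delta> where "\<delta> = min (r * \<epsilon> / 32) (min (growth_rate * \<beta> / 24) (min (\<zeta> / 32) q))"
  have \<delta>: "0 < \<delta>" "\<delta> \<le> r * \<epsilon> / 32" "\<delta> \<le> growth_rate * \<beta> / 24" "\<delta> \<le> \<zeta> / 32" "\<delta> \<le> q"
    using r(1) \<epsilon> growth_rate_pos \<beta> \<zeta> q by (auto simp: \<delta>_def)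
  let ?L = "\<lambda>c. \<integral>\<omega>. lmgf (min (Suc c)) t (\<eta> (\<xi> 0 \<omega>)) \<partial>M"
  have "\<forall>\<^sub>F c in sequentially. \<Lambda> t - \<delta> < ?L c"
    using Lam_trunc_tendsto[of t] \<delta>(1) by (intro order_tendstoD) auto
  then obtain c where c: "\<Lambda> t - \<delta> < ?L c" by (auto simp: eventually_sequentially)
  define \<rho> where "\<rho> = ?L c"
  have \<rho>: "\<Lambda> t - \<delta> < \<rho>" using c by (simp add: \<rho>_def)
  show ?thesis
    using birkhoff_lmgf[OF lmgf_trunc_integrable[of c t]] birkhoff_F[of "t + r"] birkhoff_F[of "t - r"]
      growth_quenched radius_quenched offspring_law_AE AE_space
  proof eventually_elim
    case (elim \<omega>)
    obtain C1 where C1: "\<And>n. \<bar>(\<Sum>k<n. lmgf (min (Suc c)) t (\<nu> \<omega> k)) - n * \<rho>\<bar> \<le> \<delta> * n + C1"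
      using elim(1) \<delta>(1) unfolding \<rho>_def by blast
    obtain C2 where C2: "\<And>n. \<bar>(\<Sum>k<n. lmgf (\<lambda>k. k) (t + r) (\<nu> \<omega> k)) - n * \<Lambda> (t + r)\<bar> \<le> \<delta> * n + C2"
      using elim(2) \<delta>(1) by blast
    obtain C3 where C3: "\<And>n. \<bar>(\<Sum>k<n. lmgf (\<lambda>k. k) (t - r) (\<nu> \<omega> k)) - n * \<Lambda> (t - r)\<bar> \<le> \<delta> * n + C3"
      using elim(3) \<delta>(1) by blast
    define C where "C = max C1 (max C2 C3)"
    interpret E: env_seq "\<nu> \<omega>" by (rule env_seq_\<xi>[OF elim(7)])
    have off: "offspring_law (\<nu> \<omega> k)" for k using elim(6) by blast
    interpret L: lower_bound_env "\<nu> \<omega>" "Suc c" "\<lambda>k. lmgf (min (Suc c)) t (\<nu> \<omega> k)"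
      "\<lambda>k. lmgf (\<lambda>k. k) (t + r) (\<nu> \<omega> k)" "\<lambda>k. lmgf (\<lambda>k. k) (t - r) (\<nu> \<omega> k)"
      \<comment> \<open>The slope defect is \<open>r * (\<epsilon> / 4)\<close> from
        \<open>Lam_increment\<close>, increased by \<delta> because the truncated average \<rho> may
        lie below \<open>\<Lambda> t\<close> by that much.\<close>
      t r v \<rho> "\<Lambda> (t + r)" "\<Lambda> (t - r)" "r * (\<epsilon> / 4) + \<delta>" \<epsilon> \<delta> C \<beta> growth_rate radius
    proof (rule lower_bound_env.intro[OF E.env_seq_axioms], rule lower_bound_env_axioms.intro)
      show "mgf (min (Suc c)) t (\<nu> \<omega> k) = ennreal (exp (lmgf (min (Suc c)) t (\<nu> \<omega> k)))" for k
        by (rule offspring_law.mgf_trunc_eq_exp_lmgf[OF off]) simp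
      show "mgf (min (Suc c)) (t + r) (\<nu> \<omega> k) \<le> ennreal (exp (lmgf (\<lambda>k. k) (t + r) (\<nu> \<omega> k)))" for k
        using offspring_law.mgf_trunc_le[OF off] by (simp only: offspring_law.mgf_eq_exp_lmgf[OF off, symmetric])
      show "mgf (min (Suc c)) (t - r) (\<nu> \<omega> k) \<le> ennreal (exp (lmgf (\<lambda>k. k) (t - r) (\<nu> \<omega> k)))" for k
        using offspring_law.mgf_trunc_le[OF off] by (simp only: offspring_law.mgf_eq_exp_lmgf[OF off, symmetric])
      show "\<bar>(\<Sum>k<j. lmgf (min (Suc c)) t (\<nu> \<omega> k)) - j * \<rho>\<bar> \<le> \<delta> * j + C" for j
        using C1[of j] by (simp add: C_def)
      show "\<bar>(\<Sum>k<j. lmgf (\<lambda>k. k) (t + r) (\<nu> \<omega> k)) - j * \<Lambda> (t + r)\<bar> \<le> \<delta> * j + C" for j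
        using C2[of j] by (simp add: C_def)
      show "\<bar>(\<Sum>k<j. lmgf (\<lambda>k. k) (t - r) (\<nu> \<omega> k)) - j * \<Lambda> (t - r)\<bar> \<le> \<delta> * j + C" for j
        using C3[of j] by (simp add: C_def)
      show "\<Lambda> (t + r) - \<rho> - r * v \<le> r * (\<epsilon> / 4) + \<delta>" "\<Lambda> (t - r) - \<rho> + r * v \<le> r * (\<epsilon> / 4) + \<delta>"
        using r \<rho> by linarith+
      have "0 < r * \<epsilon>" using r(1) \<epsilon>(1) by simp
      then show "r * (\<epsilon> / 4) + \<delta> + 4 * \<delta> < r * \<epsilon>" using \<delta>(2) by (simp add: field_simps)
      show "t * v \<le> \<rho>" using \<rho> \<delta>(5) by (simp add: q_def)
      show "0 \<le> r * (\<epsilon> / 4) + \<delta>" using r(1) \<epsilon>(1) \<delta>(1) by simp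
      have "0 < growth_rate * \<beta>" using growth_rate_pos \<beta>(1) by simp
      then show "7 * \<bar>t\<bar> * \<epsilon> + 6 * \<delta> < growth_rate * \<beta>" using t\<epsilon> b(2) \<delta>(3) by linarith
    qed (rule r(1) \<delta>(1) \<epsilon>(1) \<beta> growth_rate_pos R)+
    \<comment> \<open>The loss \<zeta> is spent as \<open>\<zeta> / 4\<close> on the generations
      before \<open>first n\<close>, \<open>\<zeta> / 2\<close> on
      \<open>3 * \<delta> + \<bar>t\<bar> * \<epsilon>\<close>, and, for large n,
      \<open>\<zeta> / 4\<close> on the constants.\<close>
    have "\<forall>\<^sub>F n in sequentially. 2 * C + ln 4 \<le> \<zeta> / 4 * real n"
      using \<zeta> by real_asymp
    then have thr: "\<forall>\<^sub>F n in sequentially. exp (n * (\<Lambda> t - t * v - \<zeta>)) \<le> L.thr n"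
    proof eventually_elim
      case (elim n)
      let ?l = "real (n - L.first n)"
      have "(1 - \<beta>) * n \<le> ?l" using L.first_le[of n] by (simp add: of_nat_diff algebra_simps)
      moreover have "0 \<le> \<rho> - t * v" using \<rho> \<delta>(5) by (simp add: q_def)
      ultimately have "(1 - \<beta>) * n * (\<rho> - t * v) \<le> ?l * (\<rho> - t * v)" by (rule mult_right_mono)
      moreover have "(1 - \<beta>) * n * (q - \<delta>) \<le> (1 - \<beta>) * n * (\<rho> - t * v)"
        using \<rho> \<beta> by (intro mult_left_mono) (auto simp: q_def)
      moreover have "n * (q - \<zeta> / 4 - \<delta>) \<le> (1 - \<beta>) * n * (q - \<delta>)"
      proof -
        have "q - \<zeta> / 4 - \<delta> \<le> (1 - \<beta>) * (q - \<delta>)"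
        proof -
          have "(1 - \<beta>) * (q - \<delta>) = q - \<delta> - \<beta> * q + \<beta> * \<delta>" by (simp add: algebra_simps)
          moreover have "0 \<le> \<beta> * \<delta>" using \<beta> \<delta>(1) by simp
          ultimately show ?thesis using \<beta>2 by linarith
        qed
        then have "n * (q - \<zeta> / 4 - \<delta>) \<le> n * ((1 - \<beta>) * (q - \<delta>))" by (rule mult_left_mono) simp
        then show ?thesis by (simp only: mult_ac)
      qed
      moreover have "n * (3 * \<delta> + \<bar>t\<bar> * \<epsilon>) \<le> n * (\<zeta> / 2)"
      proof (rule mult_left_mono)
        have "0 \<le> \<bar>t\<bar> * \<epsilon>" using \<epsilon>(1) by simp
        then show "3 * \<delta> + \<bar>t\<bar> * \<epsilon> \<le> \<zeta> / 2" using t\<epsilon> b(3) \<delta>(4) \<zeta> by linarith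
      qed simp
      ultimately have "n * (q - \<zeta>) + ln 4 \<le> ?l * (\<rho> - t * v) - (2 * \<delta> * n + 2 * C) - \<bar>t\<bar> * (\<epsilon> * n)"
        using elim by (simp add: algebra_simps)
      then have "exp (n * (q - \<zeta>) + ln 4) \<le> exp (?l * (\<rho> - t * v) - (2 * \<delta> * n + 2 * C) - \<bar>t\<bar> * (\<epsilon> * n))"
        by simp
      then show ?case by (simp add: L.thr_def exp_add q_def)
    qed
    show ?case
      using L.card_lower_AE[OF elim(4,5)]
    proof eventually_elim
      case (elim x)
      show ?case using elim thr
      proof eventually_elim
        case (elim n)
        have "(\<epsilon> + (radius + \<bar>v\<bar>) * \<beta>) * n \<le> \<zeta> * n"
          using \<epsilon>(2) \<beta>1 \<zeta> by (intro mult_right_mono) auto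
        then have "card {u \<in> generation x n. \<bar>position x u - n * v\<bar> \<le> (\<epsilon> + (radius + \<bar>v\<bar>) * \<beta>) * n} \<le>
            card {u \<in> generation x n. \<bar>position x u - n * v\<bar> \<le> \<zeta> * n}"
          by (intro card_mono) auto
        then show ?case using elim by linarith
      qed
    qed
  qed
qed

section \<open>Measurability, and the bounds under the annealed law\<close>

lemma measurable_generation_sum:
  assumes "f \<in> borel_measurable borel" "\<And>y. 0 \<le> f y"
  shows "(\<lambda>x. \<Sum>u\<in>generation x n. f (position x u) :: real) \<in> borel_measurable tree_space"
proof -
  have "(\<lambda>x. enn2real (path_sum (\<lambda>k. k) n (final_weight n (\<lambda>y. ennreal (f y))) x 0)) \<in> borel_measurable tree_space"
    by (rule borel_measurable_enn2real, rule measurable_path_sum_tree) (use assms(1) in auto)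
  then show ?thesis using assms(2) by (simp add: path_sum_final_weight sum_ennreal sum_nonneg)
qed

lemma eventually_sets:
  assumes "\<And>n. {x. P n x} \<in> sets tree_space"
  shows "{x. \<forall>\<^sub>F n in sequentially. P n x} \<in> sets tree_space"
proof -
  have "{x. \<forall>\<^sub>F n in sequentially. P n x} = (\<Union>N. \<Inter>n\<in>{N..}. {x. P n x})"
    by (auto simp: eventually_sequentially)
  also have "\<dots> \<in> sets tree_space"
    using assms by (intro sets.countable_UN sets.countable_INT') auto
  finally show ?thesis .
qed

theorem exp_sum_upper:
  assumes "0 < \<delta>"
  shows "AE \<omega> in M. \<forall>\<^sub>F n in sequentially.
    (\<Sum>u\<in>generation (\<lambda>u. X u \<omega>) n. exp (t * position (\<lambda>u. X u \<omega>) u)) \<le> exp (n * (\<Lambda> t + \<delta>))"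
proof (rule quenched_AE_imp_AE[OF eventually_sets exp_sum_upper_quenched[OF assms]])
  fix n
  have "(\<lambda>x. \<Sum>u\<in>generation x n. exp (t * position x u)) \<in> borel_measurable tree_space"
    by (rule measurable_generation_sum[where f="\<lambda>y. exp (t * y)"]) auto
  then have "{x \<in> space tree_space. (\<Sum>u\<in>generation x n. exp (t * position x u)) \<le> exp (n * (\<Lambda> t + \<delta>))} \<in> sets tree_space"
    by measurable
  then show "{x. (\<Sum>u\<in>generation x n. exp (t * position x u)) \<le> exp (n * (\<Lambda> t + \<delta>))} \<in> sets tree_space" by simp
qed

theorem count_lower:
  fixes t \<zeta> :: real
  assumes "t * deriv \<Lambda> t < \<Lambda> t" "0 < \<zeta>"
  shows "AE \<omega> in M. \<forall>\<^sub>F n in sequentially. exp (n * (\<Lambda> t - t * deriv \<Lambda> t - \<zeta>)) \<le>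
    card {u \<in> generation (\<lambda>u. X u \<omega>) n. \<bar>position (\<lambda>u. X u \<omega>) u - n * deriv \<Lambda> t\<bar> \<le> \<zeta> * n}"
proof (rule quenched_AE_imp_AE[OF eventually_sets count_lower_quenched[OF assms]])
  fix n
  let ?A = "{y. \<bar>y - real n * deriv \<Lambda> t\<bar> \<le> \<zeta> * n}"
  have "?A \<in> sets borel" by measurable
  then have "(\<lambda>x. \<Sum>u\<in>generation x n. indicator ?A (position x u) :: real) \<in> borel_measurable tree_space"
    by (intro measurable_generation_sum) auto
  moreover have "(\<Sum>u\<in>generation x n. indicator ?A (position x u)) = real (card {u \<in> generation x n. \<bar>position x u - n * deriv \<Lambda> t\<bar> \<le> \<zeta> * n})" for x
    by (simp add: indicator_def sum.If_cases Int_def)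
  ultimately have "(\<lambda>x. real (card {u \<in> generation x n. \<bar>position x u - n * deriv \<Lambda> t\<bar> \<le> \<zeta> * n})) \<in> borel_measurable tree_space"
    by simp
  then have "{x \<in> space tree_space. exp (n * (\<Lambda> t - t * deriv \<Lambda> t - \<zeta>)) \<le>
      real (card {u \<in> generation x n. \<bar>position x u - n * deriv \<Lambda> t\<bar> \<le> \<zeta> * n})} \<in> sets tree_space"
    by measurable
  then show "{x. exp (n * (\<Lambda> t - t * deriv \<Lambda> t - \<zeta>)) \<le>
      real (card {u \<in> generation x n. \<bar>position x u - n * deriv \<Lambda> t\<bar> \<le> \<zeta> * n})} \<in> sets tree_space" by simp
qed

end

section \<open>The rate function\<close>

text \<open>All that the rate function uses of \<Lambda>. Stated for an arbitrary function so that
  it can be instantiated a second time with the reflected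
  \<open>\<lambda>t. \<Lambda> (- t)\<close>.\<close>

locale cgf =
  fixes \<Lambda> :: "real \<Rightarrow> real"
  assumes convex: "convex_on UNIV \<Lambda>"
    and DERIV: "(\<Lambda> has_real_derivative deriv \<Lambda> t) (at t)"
    and pos: "0 < \<Lambda> 0"
begin

abbreviation "d \<equiv> deriv \<Lambda>"

text \<open>The Legendre transform of \<Lambda> at the slope \<open>d t\<close>;
  \<open>- G t\<close> is the exponential growth rate of the number of particles near
  \<open>n * d t\<close> while it is positive.\<close>

definition G :: "real \<Rightarrow> real" where "G t = t * d t - \<Lambda> t"

lemma tangent: "\<Lambda> t + d t * (s - t) \<le> \<Lambda> s"
proof -
  have "d t * (s - t) \<le> \<Lambda> s - \<Lambda> t"
    by (rule convex_on_imp_above_tangent[OF convex]) (auto intro: DERIV)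
  then show ?thesis by simp
qed

lemma d_mono: "s \<le> t \<Longrightarrow> d s \<le> d t"
proof (cases "s = t")
  case False
  assume "s \<le> t"
  with False have st: "0 < t - s" by simp
  have "d s * (t - s) \<le> d t * (t - s)"
    using tangent[of s t] tangent[of t s] by (simp add: algebra_simps)
  with st show ?thesis by simp
qed simp

text \<open>Convexity bounds \<open>d (t + h)\<close> by the slope of the chord from
  \<open>t + h\<close> to \<open>t + 2 * h\<close>, and differentiability at \<open>t\<close> brings
  that slope close to \<open>d t\<close>; likewise on the left. Monotonicity of \<open>d\<close>
  fills in the points between.\<close>

lemma d_cont: "isCont d t"
proof (rule isCont_def[THEN iffD2], rule tendstoI)
  fix e :: real assume e: "0 < e"
  have "((\<lambda>h. (\<Lambda> (t + h) - \<Lambda> t) / h) \<longlongrightarrow> d t) (at 0)"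
    using DERIV[of t] by (simp add: DERIV_def)
  then have "\<forall>\<^sub>F h in at 0. dist ((\<Lambda> (t + h) - \<Lambda> t) / h) (d t) < e / 4"
    using e by (intro tendstoD) auto
  then obtain r where r: "0 < r" "\<And>h. h \<noteq> 0 \<Longrightarrow> \<bar>h\<bar> < r \<Longrightarrow> \<bar>(\<Lambda> (t + h) - \<Lambda> t) / h - d t\<bar> < e / 4"
    unfolding eventually_at by (auto simp: dist_real_def)
  have inc: "\<bar>\<Lambda> (t + k) - \<Lambda> t - k * d t\<bar> \<le> \<bar>k\<bar> * (e / 4)" if "k \<noteq> 0" "\<bar>k\<bar> < r" for k
  proof -
    have "\<Lambda> (t + k) - \<Lambda> t - k * d t = k * ((\<Lambda> (t + k) - \<Lambda> t) / k - d t)"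
      using that(1) by (simp add: field_simps)
    then have "\<bar>\<Lambda> (t + k) - \<Lambda> t - k * d t\<bar> = \<bar>k\<bar> * \<bar>(\<Lambda> (t + k) - \<Lambda> t) / k - d t\<bar>"
      by (simp only: abs_mult)
    also have "\<dots> \<le> \<bar>k\<bar> * (e / 4)" using r(2)[OF that] by (intro mult_left_mono) auto
    finally show ?thesis .
  qed
  define h where "h = r / 4"
  have h: "0 < h" "2 * h < r" using r(1) by (auto simp: h_def)
  have i1: "\<bar>\<Lambda> (t + h) - \<Lambda> t - h * d t\<bar> \<le> h * (e / 4)"
    "\<bar>\<Lambda> (t - h) - \<Lambda> t + h * d t\<bar> \<le> h * (e / 4)"
    using inc[of h] inc[of "- h"] h by simp_all
  have i2: "\<bar>\<Lambda> (t + 2 * h) - \<Lambda> t - 2 * (h * d t)\<bar> \<le> 2 * (h * (e / 4))"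
    "\<bar>\<Lambda> (t - 2 * h) - \<Lambda> t + 2 * (h * d t)\<bar> \<le> 2 * (h * (e / 4))"
    using inc[of "2 * h"] inc[of "- (2 * h)"] h by (simp_all add: mult.assoc)
  have "h * d (t + h) \<le> \<Lambda> (t + 2 * h) - \<Lambda> (t + h)"
    using tangent[of "t + h" "t + 2 * h"] by (simp add: algebra_simps)
  also have "\<dots> \<le> h * d t + 3 * (h * (e / 4))"
    using i1(1) i2(1) by linarith
  also have "\<dots> = h * (d t + 3 * (e / 4))" by (simp add: algebra_simps)
  finally have up: "d (t + h) < d t + e" using h(1) e by simp
  have "h * (d t - 3 * (e / 4)) = h * d t - 3 * (h * (e / 4))" by (simp add: algebra_simps)
  also have "\<dots> \<le> \<Lambda> (t - h) - \<Lambda> (t - 2 * h)"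
    using i1(2) i2(2) by linarith
  also have "\<dots> \<le> h * d (t - h)"
    using tangent[of "t - h" "t - 2 * h"] by (simp add: algebra_simps)
  finally have lo: "d t - e < d (t - h)" using h(1) e by simp
  have "dist (d s) (d t) < e" if "s \<noteq> t" "dist s t < h" for s
  proof -
    have "t - h \<le> s" "s \<le> t + h" using that(2) by (auto simp: dist_real_def abs_less_iff)
    then have "d (t - h) \<le> d s" "d s \<le> d (t + h)" by (auto intro: d_mono)
    then show ?thesis using up lo by (simp add: dist_real_def abs_less_iff)
  qed
  then show "\<forall>\<^sub>F s in at t. dist (d s) (d t) < e"
    unfolding eventually_at using h(1) by blast
qed

lemma \<Lambda>_cont: "isCont \<Lambda> t"
  using DERIV by (rule DERIV_isCont)

lemma G_cont: "isCont G t"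
  unfolding G_def[abs_def] by (intro continuous_intros d_cont \<Lambda>_cont)

lemma d_nhds: "(d \<longlongrightarrow> d t) (nhds t)"
  using d_cont[of t] by (simp add: isCont_def tendsto_at_iff_tendsto_nhds)

lemma G_at: "(G \<longlongrightarrow> G t) (at t)"
  using G_cont[of t] by (simp add: isCont_def)

lemma G_nhds: "(G \<longlongrightarrow> G t) (nhds t)"
  using G_at[of t] by (simp add: tendsto_at_iff_tendsto_nhds)

text \<open>A substitute for the formal derivative \<open>t * \<Lambda>''(t)\<close> of
  \<open>G\<close>, valid although \<Lambda> need not be twice differentiable. It also yields strict
  inequalities where \<open>d\<close> increases strictly.\<close>

lemma G_diff: "0 \<le> s \<Longrightarrow> s * (d t - d s) \<le> G t - G s"
  using tangent[of t s] by (simp add: G_def algebra_simps)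

lemma G_mono: "0 \<le> s \<Longrightarrow> s \<le> t \<Longrightarrow> G s \<le> G t"
  using G_diff[of s t] d_mono[of s t] mult_nonneg_nonneg[of s "d t - d s"] by linarith

lemma t_plus_eq: "t_plus \<Lambda> = Sup (ereal ` {t. G t \<le> 0})"
  by (simp add: t_plus_def G_def)

lemma t_minus_eq: "t_minus \<Lambda> = Inf (ereal ` {t. G t \<le> 0})"
  by (simp add: t_minus_def G_def)

lemma near_0: obtains e where "0 < e" "\<And>t. \<bar>t\<bar> \<le> e \<Longrightarrow> G t < 0"
proof -
  have "\<forall>\<^sub>F t in at 0. G t < 0"
    by (rule order_tendstoD(2)[OF G_at]) (use pos in \<open>simp add: G_def\<close>)
  then obtain e where e: "0 < e" "\<And>t. t \<noteq> 0 \<Longrightarrow> dist t 0 < e \<Longrightarrow> G t < 0"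
    unfolding eventually_at by auto
  have "G t < 0" if "\<bar>t\<bar> \<le> e / 2" for t
    using e that pos by (cases "t = 0") (auto simp: G_def)
  then show ?thesis using e(1) by (intro that[of "e / 2"]) auto
qed

lemma t_plus_pos: "0 < t_plus \<Lambda>"
proof -
  obtain e where e: "0 < e" "\<And>t. \<bar>t\<bar> \<le> e \<Longrightarrow> G t < 0" by (rule near_0) blast
  have "ereal e \<le> t_plus \<Lambda>" unfolding t_plus_eq using e by (intro Sup_upper) (auto intro!: less_imp_le)
  then show ?thesis using e(1) by (meson ereal_less(2) less_le_trans)
qed

lemma t_minus_neg: "t_minus \<Lambda> < 0"
proof -
  obtain e where e: "0 < e" "\<And>t. \<bar>t\<bar> \<le> e \<Longrightarrow> G t < 0" by (rule near_0) blast
  have "t_minus \<Lambda> \<le> ereal (- e)" unfolding t_minus_eq using e by (intro Inf_lower) (auto intro!: less_imp_le)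
  also have "\<dots> < 0" using e(1) by simp
  finally show ?thesis .
qed

lemma G_le_0: "0 \<le> t \<Longrightarrow> ereal t < t_plus \<Lambda> \<Longrightarrow> G t \<le> 0"
proof -
  assume t: "0 \<le> t" "ereal t < t_plus \<Lambda>"
  then obtain s where "G s \<le> 0" "t < s" unfolding t_plus_eq less_Sup_iff by auto
  then show "G t \<le> 0" using G_mono[OF t(1), of s] by simp
qed

text \<open>Continuity of \<open>G\<close> at the endpoint. It means
  \<open>\<Lambda> T = T * d T\<close>: the linear continuation in \<open>Lam_tilde\<close> is the
  tangent at \<open>T\<close>, which passes through the origin.\<close>

lemma G_t_plus:
  assumes "t_plus \<Lambda> = ereal T"
  shows "0 < T" "G T = 0"
proof -
  show T: "0 < T" using t_plus_pos assms by simp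
  have "G T \<le> 0"
  proof (rule tendsto_upperbound)
    show "(G \<longlongrightarrow> G T) (at_left T)"
      using G_cont[of T] by (simp add: isCont_def filterlim_at_split)
    show "\<forall>\<^sub>F t in at_left T. G t \<le> 0"
      using eventually_at_left_real[OF T] by eventually_elim (auto intro: G_le_0 simp: assms)
  qed simp
  moreover have "0 \<le> G T"
  proof (rule tendsto_lowerbound)
    show "(G \<longlongrightarrow> G T) (at_right T)"
      using G_cont[of T] by (simp add: isCont_def filterlim_at_split)
    have "0 \<le> G t" if "T < t" for t
    proof (rule ccontr)
      assume "\<not> 0 \<le> G t"
      then have "ereal t \<le> t_plus \<Lambda>" unfolding t_plus_eq by (intro Sup_upper) auto
      then show False using that assms by simp
    qed
    then show "\<forall>\<^sub>F t in at_right T. 0 \<le> G t"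
      by (auto simp: eventually_at_filter)
  qed simp
  ultimately show "G T = 0" by simp
qed

section \<open>Approximation by exposed slopes, and Chernoff exponents\<close>

abbreviation "rate \<equiv> legendre (Lam_tilde \<Lambda>)"

lemma le_rate: "ereal (t * y - Lam_tilde \<Lambda> t) \<le> rate y"
  unfolding legendre_def by (rule SUP_upper2[of t]) (simp_all add: mult.commute)

lemma Lam_tilde_inside: "t_minus \<Lambda> < ereal t \<Longrightarrow> ereal t < t_plus \<Lambda> \<Longrightarrow> Lam_tilde \<Lambda> t = \<Lambda> t"
  by (simp add: Lam_tilde_def)

lemma Lam_tilde_right: "t_plus \<Lambda> = ereal T \<Longrightarrow> T \<le> t \<Longrightarrow> Lam_tilde \<Lambda> t = t * d T"
  by (simp add: Lam_tilde_def)

lemma nonneg_inside: "0 \<le> t \<Longrightarrow> t_minus \<Lambda> < ereal t"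
  using t_minus_neg by (metis ereal_less_eq(5) less_le_trans)

text \<open>If all slopes on the open interval from 0 to t_+ were at most \<open>z\<close>, then
  \<open>Lam_tilde\<close> would grow with slope at most \<open>z\<close>, either through its linear
  part or through \<Lambda> itself. Then \<open>t * y - Lam_tilde \<Lambda> t\<close> would tend to
  \<infinity> at slope at least \<open>y - z\<close>; the witnesses \<open>t\<close> make it exceed
  a bound \<open>r\<close> of the rate.\<close>

lemma slope_above:
  assumes fin: "rate y < \<infinity>" and z: "z < y"
  obtains \<tau> where "0 < \<tau>" "ereal \<tau> < t_plus \<Lambda>" "z < d \<tau>"
proof (rule ccontr)
  assume "\<not> thesis"
  with that have le: "d \<tau> \<le> z" if "0 < \<tau>" "ereal \<tau> < t_plus \<Lambda>" for \<tau>
    using that by (meson not_le)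
  obtain r where r: "rate y \<le> ereal r"
    using fin by (cases "rate y") auto
  show False
  proof (cases "t_plus \<Lambda>")
    case (real T)
    have T: "0 < T" by (rule G_t_plus(1)[OF real])
    have "d T \<le> z"
    proof (rule tendsto_upperbound)
      show "(d \<longlongrightarrow> d T) (at_left T)"
        using d_cont[of T] by (simp add: isCont_def filterlim_at_split)
      show "\<forall>\<^sub>F t in at_left T. d t \<le> z"
        using eventually_at_left_real[OF T] by eventually_elim (auto intro: le simp: real)
    qed simp
    define t where "t = max T ((r + 1) / (y - z))"
    have "(r + 1) / (y - z) \<le> t" by (simp add: t_def)
    then have "r + 1 \<le> t * (y - z)" using z by (simp add: pos_divide_le_eq)
    also have "\<dots> \<le> t * (y - d T)" using \<open>d T \<le> z\<close> T by (intro mult_left_mono) (auto simp: t_def)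
    also have "\<dots> = t * y - Lam_tilde \<Lambda> t" by (subst Lam_tilde_right[OF real]) (auto simp: t_def algebra_simps)
    finally show False using le_rate[of t y] r by (metis ereal_less_eq(3) less_add_one linorder_not_less order_trans)
  next
    case PInf
    define t where "t = max 1 ((r + 1 + \<Lambda> 0) / (y - z))"
    have t: "0 < t" by (simp add: t_def)
    have "(r + 1 + \<Lambda> 0) / (y - z) \<le> t" by (simp add: t_def)
    then have "r + 1 + \<Lambda> 0 \<le> t * (y - z)" using z by (simp add: pos_divide_le_eq)
    moreover have "\<Lambda> t \<le> \<Lambda> 0 + t * z"
    proof -
      have "d t \<le> z" using le[OF t] PInf by simp
      then have "t * d t \<le> t * z" using t by (intro mult_left_mono) auto
      then show ?thesis using tangent[of t 0] by (simp add: algebra_simps)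
    qed
    ultimately have "r + 1 \<le> t * y - \<Lambda> t" by (simp add: algebra_simps)
    also have "\<dots> = t * y - Lam_tilde \<Lambda> t"
      using t PInf by (subst Lam_tilde_inside) (auto intro: nonneg_inside)
    finally show False using le_rate[of t y] r by (metis ereal_less_eq(3) less_add_one linorder_not_less order_trans)
  next
    case MInf
    then show False using t_plus_pos by simp
  qed
qed

text \<open>A point of finite rate is approached by slopes from the side of \<open>d 0\<close>,
  where the cost does not exceed \<open>rate y\<close>. Strictness of \<open>G t < 0\<close> is what
  the particle count requires, and rational \<open>t\<close> are those for which it is known almost
  surely.\<close>

lemma exposed_slope_right:
  assumes y: "d 0 \<le> y" and fin: "rate y < \<infinity>" and \<rho>: "0 < \<rho>"
  obtains t where "t \<in> \<rat>" "G t < 0" "\<bar>d t - y\<bar> < \<rho>" "ereal (G t) \<le> rate y"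
proof (cases "y = d 0")
  case True
  have "ereal (0 * y - Lam_tilde \<Lambda> 0) \<le> rate y" by (rule le_rate)
  moreover have "Lam_tilde \<Lambda> 0 = \<Lambda> 0"
    using t_plus_pos t_minus_neg by (intro Lam_tilde_inside) (auto simp: zero_ereal_def)
  ultimately have "ereal (G 0) \<le> rate y" by (simp add: G_def)
  then show ?thesis using that[of 0] True \<rho> pos by (simp add: G_def)
next
  case False
  define z where "z = max (d 0) (y - \<rho>)"
  have z: "z < y" "d 0 \<le> z" "y - \<rho> \<le> z" using False y \<rho> by (auto simp: z_def)
  obtain \<tau> where \<tau>: "0 < \<tau>" "ereal \<tau> < t_plus \<Lambda>" "z < d \<tau>"
    by (rule slope_above[OF fin z(1)])
  \<comment> \<open>Strict inequalities on both sides leave room to move \<open>t0\<close> to a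
    rational neighbour. As \<open>d\<close> may have flat pieces, \<open>d t < d \<tau>\<close>
    rather than \<open>t < \<tau>\<close> is what gives \<open>G t < 0\<close> through
    \<open>G_diff\<close>.\<close>
  obtain m where m: "z < m" "m < min y (d \<tau>)" using dense[of z "min y (d \<tau>)"] z(1) \<tau>(3) by auto
  obtain t0 where t0: "0 \<le> t0" "t0 \<le> \<tau>" "d t0 = m"
    using IVT[of d 0 m \<tau>] d_cont \<tau>(1) z(2) m by auto
  have "t0 \<noteq> 0" "t0 \<noteq> \<tau>" using t0(3) m z(2) by auto
  then have t0': "0 < t0" "t0 < \<tau>" using t0 by auto
  have "\<forall>\<^sub>F t in nhds t0. z < d t \<and> d t < min y (d \<tau>) \<and> 0 < t \<and> t < \<tau>"
  proof (intro eventually_conj)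
    have c: "(d \<longlongrightarrow> m) (nhds t0)"
      using d_nhds[of t0] t0(3) by simp
    show "\<forall>\<^sub>F t in nhds t0. z < d t" by (rule order_tendstoD(1)[OF c m(1)])
    show "\<forall>\<^sub>F t in nhds t0. d t < min y (d \<tau>)" by (rule order_tendstoD(2)[OF c m(2)])
    show "\<forall>\<^sub>F t in nhds t0. 0 < t" "\<forall>\<^sub>F t in nhds t0. t < \<tau>"
      using t0' eventually_nhds_in_open[of "{0<..}" t0] eventually_nhds_in_open[of "{..<\<tau>}" t0] by simp_all
  qed
  then obtain e where e: "0 < e" "\<And>t. dist t t0 < e \<Longrightarrow> z < d t \<and> d t < min y (d \<tau>) \<and> 0 < t \<and> t < \<tau>"
    unfolding eventually_nhds_metric by blast
  obtain t where tq: "t \<in> \<rat>" "t0 < t" "t < t0 + e"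
    using Rats_dense_in_real[of t0 "t0 + e"] e(1) by auto
  then have t: "z < d t" "d t < y" "d t < d \<tau>" "0 < t" "t < \<tau>"
    using e(2)[of t] by (auto simp: dist_real_def)
  have "0 < t * (d \<tau> - d t)" using t by simp
  moreover have "t * (d \<tau> - d t) \<le> G \<tau> - G t" using t(4) by (intro G_diff) simp
  moreover have "G \<tau> \<le> 0" using \<tau> by (intro G_le_0) auto
  ultimately have G: "G t < 0" by linarith
  have "ereal t < t_plus \<Lambda>" using t(5) \<tau>(2) by (meson ereal_less_ereal_Ex less_ereal.simps(1) less_trans)
  then have "Lam_tilde \<Lambda> t = \<Lambda> t" using t(4) by (intro Lam_tilde_inside nonneg_inside) auto
  moreover have "G t \<le> t * y - \<Lambda> t" using t by (simp add: G_def)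
  ultimately have "ereal (G t) \<le> rate y"
    using le_rate[of t y] by (metis ereal_less_eq(3) order_trans)
  then show ?thesis using that[OF tq(1) G] t z by (simp add: abs_less_iff)
qed

text \<open>A positive exponent already rules out every particle beyond \<open>n * y\<close>, so it
  may replace an exponent above \<open>a\<close>. If neither is available, each piece of
  \<open>Lam_tilde\<close> is checked to contribute at most \<open>a\<close> to the supremum that
  defines \<open>rate y\<close>.\<close>

lemma chernoff_right:
  assumes y: "d 0 \<le> y" and a: "ereal a < rate y"
  obtains s where "0 \<le> s" "0 < s * y - \<Lambda> s \<or> a < s * y - \<Lambda> s"
proof (rule ccontr)
  assume "\<not> thesis"
  with that have le: "s * y - \<Lambda> s \<le> 0" "s * y - \<Lambda> s \<le> a" if "0 \<le> s" for s
    using that by (meson not_le)+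
  \<comment> \<open>The tangent at 0 has slope \<open>d 0 \<le> y\<close>, so negative
    \<open>t\<close> cannot improve on the value at 0, which is at most \<open>a\<close>.\<close>
  have neg: "t * y - \<Lambda> t \<le> - \<Lambda> 0" if "t \<le> 0" for t
    using tangent[of 0 t] mult_left_mono_neg[OF y that] by (simp add: mult.commute)
  have a0: "- \<Lambda> 0 \<le> a" using le(2)[of 0] by simp
  have "ereal (t * y - Lam_tilde \<Lambda> t) \<le> ereal a" for t
  proof (cases "t_minus \<Lambda> < ereal t \<and> ereal t < t_plus \<Lambda>")
    case True
    then have "Lam_tilde \<Lambda> t = \<Lambda> t" by (intro Lam_tilde_inside) auto
    then show ?thesis using le(2)[of t] neg[of t] a0 by (cases "0 \<le> t") auto
  next
    case outside: False
    show ?thesis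
    proof (cases "t_plus \<Lambda> \<le> ereal t")
      case True
      then obtain T where T: "t_plus \<Lambda> = ereal T"
        using t_plus_pos by (cases "t_plus \<Lambda>") auto
      have "T \<le> t" using True T by simp
      have G: "\<Lambda> T = T * d T" using G_t_plus(2)[OF T] by (simp add: G_def)
      \<comment> \<open>At the endpoint the failed first alternative reads
        \<open>y \<le> d T\<close>. Along the linear continuation \<open>t * (y - d T)\<close> is
        then nonincreasing, so its largest value is the one at \<open>T\<close>, already bounded by
        \<open>a\<close>.\<close>
      have "T * (y - d T) \<le> 0" using le(1)[of T] G_t_plus(1)[OF T] G by (simp add: algebra_simps)
      then have "y - d T \<le> 0" using G_t_plus(1)[OF T] by (simp add: mult_le_0_iff)
      then have "t * (y - d T) \<le> T * (y - d T)" using \<open>T \<le> t\<close> by (intro mult_right_mono_neg)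
      also have "\<dots> \<le> a" using le(2)[of T] G_t_plus(1)[OF T] G by (simp add: algebra_simps)
      finally show ?thesis using Lam_tilde_right[OF T \<open>T \<le> t\<close>] by (simp add: algebra_simps)
    next
      case False
      then have "ereal t \<le> t_minus \<Lambda>" using outside by auto
      then obtain T where T: "t_minus \<Lambda> = ereal T"
        using t_minus_neg by (cases "t_minus \<Lambda>") auto
      have tT: "t \<le> T" "T < 0" using \<open>ereal t \<le> t_minus \<Lambda>\<close> T t_minus_neg by auto
      have "d T \<le> y" using d_mono[of T 0] y tT by simp
      \<comment> \<open>The counterpart of \<open>G_t_plus\<close> at the left endpoint:
        \<open>G T < 0\<close> would extend the set \<open>{t. G t \<le> 0}\<close> beyond its
        infimum, and \<open>G T > 0\<close> would separate the set from it.\<close>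
      have "\<Lambda> T \<le> T * d T"
      proof (rule ccontr)
        assume "\<not> ?thesis"
        then have "G T < 0" by (simp add: G_def)
        then have "\<forall>\<^sub>F s in at T. G s < 0"
          by (rule order_tendstoD(2)[OF G_at])
        then obtain e where e: "0 < e" "\<And>s. s \<noteq> T \<Longrightarrow> dist s T < e \<Longrightarrow> G s < 0"
          unfolding eventually_at by auto
        have "G (T - e / 2) < 0" using e by (auto simp: dist_real_def)
        then have "t_minus \<Lambda> \<le> ereal (T - e / 2)" unfolding t_minus_eq by (intro Inf_lower) auto
        then show False using T e(1) by simp
      qed
      have "\<Lambda> T = T * d T"
      proof (rule antisym[OF \<open>\<Lambda> T \<le> T * d T\<close>])
        have "G T \<le> 0"
        proof (rule ccontr)
          assume "\<not> ?thesis"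
          then have "\<forall>\<^sub>F s in nhds T. 0 < G s"
            by (intro order_tendstoD(1)[OF G_nhds]) simp
          then obtain e where e: "0 < e" "\<And>s. dist s T < e \<Longrightarrow> 0 < G s"
            unfolding eventually_nhds_metric by auto
          have "ereal (T + e) \<le> t_minus \<Lambda>"
            unfolding t_minus_eq
          proof (rule Inf_greatest)
            fix w assume "w \<in> ereal ` {t. G t \<le> 0}"
            then obtain s where s: "w = ereal s" "G s \<le> 0" by auto
            then have "t_minus \<Lambda> \<le> ereal s" unfolding t_minus_eq by (intro Inf_lower) auto
            then have "T \<le> s" using T by simp
            moreover have "\<not> dist s T < e" using e(2)[of s] s(2) by auto
            ultimately show "ereal (T + e) \<le> w" using s(1) by (auto simp: dist_real_def)
          qed
          then show False using T e(1) by simp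
        qed
        then show "T * d T \<le> \<Lambda> T" by (simp add: G_def)
      qed
      have "t * (y - d T) \<le> T * (y - d T)" using tT(1) \<open>d T \<le> y\<close> by (intro mult_right_mono) auto
      also have "\<dots> = T * y - \<Lambda> T" using \<open>\<Lambda> T = T * d T\<close> by (simp add: algebra_simps)
      also have "\<dots> \<le> a" using neg[of T] tT(2) a0 by simp
      finally have "t * (y - d T) \<le> a" .
      moreover have "Lam_tilde \<Lambda> t = t * d (real_of_ereal (t_minus \<Lambda>))"
        unfolding Lam_tilde_def by (simp only: outside False if_False)
      ultimately show ?thesis by (simp add: algebra_simps T)
    qed
  qed
  then have "rate y \<le> ereal a"
    unfolding legendre_def by (intro SUP_least) (simp add: mult.commute)
  then show False using a by simp
qed

end

text \<open>Reflecting the walk exchanges t_- with \<open>- t_+\<close> and \<open>y\<close> with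
  \<open>- y\<close>, so each one-sided statement to the right of \<open>d 0\<close> yields its
  counterpart to the left.\<close>

lemma (in cgf) mirror: "cgf (\<lambda>t. \<Lambda> (- t))" and deriv_mirror: "deriv (\<lambda>t. \<Lambda> (- t)) t = - d (- t)"
proof -
  have D: "((\<lambda>t. \<Lambda> (- t)) has_real_derivative - d (- t)) (at t)" for t
  proof -
    have "(uminus has_real_derivative - 1) (at t)" by (auto intro!: derivative_eq_intros)
    from DERIV_chain'[OF this DERIV] show ?thesis by simp
  qed
  then show eq: "deriv (\<lambda>t. \<Lambda> (- t)) t = - d (- t)" for t
    by (rule DERIV_imp_deriv)
  show "cgf (\<lambda>t. \<Lambda> (- t))"
  proof
    show "convex_on UNIV (\<lambda>t. \<Lambda> (- t))"
    proof (rule convex_onI)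
      fix w s t :: real assume w: "0 < w" "w < 1"
      show "\<Lambda> (- ((1 - w) *\<^sub>R s + w *\<^sub>R t)) \<le> (1 - w) * \<Lambda> (- s) + w * \<Lambda> (- t)"
        using convex_onD[OF convex, of w "- s" "- t"] w by (simp add: algebra_simps)
    qed simp
    show "((\<lambda>t. \<Lambda> (- t)) has_real_derivative deriv (\<lambda>t. \<Lambda> (- t)) t) (at t)" for t
      unfolding eq[of t] by (rule D)
    show "0 < \<Lambda> (- 0)" using pos by simp
  qed
qed

lemma (in cgf) t_mirror:
  "t_plus (\<lambda>t. \<Lambda> (- t)) = - t_minus \<Lambda>" "t_minus (\<lambda>t. \<Lambda> (- t)) = - t_plus \<Lambda>"
proof -
  have "{t. t * deriv (\<lambda>t. \<Lambda> (- t)) t - \<Lambda> (- t) \<le> 0} = uminus ` {t. t * d t - \<Lambda> t \<le> 0}"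
    unfolding deriv_mirror by (auto simp: image_iff) (metis minus_minus mult_minus_left mult_minus_right)
  then have "ereal ` {t. t * deriv (\<lambda>t. \<Lambda> (- t)) t - \<Lambda> (- t) \<le> 0} = uminus ` ereal ` {t. t * d t - \<Lambda> t \<le> 0}"
    by (simp add: image_image)
  then show "t_plus (\<lambda>t. \<Lambda> (- t)) = - t_minus \<Lambda>" "t_minus (\<lambda>t. \<Lambda> (- t)) = - t_plus \<Lambda>"
    unfolding t_plus_def t_minus_def by (simp_all add: ereal_Sup_uminus_image_eq ereal_Inf_uminus_image_eq)
qed

lemma (in cgf) rate_mirror: "legendre (Lam_tilde (\<lambda>t. \<Lambda> (- t))) y = rate (- y)"
proof -
  have "Lam_tilde (\<lambda>t. \<Lambda> (- t)) t = Lam_tilde \<Lambda> (- t)" for t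
  proof -
    have *: "- t_plus \<Lambda> < ereal t \<longleftrightarrow> ereal (- t) < t_plus \<Lambda>" "ereal t < - t_minus \<Lambda> \<longleftrightarrow> t_minus \<Lambda> < ereal (- t)"
      "- t_minus \<Lambda> \<le> ereal t \<longleftrightarrow> ereal (- t) \<le> t_minus \<Lambda>"
      by (cases "t_plus \<Lambda>"; cases "t_minus \<Lambda>"; auto)+
    have ne: "t_minus \<Lambda> < t_plus \<Lambda>" using t_minus_neg t_plus_pos by (rule less_trans)
    show ?thesis
      unfolding Lam_tilde_def t_mirror * deriv_mirror using ne by auto
  qed
  then have "legendre (Lam_tilde (\<lambda>t. \<Lambda> (- t))) y = (SUP t. ereal (- t * - y - Lam_tilde \<Lambda> (- t)))"
    by (simp add: legendre_def mult.commute)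
  also have "\<dots> = (SUP t. ereal (- y * t - Lam_tilde \<Lambda> t))"
  proof (rule antisym)
    show "(SUP t. ereal (- t * - y - Lam_tilde \<Lambda> (- t))) \<le> (SUP t. ereal (- y * t - Lam_tilde \<Lambda> t))"
    proof (rule SUP_least)
      fix t
      show "ereal (- t * - y - Lam_tilde \<Lambda> (- t)) \<le> (SUP t. ereal (- y * t - Lam_tilde \<Lambda> t))"
        by (rule SUP_upper2[of "- t"]) simp_all
    qed
    show "(SUP t. ereal (- y * t - Lam_tilde \<Lambda> t)) \<le> (SUP t. ereal (- t * - y - Lam_tilde \<Lambda> (- t)))"
    proof (rule SUP_least)
      fix t
      show "ereal (- y * t - Lam_tilde \<Lambda> t) \<le> (SUP t. ereal (- t * - y - Lam_tilde \<Lambda> (- t)))"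
        by (rule SUP_upper2[of "- t"]) simp_all
    qed
  qed
  finally show ?thesis by (simp add: legendre_def)
qed

context cgf
begin

lemma exposed_slope:
  assumes fin: "rate y < \<infinity>" and \<rho>: "0 < \<rho>"
  obtains t where "t \<in> \<rat>" "G t < 0" "\<bar>d t - y\<bar> < \<rho>" "ereal (G t) \<le> rate y"
proof (cases "d 0 \<le> y")
  case True
  show ?thesis by (rule exposed_slope_right[OF True fin \<rho>]) (rule that)
next
  case False
  interpret m: cgf "\<lambda>t. \<Lambda> (- t)" by (rule mirror)
  obtain t where t: "t \<in> \<rat>" "m.G t < 0" "\<bar>deriv (\<lambda>t. \<Lambda> (- t)) t - (- y)\<bar> < \<rho>"
    "ereal (m.G t) \<le> legendre (Lam_tilde (\<lambda>t. \<Lambda> (- t))) (- y)"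
  proof (rule m.exposed_slope_right[OF _ _ \<rho>, of "- y"])
    show "deriv (\<lambda>t. \<Lambda> (- t)) 0 \<le> - y" using False by (simp add: deriv_mirror)
    show "legendre (Lam_tilde (\<lambda>t. \<Lambda> (- t))) (- y) < \<infinity>" using fin by (simp add: rate_mirror)
  qed
  have "m.G t = G (- t)" by (simp add: m.G_def G_def deriv_mirror)
  then show ?thesis using that[of "- t"] t by (simp add: deriv_mirror rate_mirror abs_minus_commute)
qed

lemma chernoff_left:
  assumes y: "y \<le> d 0" and a: "ereal a < rate y"
  obtains s where "s \<le> 0" "0 < s * y - \<Lambda> s \<or> a < s * y - \<Lambda> s"
proof -
  interpret m: cgf "\<lambda>t. \<Lambda> (- t)" by (rule mirror)
  obtain s where s: "0 \<le> s" "0 < s * - y - \<Lambda> (- s) \<or> a < s * - y - \<Lambda> (- s)"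
  proof (rule m.chernoff_right[of "- y" a])
    show "deriv (\<lambda>t. \<Lambda> (- t)) 0 \<le> - y" using y by (simp add: deriv_mirror)
    show "ereal a < legendre (Lam_tilde (\<lambda>t. \<Lambda> (- t))) (- y)" using a by (simp add: rate_mirror)
  qed
  then show ?thesis using that[of "- s"] by simp
qed

end

section \<open>The large deviation principle\<close>

lemma emeasure_Z:
  assumes "B \<in> sets borel"
  shows "emeasure (Z x n) B = of_nat (card {u \<in> generation x n. position x u \<in> B})"
proof -
  have "emeasure (Z x n) B = emeasure (count_space (generation x n)) (position x -` B \<inter> generation x n)"
    using assms unfolding Z_def by (subst emeasure_distr) auto
  also have "\<dots> = of_nat (card (position x -` B \<inter> generation x n))"
    by (subst emeasure_count_space_finite) (auto intro: finite_subset[OF _ finite_generation])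
  also have "position x -` B \<inter> generation x n = {u \<in> generation x n. position x u \<in> B}" by auto
  finally show ?thesis .
qed

lemma scaled_borel:
  assumes A: "A \<in> sets (borel :: real measure)" and c: "c \<noteq> (0 :: real)"
  shows "(\<lambda>x. c * x) ` A \<in> sets borel"
proof -
  have eq: "(\<lambda>x. c * x) ` A = (\<lambda>y. y / c) -` A \<inter> space borel"
    using c by (force simp: image_iff)
  have "(\<lambda>y. y / c) \<in> borel_measurable borel" by measurable
  from measurable_sets[OF this A] show ?thesis unfolding eq .
qed

lemma elog_of_nat: "elog (of_nat k) = (if k = 0 then -\<infinity> else ereal (ln (real k)))"
  by (auto simp: elog_def ennreal_of_nat_eq_real_of_nat)

text \<open>One realization of the tree with the countably many bounds that hold almost surely.
  Everything below is deterministic, so no further null set depends on the Borel set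
  \<open>A\<close>.\<close>

locale ldp_tree = cgf +
  fixes x :: "nat list \<Rightarrow> mark"
  assumes upper: "t \<in> \<rat> \<Longrightarrow> \<forall>\<^sub>F n in sequentially.
      (\<Sum>u\<in>generation x n. exp (t * position x u)) \<le> exp (n * (\<Lambda> t + 1 / Suc k))"
    and lower: "t \<in> \<rat> \<Longrightarrow> t * deriv \<Lambda> t < \<Lambda> t \<Longrightarrow> \<forall>\<^sub>F n in sequentially.
      exp (n * (\<Lambda> t - t * deriv \<Lambda> t - 1 / Suc k)) \<le>
      card {u \<in> generation x n. \<bar>position x u - n * deriv \<Lambda> t\<bar> \<le> 1 / Suc k * n}"
begin

abbreviation count :: "nat \<Rightarrow> real set \<Rightarrow> nat" where
  "count n B \<equiv> card {u \<in> generation x n. position x u \<in> B}"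

definition rn :: "real set \<Rightarrow> nat \<Rightarrow> ereal" where
  "rn A n = ereal (1 / real n) * elog (emeasure (Z x n) ((\<lambda>x. real n * x) ` A))"

lemma rn_eq:
  assumes "A \<in> sets borel" "0 < n"
  shows "rn A n = (if count n ((\<lambda>x. real n * x) ` A) = 0 then -\<infinity>
    else ereal (ln (count n ((\<lambda>x. real n * x) ` A)) / n))"
proof -
  have "(\<lambda>x. real n * x) ` A \<in> sets borel" using assms by (intro scaled_borel) auto
  from emeasure_Z[OF this, of x n] show ?thesis
    unfolding rn_def elog_of_nat using assms(2) by (simp add: elog_of_nat)
qed

lemma count_mono: "B \<subseteq> C \<Longrightarrow> count n B \<le> count n C"
  by (rule card_mono) auto

text \<open>Markov's inequality for the counting measure of a single tree. Writing the half line as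
  \<open>s * (n * y) \<le> s * z\<close> covers right tails for positive \<open>s\<close> and left
  tails for negative \<open>s\<close>.\<close>

lemma tail_count:
  fixes s y b :: real
  assumes s: "s \<in> \<rat>" and b: "b < s * y - \<Lambda> s"
  shows "\<forall>\<^sub>F n in sequentially. count n {z. s * (n * y) \<le> s * z} \<le> exp (- (real n * b))"
proof -
  obtain k where k: "1 / real (Suc k) < s * y - \<Lambda> s - b"
    using nat_approx_posE[of "s * y - \<Lambda> s - b"] b by auto
  from upper[OF s, of k] show ?thesis
  proof eventually_elim
    case (elim n)
    let ?U = "{u \<in> generation x n. position x u \<in> {z. s * (n * y) \<le> s * z}}"
    have "exp (s * (n * y)) * card ?U = (\<Sum>u\<in>?U. exp (s * (n * y)))" by simp
    also have "\<dots> \<le> (\<Sum>u\<in>?U. exp (s * position x u))" by (intro sum_mono) auto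
    also have "\<dots> \<le> (\<Sum>u\<in>generation x n. exp (s * position x u))" by (intro sum_mono2) auto
    also note elim
    finally have "exp (- (s * (n * y))) * (exp (s * (n * y)) * card ?U) \<le>
        exp (- (s * (n * y))) * exp (n * (\<Lambda> s + 1 / Suc k))"
      by (intro mult_left_mono) auto
    then have "card ?U \<le> exp (n * (\<Lambda> s + 1 / Suc k) - s * (n * y))"
      by (simp add: mult.assoc[symmetric] exp_add[symmetric])
    also have "\<dots> \<le> exp (- (real n * b))"
    proof -
      have "n * (\<Lambda> s + 1 / Suc k - s * y) \<le> n * (- b)" using k by (intro mult_left_mono) auto
      then show ?thesis by (simp add: algebra_simps)
    qed
    finally show ?case .
  qed
qed

text \<open>\<open>chernoff_right\<close> and \<open>chernoff_left\<close> produce real exponents,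
  whereas the exponential sums are controlled at rational ones; continuity of \<Lambda> bridges the
  gap.\<close>

lemma rational_near:
  fixes s y b :: real
  assumes b: "b < s * y - \<Lambda> s"
  obtains e where "0 < e" "\<And>s'. \<bar>s' - s\<bar> < e \<Longrightarrow> b < s' * y - \<Lambda> s'"
proof -
  have "isCont (\<lambda>s. s * y - \<Lambda> s) s" by (intro continuous_intros \<Lambda>_cont)
  then have "((\<lambda>s. s * y - \<Lambda> s) \<longlongrightarrow> s * y - \<Lambda> s) (nhds s)"
    unfolding isCont_def tendsto_at_iff_tendsto_nhds[of "\<lambda>s. s * y - \<Lambda> s" s] .
  from order_tendstoD(1)[OF this b] show ?thesis
    using that unfolding eventually_nhds_metric dist_real_def by blast
qed

lemma zero_from_tail:
  fixes a b :: real
  assumes "\<forall>\<^sub>F n in sequentially. real (c n) \<le> exp (- (real n * b))" "0 < b"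
  shows "\<forall>\<^sub>F n in sequentially. real (c n) \<le> exp (- (real n * a))"
  using assms(1) eventually_gt_at_top[of 0]
proof eventually_elim
  case (elim n)
  have "exp (- (real n * b)) < 1" using elim(2) assms(2) by simp
  then have "real (c n) < 1" using elim(1) by linarith
  then show ?case by simp
qed

lemma tail_right:
  fixes a y :: real
  assumes y: "d 0 \<le> y" and a: "ereal a < rate y"
  shows "\<forall>\<^sub>F n in sequentially. count n {n * y..} \<le> exp (- (real n * a))"
proof -
  have tail: "\<forall>\<^sub>F n in sequentially. count n {n * y..} \<le> exp (- (real n * b))"
    if sb: "0 \<le> s" "b < s * y - \<Lambda> s" for s b :: real
  proof -
    obtain e where e: "0 < e" "\<And>s'. \<bar>s' - s\<bar> < e \<Longrightarrow> b < s' * y - \<Lambda> s'"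
      by (rule rational_near[OF sb(2)]) blast
    \<comment> \<open>\<open>s\<close> may be 0, so \<open>q\<close> is taken above it: its sign
      remains the right one for the half line.\<close>
    obtain q where q: "q \<in> \<rat>" "s < q" "q < s + e" using Rats_dense_in_real[of s "s + e"] e(1) by auto
    have "b < q * y - \<Lambda> q" using q by (intro e(2)) auto
    from tail_count[OF q(1) this] show ?thesis
    proof eventually_elim
      case (elim n)
      have "{n * y..} \<subseteq> {z. q * (n * y) \<le> q * z}" using q(2) sb(1) by auto
      from count_mono[OF this, of n] elim show ?case by linarith
    qed
  qed
  obtain s where s: "0 \<le> s" "0 < s * y - \<Lambda> s \<or> a < s * y - \<Lambda> s"
    by (rule chernoff_right[OF y a])
  from s(2) show ?thesis
  proof
    assume pos: "0 < s * y - \<Lambda> s"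
    then have "(s * y - \<Lambda> s) / 2 < s * y - \<Lambda> s" by simp
    from tail[OF s(1) this] show ?thesis by (rule zero_from_tail) (use pos in simp)
  qed (rule tail[OF s(1)])
qed

lemma tail_left:
  fixes a y :: real
  assumes y: "y \<le> d 0" and a: "ereal a < rate y"
  shows "\<forall>\<^sub>F n in sequentially. count n {..n * y} \<le> exp (- (real n * a))"
proof -
  have tail: "\<forall>\<^sub>F n in sequentially. count n {..n * y} \<le> exp (- (real n * b))"
    if sb: "s \<le> 0" "b < s * y - \<Lambda> s" for s b :: real
  proof -
    obtain e where e: "0 < e" "\<And>s'. \<bar>s' - s\<bar> < e \<Longrightarrow> b < s' * y - \<Lambda> s'"
      by (rule rational_near[OF sb(2)]) blast
    obtain q where q: "q \<in> \<rat>" "s - e < q" "q < s" using Rats_dense_in_real[of "s - e" s] e(1) by auto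
    have "b < q * y - \<Lambda> q" using q by (intro e(2)) auto
    from tail_count[OF q(1) this] show ?thesis
    proof eventually_elim
      case (elim n)
      have "{..n * y} \<subseteq> {z. q * (n * y) \<le> q * z}" using q(3) sb(1) by auto
      from count_mono[OF this, of n] elim show ?case by linarith
    qed
  qed
  obtain s where s: "s \<le> 0" "0 < s * y - \<Lambda> s \<or> a < s * y - \<Lambda> s"
    by (rule chernoff_left[OF y a])
  from s(2) show ?thesis
  proof
    assume pos: "0 < s * y - \<Lambda> s"
    then have "(s * y - \<Lambda> s) / 2 < s * y - \<Lambda> s" by simp
    from tail[OF s(1) this] show ?thesis by (rule zero_from_tail) (use pos in simp)
  qed (rule tail[OF s(1)])
qed

lemma count_upper:
  fixes a :: real
  assumes a: "\<And>y. y \<in> closure A \<Longrightarrow> ereal a < rate y"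
  shows "\<forall>\<^sub>F n in sequentially. count n ((\<lambda>x. real n * x) ` A) \<le> 2 * exp (- (real n * a))"
proof -
  have right: "\<forall>\<^sub>F n in sequentially. count n ((\<lambda>x. real n * x) ` (A \<inter> {d 0..})) \<le> exp (- (real n * a))"
  proof (cases "closure A \<inter> {d 0..} = {}")
    case True
    then have "A \<inter> {d 0..} = {}" using closure_subset[of A] by auto
    then show ?thesis by simp
  next
    case False
    \<comment> \<open>The point of the closure nearest to \<open>d 0\<close> on this side: the set
      lies beyond it, and the hypothesis on \<open>a\<close> applies to it because it belongs to the
      closure.\<close>
    define y where "y = Inf (closure A \<inter> {d 0..})"
    have bdd: "bdd_below (closure A \<inter> {d 0..})" by (rule bdd_belowI[of _ "d 0"]) simp
    have "y \<in> closure A \<inter> {d 0..}"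
      unfolding y_def using False bdd by (intro closed_contains_Inf closed_Int) auto
    then have y: "d 0 \<le> y" "ereal a < rate y" using a by auto
    have yle: "y \<le> z" if "z \<in> A" "d 0 \<le> z" for z
      unfolding y_def using that closure_subset[of A] by (intro cInf_lower bdd) auto
    from tail_right[OF y] show ?thesis
    proof eventually_elim
      case (elim n)
      have "(\<lambda>x. real n * x) ` (A \<inter> {d 0..}) \<subseteq> {n * y..}"
        using yle by (auto intro: mult_left_mono)
      from count_mono[OF this, of n] elim show ?case by linarith
    qed
  qed
  have left: "\<forall>\<^sub>F n in sequentially. count n ((\<lambda>x. real n * x) ` (A \<inter> {..d 0})) \<le> exp (- (real n * a))"
  proof (cases "closure A \<inter> {..d 0} = {}")
    case True
    then have "A \<inter> {..d 0} = {}" using closure_subset[of A] by auto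
    then show ?thesis by simp
  next
    case False
    define y where "y = Sup (closure A \<inter> {..d 0})"
    have bdd: "bdd_above (closure A \<inter> {..d 0})" by (rule bdd_aboveI[of _ "d 0"]) simp
    have "y \<in> closure A \<inter> {..d 0}"
      unfolding y_def using False bdd by (intro closed_contains_Sup closed_Int) auto
    then have y: "y \<le> d 0" "ereal a < rate y" using a by auto
    have yle: "z \<le> y" if "z \<in> A" "z \<le> d 0" for z
      unfolding y_def using that closure_subset[of A] by (intro cSup_upper bdd) auto
    from tail_left[OF y] show ?thesis
    proof eventually_elim
      case (elim n)
      have "(\<lambda>x. real n * x) ` (A \<inter> {..d 0}) \<subseteq> {..n * y}"
        using yle by (auto intro: mult_left_mono)
      from count_mono[OF this, of n] elim show ?case by linarith
    qed
  qed
  from right left show ?thesis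
  proof eventually_elim
    case (elim n)
    let ?h = "\<lambda>x. real n * x"
    have "A = (A \<inter> {d 0..}) \<union> (A \<inter> {..d 0})" by auto
    then have "{u \<in> generation x n. position x u \<in> ?h ` A} =
        {u \<in> generation x n. position x u \<in> ?h ` (A \<inter> {d 0..})} \<union>
        {u \<in> generation x n. position x u \<in> ?h ` (A \<inter> {..d 0})}" by blast
    then have "count n (?h ` A) \<le> count n (?h ` (A \<inter> {d 0..})) + count n (?h ` (A \<inter> {..d 0}))"
      by (simp only: card_Un_le)
    then show ?case using elim by linarith
  qed
qed

lemma limsup_le:
  assumes A: "A \<in> sets borel"
  shows "limsup (rn A) \<le> - (INF y\<in>closure A. rate y)"
proof -
  have reorder: "p \<le> - q \<longleftrightarrow> q \<le> - p" for p q :: ereal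
    by (metis ereal_minus_le_minus ereal_uminus_uminus)
  have bound: "limsup (rn A) \<le> - ereal a" if "ereal a < (INF y\<in>closure A. rate y)" for a
  proof -
    have a: "ereal a < rate y" if "y \<in> closure A" for y
      using \<open>ereal a < _\<close> INF_lower[OF that, of rate] by (rule less_le_trans)
    have "\<forall>\<^sub>F n in sequentially. count n ((\<lambda>x. real n * x) ` A) \<le> 2 * exp (- (real n * a))"
      by (rule count_upper) (rule a)
    then have "\<forall>\<^sub>F n in sequentially. rn A n \<le> ereal (ln 2 / n - a)"
      using eventually_gt_at_top[of 0]
    proof eventually_elim
      case (elim n)
      let ?c = "count n ((\<lambda>x. real n * x) ` A)"
      show ?case
      proof (cases "?c = 0")
        case True
        then show ?thesis using rn_eq[OF A elim(2)] by simp
      next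
        case False
        then have "0 < real ?c" by (metis neq0_conv of_nat_0_less_iff)
        then have "ln ?c \<le> ln (2 * exp (- (real n * a)))" using elim(1) by (intro ln_mono) linarith+
        also have "\<dots> = ln 2 - n * a" by (simp add: ln_mult)
        finally have "ln ?c / n \<le> (ln 2 - n * a) / n" by (rule divide_right_mono) simp
        also have "\<dots> = ln 2 / n - a" using elim(2) by (simp add: diff_divide_distrib)
        finally show ?thesis using rn_eq[OF A elim(2)] \<open>0 < real ?c\<close> by simp
      qed
    qed
    then have "limsup (rn A) \<le> limsup (\<lambda>n. ereal (ln 2 / n - a))" by (rule Limsup_mono)
    also have "\<dots> = ereal (- a)"
    proof (rule lim_imp_Limsup)
      have "(\<lambda>n. ln 2 / real n - a) \<longlonglongrightarrow> 0 - a"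
        by (intro tendsto_diff tendsto_const lim_const_over_n)
      then show "(\<lambda>n. ereal (ln 2 / n - a)) \<longlonglongrightarrow> ereal (- a)" by simp
    qed simp
    finally show ?thesis by simp
  qed
  have "(INF y\<in>closure A. rate y) \<le> - limsup (rn A)"
  \<comment> \<open>Testing only real \<open>a\<close> below the infimum also covers an infinite
    infimum, in particular an empty set, for which the limit superior must be
    \<open>-\<infinity>\<close>.\<close>
  proof (rule dense_le)
    fix z assume z: "z < (INF y\<in>closure A. rate y)"
    show "z \<le> - limsup (rn A)"
    proof (cases z)
      case (real a)
      then show ?thesis using bound[of a] z reorder by metis
    qed (use z in auto)
  qed
  then show ?thesis using reorder by metis
qed

text \<open>A point of finite rate inside \<open>A\<close> is replaced by a nearby exposed slope
  with no larger cost, around which the particles have been counted. Working with numbers above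
  \<open>rate y\<close> makes points of infinite rate trivial.\<close>

lemma liminf_ge:
  assumes A: "A \<in> sets borel"
  shows "- (INF y\<in>interior A. rate y) \<le> liminf (rn A)"
proof -
  have "- liminf (rn A) \<le> rate y" if y: "y \<in> interior A" for y
  proof (rule dense_ge)
    fix z assume z: "rate y < z"
    show "- liminf (rn A) \<le> z"
    proof (cases z)
      case (real b)
      obtain e where e: "0 < e" "ball y e \<subseteq> A" using y unfolding mem_interior by blast
      have "rate y < \<infinity>" using z real by (auto intro: less_trans)
      then obtain t where t: "t \<in> \<rat>" "G t < 0" "\<bar>d t - y\<bar> < e / 2" "ereal (G t) \<le> rate y"
        using exposed_slope[of y "e / 2"] e(1) by auto
      have "G t < b" using t(4) z real by (metis le_less_trans less_ereal.simps(1))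
      \<comment> \<open>The error \<open>1 / Suc k\<close> is both a window and a loss in the
        exponent: \<open>e / 2\<close> keeps the window inside the ball around \<open>y\<close>, and
        \<open>b - G t\<close> keeps the exponent above \<open>- b\<close>.\<close>
      define m where "m = min (e / 2) (b - G t)"
      have "0 < m" using e(1) \<open>G t < b\<close> by (simp add: m_def)
      then obtain k where k: "1 / real (Suc k) < m" using nat_approx_posE by blast
      have strict: "t * d t < \<Lambda> t" using t(2) by (simp add: G_def)
      have "\<forall>\<^sub>F n in sequentially. ereal (- b) \<le> rn A n"
        using lower[OF t(1) strict, of k] eventually_gt_at_top[of 0]
      proof eventually_elim
        case (elim n)
        note le = elim(1) and n = elim(2)
        let ?c = "count n ((\<lambda>x. real n * x) ` A)"
        have "card {u \<in> generation x n. \<bar>position x u - n * d t\<bar> \<le> 1 / Suc k * n} \<le> ?c"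
        proof (rule card_mono)
          show "{u \<in> generation x n. \<bar>position x u - n * d t\<bar> \<le> 1 / Suc k * n} \<subseteq>
              {u \<in> generation x n. position x u \<in> (\<lambda>x. real n * x) ` A}"
          proof safe
            fix u assume u: "\<bar>position x u - n * d t\<bar> \<le> 1 / Suc k * n"
            have "position x u / n - d t = (position x u - n * d t) / n"
              using n by (simp add: diff_divide_distrib)
            then have "\<bar>position x u / n - d t\<bar> = \<bar>position x u - n * d t\<bar> / n"
              using n by simp
            also have "\<dots> \<le> 1 / Suc k" using u n by (simp add: pos_divide_le_eq)
            finally have "\<bar>position x u / n - d t\<bar> < e / 2" using k by (simp add: m_def)
            then have "\<bar>position x u / n - y\<bar> < e" using t(3) by linarith
            then have "position x u / n \<in> A" using e(2) by (auto simp: dist_real_def abs_minus_commute)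
            then show "position x u \<in> (\<lambda>x. real n * x) ` A"
              using n by (intro image_eqI[of _ _ "position x u / n"]) auto
          qed
        qed simp
        then have c: "exp (n * (\<Lambda> t - t * d t - 1 / Suc k)) \<le> ?c" using le by linarith
        then have c0: "?c \<noteq> 0" using exp_gt_zero[of "n * (\<Lambda> t - t * d t - 1 / Suc k)"] by linarith
        have "ln (exp (n * (\<Lambda> t - t * d t - 1 / Suc k))) \<le> ln ?c" using c exp_gt_zero by (rule ln_mono)
        then have "n * (\<Lambda> t - t * d t - 1 / Suc k) \<le> ln ?c" by simp
        moreover have "n * (- b) \<le> n * (\<Lambda> t - t * d t - 1 / Suc k)"
          using k by (intro mult_left_mono) (auto simp: m_def G_def)
        ultimately have "- b * n \<le> ln ?c" by (simp add: mult.commute)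
        then have "- b \<le> ln ?c / n" using n by (simp add: pos_le_divide_eq)
        then show "ereal (- b) \<le> rn A n" using rn_eq[OF A n] c0 by simp
      qed
      then have "ereal (- b) \<le> liminf (rn A)" by (rule Liminf_bounded)
      then show ?thesis using real by (simp add: ereal_uminus_le_reorder)
    qed (use z in auto)
  qed
  then have "- liminf (rn A) \<le> (INF y\<in>interior A. rate y)" by (rule INF_greatest)
  then show ?thesis by (simp add: ereal_uminus_le_reorder)
qed

end

theorem theorem3p2:
  fixes M :: "'w measure" and \<Theta> :: "'e measure" and \<eta> :: "'e \<Rightarrow> mark measure"
    and \<xi> :: "nat \<Rightarrow> 'w \<Rightarrow> 'e" and X :: "nat list \<Rightarrow> 'w \<Rightarrow> mark"
  defines "env \<equiv> \<lambda>\<omega> n. \<xi> n \<omega>"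
    and "marks \<equiv> \<lambda>\<omega> u. X u \<omega>"
    and "rate \<equiv> legendre (Lam_tilde (Lam M \<eta> \<xi>))"
  assumes "bwre M \<Theta> \<eta> \<xi> X"
    and "(\<integral>\<^sup>+\<omega>. e2ennreal \<bar>elog (m0 \<eta> (env \<omega>))\<bar> \<partial>M) < \<infinity>"
    and "0 < (\<integral>\<omega>. real_of_ereal (elog (m0 \<eta> (env \<omega>))) \<partial>M)"
    and "(\<integral>\<^sup>+\<omega>. of_nat (fst (X [] \<omega>)) / m0 \<eta> (env \<omega>) *
            ennreal (max 0 (ln (real (fst (X [] \<omega>))))) \<partial>M) < \<infinity>"
    and "AE \<omega> in M. 1 \<le> fst (X [] \<omega>)"
    and "integrable M (\<lambda>\<omega>. snd (X [] \<omega>) 0)"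
    and "\<And>t::real. (\<integral>\<^sup>+\<omega>. e2ennreal \<bar>elog (m0_fun \<eta> (env \<omega>) t)\<bar> \<partial>M) < \<infinity>"
    and "\<And>t::real. (\<integral>\<^sup>+\<omega>. ennreal \<bar>m0_log_deriv \<eta> (env \<omega>) t\<bar> \<partial>M) < \<infinity>"
  shows "AE \<omega> in M. \<forall>A \<in> sets (borel :: real measure).
      - (INF x \<in> interior A. rate x)
        \<le> liminf (\<lambda>n. ereal (1 / real n) * elog (emeasure (Z (marks \<omega>) n) ((\<lambda>x. real n * x) ` A))) \<and>
      liminf (\<lambda>n. ereal (1 / real n) * elog (emeasure (Z (marks \<omega>) n) ((\<lambda>x. real n * x) ` A)))
        \<le> limsup (\<lambda>n. ereal (1 / real n) * elog (emeasure (Z (marks \<omega>) n) ((\<lambda>x. real n * x) ` A))) \<and>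
      limsup (\<lambda>n. ereal (1 / real n) * elog (emeasure (Z (marks \<omega>) n) ((\<lambda>x. real n * x) ` A)))
        \<le> - (INF x \<in> closure A. rate x)"
proof -
  interpret B: bwre_model M \<Theta> \<eta> \<xi> X
    using assms(4,6,8,9,10) unfolding env_def by (intro bwre_model.intro)
  let ?\<Lambda> = "Lam M \<eta> \<xi>"
  interpret C: cgf ?\<Lambda>
    by (rule cgf.intro[OF B.Lam_convex B.Lam_DERIV B.Lam_0_pos])
  \<comment> \<open>Countably many exponents \<open>t\<close> and errors \<open>1 / Suc k\<close>
    leave a single exceptional null set, fixed before \<open>A\<close> is chosen.\<close>
  have upper: "AE \<omega> in M. \<forall>t\<in>\<rat>. \<forall>k. \<forall>\<^sub>F n in sequentially.
      (\<Sum>u\<in>generation (marks \<omega>) n. exp (t * position (marks \<omega>) u)) \<le> exp (n * (?\<Lambda> t + 1 / Suc k))"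
    unfolding marks_def AE_ball_countable[OF countable_rat] AE_all_countable
    using B.exp_sum_upper by simp
  have lower: "AE \<omega> in M. \<forall>t\<in>{t\<in>\<rat>. t * deriv ?\<Lambda> t < ?\<Lambda> t}. \<forall>k. \<forall>\<^sub>F n in sequentially.
      exp (n * (?\<Lambda> t - t * deriv ?\<Lambda> t - 1 / Suc k)) \<le>
      card {u \<in> generation (marks \<omega>) n. \<bar>position (marks \<omega>) u - n * deriv ?\<Lambda> t\<bar> \<le> 1 / Suc k * n}"
  proof -
    have cnt: "countable {t\<in>\<rat>. t * deriv ?\<Lambda> t < ?\<Lambda> t}"
      by (rule countable_subset[OF _ countable_rat]) auto
    show ?thesis
      unfolding marks_def AE_ball_countable[OF cnt] AE_all_countable
    proof (intro ballI allI)
      fix t :: real and k :: nat assume "t \<in> {t\<in>\<rat>. t * deriv ?\<Lambda> t < ?\<Lambda> t}"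
      then have "t * deriv ?\<Lambda> t < ?\<Lambda> t" by simp
      from B.count_lower[OF this, of "1 / Suc k"]
      show "AE \<omega> in M. \<forall>\<^sub>F n in sequentially. exp (n * (?\<Lambda> t - t * deriv ?\<Lambda> t - 1 / Suc k)) \<le>
          card {u \<in> generation (\<lambda>u. X u \<omega>) n. \<bar>position (\<lambda>u. X u \<omega>) u - n * deriv ?\<Lambda> t\<bar> \<le> 1 / Suc k * n}"
        by simp
    qed
  qed
  from upper lower show ?thesis
  proof eventually_elim
    case (elim \<omega>)
    interpret T: ldp_tree ?\<Lambda> "marks \<omega>"
      by (rule ldp_tree.intro[OF C.cgf_axioms], rule ldp_tree_axioms.intro) (use elim in blast)+
    show ?case
      using T.liminf_ge T.limsup_le Liminf_le_Limsup[of sequentially]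
      unfolding rate_def T.rn_def[abs_def] by auto
  qed
qed

end
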